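(* Let $\Omega=\Omega_{12}\times\Omega_3\subset\mathbb{R}^3$ be a bounded cylindrical domain, where $\Omega_{12}\subset\mathbb{R}^2$ is a bounded domain with Lipschitz boundary and $\Omega_3\subset\mathbb{R}$ is a bounded open interval. Let $T>0$, $I=(0,T)$, and let $\mu_0,m_0>0$ be constants. Let $G=\mathrm{diag}(G_{11},G_{22},0)\in\mathbb{R}^{3\times3}$ with $G_{11}\neq0$ and $G_{22}\ne0$ (so $\mathrm{rank}(G)=2$, the field free line case), let $p\in(L^\infty(\Omega))^3$, and let $h=(h_1,h_2,h_3)\in(H^s(I))^3$ with $s>\frac32$ and $h_3\equiv0$. Write $G'=\mathrm{diag}(G_{11},G_{22})$ and $h'=(h_1,h_2)$, and assume: (i) $\sup_{t\in[0,T]}|\dot h'(t)|^{-1}<\infty$; (ii) $(G')^{-1}h'(t)\in\Omega_{12}$ for every $t\in I$, and there is a number $N_h$ such that for every $y\in\Omega_{12}$ there exist at most $N_h$ distinct $t\in I$ with $h'(t)=G'y$. Let $H(x,t)=Gx-h(t)$ (whose third component vanishes) and let $\widetilde F$ be the limit ($\beta\to\infty$) integral operator $$(\widetilde F c)(t)=\int_\Omega c(x)\tilde\kappa(x,t)\,\mathrm{d}x,\qquad \tilde\kappa=\mu_0m_0\,p^t\left(-\frac{HH^t}{|H|^3}+\frac1{|H|}I_3\right)\dot H .$$ Then for any $\epsilon\in(0,\frac14)$ there is a constant $C$ independent of $n$ such that the singular values $\sigma_n$ of $\widetilde F$ (as an operator from $L^2(\Omega)$ to $L^2(I)$, ordered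 nonincreasingly) satisfy $\sigma_n\le C n^{-\frac14+\epsilon}$.
   Context: The superscript $t$ on a vector denotes transpose, $|\cdot|$ is the Euclidean norm, $I_3$ is the $3\times3$ identity matrix, and a dot denotes the time derivative, so $\dot H(x,t)=-\dot h(t)$. $H^s(I)$ is the $L^2$-based Sobolev space (Sobolev--Slobodeckij for non-integer $s$). *)

theory Defs
  imports "HOL-Analysis.Analysis"
begin

section \<open>Domains\<close>

text \<open>
  The boundary is locally the graph of a Lipschitz function, with the set strictly on one side.
  The local coordinates are \<open>(y, \<tau>)\<close> with \<open>x = y + \<tau> e\<close>, where \<open>e\<close> is a unit vector and \<open>y\<close>
  ranges over the hyperplane orthogonal to \<open>e\<close>.
\<close>

definition lipschitz_boundary :: "'a::euclidean_space set \<Rightarrow> bool" where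
  "lipschitz_boundary S \<longleftrightarrow>
     (\<forall>z\<in>frontier S. \<exists>r>0. \<exists>e \<gamma> L.
        norm e = 1 \<and> L-lipschitz_on {y. y \<bullet> e = 0} \<gamma> \<and>
        S \<inter> ball z r = {x \<in> ball z r. \<gamma> (x - (x \<bullet> e) *\<^sub>R e) < x \<bullet> e})"

definition bounded_lipschitz_domain :: "'a::euclidean_space set \<Rightarrow> bool" where
  "bounded_lipschitz_domain S \<longleftrightarrow>
     S \<noteq> {} \<and> open S \<and> connected S \<and> bounded S \<and> lipschitz_boundary S"

definition proj12 :: "real^3 \<Rightarrow> real^2" where
  "proj12 x = vector [x$1, x$2]"

definition cylinder :: "(real^2) set \<Rightarrow> real set \<Rightarrow> (real^3) set" where
  "cylinder A B = {x. proj12 x \<in> A \<and> x$3 \<in> B}"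


section \<open>Function spaces\<close>

text \<open>Elements of the Lebesgue spaces are represented by functions; the identification of functions
  that agree almost everywhere is made explicit wherever it matters.\<close>

definition L2 :: "'a measure \<Rightarrow> ('a \<Rightarrow> real) set" where
  "L2 M = {f \<in> borel_measurable M. integrable M (\<lambda>x. (f x)\<^sup>2)}"

definition L2_inner :: "'a measure \<Rightarrow> ('a \<Rightarrow> real) \<Rightarrow> ('a \<Rightarrow> real) \<Rightarrow> real" where
  "L2_inner M f g = (LINT x|M. f x * g x)"

definition L2_norm :: "'a measure \<Rightarrow> ('a \<Rightarrow> real) \<Rightarrow> real" where
  "L2_norm M f = sqrt (L2_inner M f f)"

definition Linfty :: "'a measure \<Rightarrow> ('a \<Rightarrow> 'b::real_normed_vector) set" where
  "Linfty M = {f \<in> borel_measurable M. \<exists>B. AE x in M. norm (f x) \<le> B}"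

definition test_function :: "real set \<Rightarrow> (real \<Rightarrow> real) \<Rightarrow> bool" where
  "test_function U \<phi> \<longleftrightarrow>
     (\<forall>k x. (deriv ^^ k) \<phi> field_differentiable at x) \<and>
     compact (closure {x. \<phi> x \<noteq> 0}) \<and> closure {x. \<phi> x \<noteq> 0} \<subseteq> U"

definition weak_deriv :: "real set \<Rightarrow> nat \<Rightarrow> (real \<Rightarrow> real) \<Rightarrow> (real \<Rightarrow> real) \<Rightarrow> bool" where
  "weak_deriv U k f g \<longleftrightarrow>
     (\<forall>\<phi>. test_function U \<phi> \<longrightarrow>
        (LINT x|lebesgue_on U. f x * (deriv ^^ k) \<phi> x) =
        (-1) ^ k * (LINT x|lebesgue_on U. g x * \<phi> x))"

definition slobodeckij_finite :: "real set \<Rightarrow> real \<Rightarrow> (real \<Rightarrow> real) \<Rightarrow> bool" where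
  "slobodeckij_finite U \<theta> g \<longleftrightarrow>
     (\<integral>\<^sup>+x. (\<integral>\<^sup>+y. ennreal ((g x - g y)\<^sup>2 / \<bar>x - y\<bar> powr (1 + 2 * \<theta>))
        \<partial>lebesgue_on U) \<partial>lebesgue_on U) < \<infinity>"

text \<open>\<open>H\<^sup>s(U)\<close> for an open \<open>U\<close> and \<open>s \<ge> 0\<close>: weak derivatives up to order \<open>\<lfloor>s\<rfloor>\<close> in \<open>L\<^sup>2(U)\<close> and,
  if \<open>s\<close> is not an integer, a finite Slobodeckij seminorm of order \<open>s - \<lfloor>s\<rfloor>\<close> of the highest one.\<close>

definition sobolev_H :: "real \<Rightarrow> real set \<Rightarrow> (real \<Rightarrow> real) set" where
  "sobolev_H s U =
     {f \<in> L2 (lebesgue_on U).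
        (\<forall>j\<le>nat \<lfloor>s\<rfloor>. \<exists>g\<in>L2 (lebesgue_on U). weak_deriv U j f g) \<and>
        (s \<notin> \<int> \<longrightarrow>
          (\<exists>g\<in>L2 (lebesgue_on U).
             weak_deriv U (nat \<lfloor>s\<rfloor>) f g \<and> slobodeckij_finite U (s - \<lfloor>s\<rfloor>) g))}"


section \<open>Operators between \<open>L\<^sup>2\<close> spaces and their singular values\<close>

definition L2_operator ::
  "'a measure \<Rightarrow> 'b measure \<Rightarrow> (('a \<Rightarrow> real) \<Rightarrow> 'b \<Rightarrow> real) \<Rightarrow> bool" where
  "L2_operator M N T \<longleftrightarrow>
     (\<forall>f\<in>L2 M. T f \<in> L2 N) \<and>
     (\<forall>f\<in>L2 M. \<forall>g\<in>L2 M. (AE x in M. f x = g x) \<longrightarrow> (AE t in N. T f t = T g t)) \<and>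
     (\<forall>f\<in>L2 M. \<forall>g\<in>L2 M. \<forall>a b.
        AE t in N. T (\<lambda>x. a * f x + b * g x) t = a * T f t + b * T g t)"

definition compact_L2_operator ::
  "'a measure \<Rightarrow> 'b measure \<Rightarrow> (('a \<Rightarrow> real) \<Rightarrow> 'b \<Rightarrow> real) \<Rightarrow> bool" where
  "compact_L2_operator M N T \<longleftrightarrow>
     L2_operator M N T \<and>
     (\<forall>f :: nat \<Rightarrow> 'a \<Rightarrow> real.
        (\<forall>k. f k \<in> L2 M) \<and> (\<exists>B. \<forall>k. L2_norm M (f k) \<le> B) \<longrightarrow>
        (\<exists>r g. strict_mono (r :: nat \<Rightarrow> nat) \<and> g \<in> L2 N \<and>
           (\<lambda>k. L2_norm N (\<lambda>t. T (f (r k)) t - g t)) \<longlonglongrightarrow> 0))"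

definition L2_adjoint ::
  "'a measure \<Rightarrow> 'b measure \<Rightarrow> (('a \<Rightarrow> real) \<Rightarrow> 'b \<Rightarrow> real) \<Rightarrow> (('b \<Rightarrow> real) \<Rightarrow> 'a \<Rightarrow> real) \<Rightarrow> bool"
where
  "L2_adjoint M N T S \<longleftrightarrow>
     (\<forall>g\<in>L2 N. S g \<in> L2 M) \<and>
     (\<forall>f\<in>L2 M. \<forall>g\<in>L2 N. L2_inner N (T f) g = L2_inner M f (S g))"

text \<open>The eigenspace of \<open>T\<^sup>*T\<close> for the eigenvalue \<open>r\<^sup>2\<close>; the adjoint is unique up to null sets.\<close>

definition singular_space ::
  "'a measure \<Rightarrow> 'b measure \<Rightarrow> (('a \<Rightarrow> real) \<Rightarrow> 'b \<Rightarrow> real) \<Rightarrow> real \<Rightarrow> ('a \<Rightarrow> real) set" where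
  "singular_space M N T r =
     {u \<in> L2 M. \<exists>S. L2_adjoint M N T S \<and> (AE x in M. S (T u) x = r\<^sup>2 * u x)}"

definition L2_independent :: "'a measure \<Rightarrow> nat \<Rightarrow> (nat \<Rightarrow> 'a \<Rightarrow> real) \<Rightarrow> bool" where
  "L2_independent M k u \<longleftrightarrow>
     (\<forall>a. (AE x in M. (\<Sum>i<k. a i * u i x) = 0) \<longrightarrow> (\<forall>i<k. a i = 0))"

text \<open>The dimension, modulo null sets, of the eigenspace: it is \<open>0\<close> unless \<open>r\<^sup>2\<close> is an eigenvalue.\<close>

definition singular_multiplicity ::
  "'a measure \<Rightarrow> 'b measure \<Rightarrow> (('a \<Rightarrow> real) \<Rightarrow> 'b \<Rightarrow> real) \<Rightarrow> real \<Rightarrow> enat" where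
  "singular_multiplicity M N T r =
     Sup {enat k | k. \<exists>u. (\<forall>i<k. u i \<in> singular_space M N T r) \<and> L2_independent M k u}"

text \<open>
  The \<open>n\<close>-th entry (\<open>n \<ge> 1\<close>) of the nonincreasing list of the singular values, repeated according
  to multiplicity: the largest \<open>s > 0\<close> such that at least \<open>n\<close> singular values, counted with
  multiplicity, are \<open>\<ge> s\<close>. The list is continued by zeros if there are fewer than \<open>n\<close> positive
  singular values. This is meaningful for compact \<open>T\<close>.
\<close>

definition singular_value ::
  "'a measure \<Rightarrow> 'b measure \<Rightarrow> (('a \<Rightarrow> real) \<Rightarrow> 'b \<Rightarrow> real) \<Rightarrow> nat \<Rightarrow> real" where
  "singular_value M N T n =
     Sup ({0} \<union> {s. 0 < s \<and> (\<exists>R. finite R \<and> R \<subseteq> {s..} \<and>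
                          enat n \<le> (\<Sum>r\<in>R. singular_multiplicity M N T r))})"


section \<open>The limit integral operator\<close>

definition diag_matrix :: "real^'n \<Rightarrow> real^'n^'n" where
  "diag_matrix d = (\<chi> i j. if i = j then d$i else 0)"

definition outer :: "real^'n \<Rightarrow> real^'n \<Rightarrow> real^'n^'n" where
  "outer v w = (\<chi> i j. v$i * w$j)"

text \<open>Time derivative on \<open>[0,T]\<close>, one-sided at the end points.\<close>

definition time_deriv :: "real \<Rightarrow> (real \<Rightarrow> 'a::real_normed_vector) \<Rightarrow> real \<Rightarrow> 'a" where
  "time_deriv T h t = vector_derivative h (at t within {0..T})"

definition field_H :: "real^3^3 \<Rightarrow> (real \<Rightarrow> real^3) \<Rightarrow> real^3 \<Rightarrow> real \<Rightarrow> real^3" where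
  "field_H G h x t = G *v x - h t"

text \<open>The time derivative of \<open>field_H G h x\<close> is \<open>- time_deriv T h\<close>. The kernel is singular on the null
  set \<open>field_H G h x t = 0\<close>, where division by zero gives it the value \<open>0\<close>.\<close>

definition kappa_limit ::
  "real \<Rightarrow> real \<Rightarrow> real \<Rightarrow> real^3^3 \<Rightarrow> (real^3 \<Rightarrow> real^3) \<Rightarrow> (real \<Rightarrow> real^3) \<Rightarrow> real^3 \<Rightarrow> real \<Rightarrow> real"
where
  "kappa_limit T \<mu>0 m0 G p h x t =
     (let H = field_H G h x t in
      \<mu>0 * m0 *
        (p x \<bullet> ((- ((1 / norm H ^ 3) *\<^sub>R outer H H) + (1 / norm H) *\<^sub>R mat 1)
                  *v (- time_deriv T h t))))"

definition F_limit ::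
  "(real^3) set \<Rightarrow> real \<Rightarrow> real \<Rightarrow> real \<Rightarrow> real^3^3 \<Rightarrow> (real^3 \<Rightarrow> real^3) \<Rightarrow> (real \<Rightarrow> real^3) \<Rightarrow>
     (real^3 \<Rightarrow> real) \<Rightarrow> real \<Rightarrow> real" where
  "F_limit \<Omega> T \<mu>0 m0 G p h c t =
     (LINT x|lebesgue_on \<Omega>. c x * kappa_limit T \<mu>0 m0 G p h x t)"

end

(*
  The kernel is perp H p . dh/dt with H = Gx - h(t), where perp H p is homogeneous of degree -1 in H
  and H vanishes on a line for each t. Freeze H at the n equidistant times t_j = jT/n, cutting off the
  part of the domain where |H(x,t_j)| is less than a constant times 1/n. This gives an operator of rank
  3n whose kernel differs from the given one by at most C n^(-1/4) |H|^(-5/4), since h is Lipschitz.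
  The factor dh/dt is not frozen: it acts as multiplication by a bounded function, so no regularity
  of it is lost.

  Schur's test with |H|^(-5/4) = |H|^(-7/8) |H|^(-3/8) bounds the norm of the difference by
  C n^(-1/4), because |H|^(-7/4) is integrable in x (a two-dimensional singularity) and |H|^(-3/4) is
  integrable in t (a one-dimensional one, as h is a regular C^1 curve), both uniformly in the other
  variable. A combination of more than 3n independent eigenvectors of T*T is annihilated by the rank
  3n operator, so the singular values are bounded by the norm of the difference.

  That h is C^1 is the Sobolev embedding for s > 3/2. It is obtained from comparing the slopes of h on
  nested intervals: for s < 2 their difference is bounded by the Slobodeckij seminorm, for s >= 2 by
  the L^2 norm of the second weak derivative.
*)

theory Submission
  imports Defs "HOL-Library.Diagonal_Subsequence"
begin

section \<open>The space of square integrable functions\<close>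

text \<open>The exponents come from interpolation. With \<delta> of order 1/n, the kernel minus its
  frozen version is bounded by multiples of both |H|^(-1) and \<delta> |H|^(-2), hence by a multiple
  of \<delta>^\<theta> |H|^(-1-\<theta>) for every \<theta> between 0 and 1. Schur's test needs a
  splitting 1 + \<theta> = a + b with 2a < 2 and 2b < 1, so every \<theta> < 1/2 is admissible;
  \<theta> = 1/4 is the one that yields the required rate. The lower bound on the speed of h is
  posed on the closed time interval, so h has to be C^1 up to the end points. Slopes are therefore
  estimated inside the open interval with constants independent of the distance to the ends, and the
  estimates are then carried to the boundary by continuity.\<close>

lemma L2_D:
  assumes "f \<in> L2 M"
  shows L2_measurable: "f \<in> borel_measurable M" and L2_square: "integrable M (\<lambda>x. (f x)\<^sup>2)"
  using assms by (auto simp: L2_def)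

lemma L2_mult_integrable:
  assumes "f \<in> L2 M" "g \<in> L2 M"
  shows "integrable M (\<lambda>x. f x * g x)"
proof (rule Bochner_Integration.integrable_bound)
  show "integrable M (\<lambda>x. (f x)\<^sup>2 + (g x)\<^sup>2)"
    using assms by (auto simp: L2_def)
  show "(\<lambda>x. f x * g x) \<in> borel_measurable M"
    using assms by (auto simp: L2_def)
  have "\<bar>u * v\<bar> \<le> u\<^sup>2 + v\<^sup>2" for u v :: real
  proof -
    have "0 \<le> (\<bar>u\<bar> - \<bar>v\<bar>)\<^sup>2" by simp
    then have "2 * (\<bar>u\<bar> * \<bar>v\<bar>) \<le> u\<^sup>2 + v\<^sup>2" by (simp add: power2_diff mult.assoc)
    moreover have "0 \<le> \<bar>u\<bar> * \<bar>v\<bar>" by simp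
    ultimately show ?thesis unfolding abs_mult by linarith
  qed
  then show "AE x in M. norm (f x * g x) \<le> norm ((f x)\<^sup>2 + (g x)\<^sup>2)"
    by simp
qed

lemma L2_add:
  assumes "f \<in> L2 M" "g \<in> L2 M"
  shows "(\<lambda>x. f x + g x) \<in> L2 M"
proof -
  have "integrable M (\<lambda>x. (f x)\<^sup>2 + 2 * (f x * g x) + (g x)\<^sup>2)"
    using assms L2_mult_integrable[OF assms] by (auto simp: L2_def)
  moreover have "(f x + g x)\<^sup>2 = (f x)\<^sup>2 + 2 * (f x * g x) + (g x)\<^sup>2" for x
    by (simp add: power2_sum)
  ultimately show ?thesis using assms by (auto simp: L2_def)
qed

lemma L2_scale: "f \<in> L2 M \<Longrightarrow> (\<lambda>x. a * f x) \<in> L2 M"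
  by (auto simp: L2_def power_mult_distrib)

lemma L2_diff:
  assumes "f \<in> L2 M" "g \<in> L2 M"
  shows "(\<lambda>x. f x - g x) \<in> L2 M"
  using L2_add[OF assms(1) L2_scale[OF assms(2), of "-1"]] by simp

lemma L2_sum:
  assumes "finite A" "\<And>i. i \<in> A \<Longrightarrow> f i \<in> L2 M"
  shows "(\<lambda>x. \<Sum>i\<in>A. f i x) \<in> L2 M"
  using assms by (induction A rule: finite_induct) (auto simp: L2_def[of M] intro!: L2_add[of _ M, unfolded L2_def, simplified])

lemma L2_inner_commute: "L2_inner M f g = L2_inner M g f"
  by (simp add: L2_inner_def mult.commute)

lemma L2_inner_add:
  assumes "f \<in> L2 M" "g \<in> L2 M" "k \<in> L2 M"
  shows "L2_inner M (\<lambda>x. f x + g x) k = L2_inner M f k + L2_inner M g k"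
  unfolding L2_inner_def distrib_right
  using assms by (intro Bochner_Integration.integral_add L2_mult_integrable)

lemma L2_inner_scale: "L2_inner M (\<lambda>x. a * f x) k = a * L2_inner M f k"
  by (simp add: L2_inner_def mult.assoc)

lemma L2_inner_diff:
  assumes "f \<in> L2 M" "g \<in> L2 M" "k \<in> L2 M"
  shows "L2_inner M (\<lambda>x. f x - g x) k = L2_inner M f k - L2_inner M g k"
  unfolding L2_inner_def left_diff_distrib
  using assms by (intro Bochner_Integration.integral_diff L2_mult_integrable)

lemma L2_inner_sum:
  assumes "finite A" "\<And>i. i \<in> A \<Longrightarrow> f i \<in> L2 M" "k \<in> L2 M"
  shows "L2_inner M (\<lambda>x. \<Sum>i\<in>A. f i x) k = (\<Sum>i\<in>A. L2_inner M (f i) k)"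
  unfolding L2_inner_def sum_distrib_right
  using assms by (intro Bochner_Integration.integral_sum L2_mult_integrable) auto

lemma L2_inner_cong_AE:
  assumes "f \<in> L2 M" "g \<in> L2 M" "k \<in> L2 M" "AE x in M. f x = g x"
  shows "L2_inner M f k = L2_inner M g k"
  unfolding L2_inner_def
  using assms by (intro integral_cong_AE) (auto simp: L2_def)

lemma L2_inner_nonneg: "0 \<le> L2_inner M f f"
  unfolding L2_inner_def by (intro integral_nonneg_AE) auto

lemma L2_norm_nonneg: "0 \<le> L2_norm M f"
  by (simp add: L2_norm_def L2_inner_nonneg)

lemma L2_norm_sq: "(L2_norm M f)\<^sup>2 = L2_inner M f f"
  by (simp add: L2_norm_def L2_inner_nonneg)

lemma L2_norm_scale: "L2_norm M (\<lambda>x. a * f x) = \<bar>a\<bar> * L2_norm M f"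
proof -
  have "L2_inner M (\<lambda>x. a * f x) (\<lambda>x. a * f x) = a\<^sup>2 * L2_inner M f f"
    by (simp add: L2_inner_def power2_eq_square mult.assoc mult.left_commute)
  then show ?thesis by (simp add: L2_norm_def real_sqrt_mult)
qed

lemma L2_inner_self_eq_0:
  assumes "f \<in> L2 M" "L2_inner M f f = 0"
  shows "AE x in M. f x = 0"
  using assms integral_nonneg_eq_0_iff_AE[of M "\<lambda>x. f x * f x"] L2_mult_integrable[of f M f]
  by (auto simp: L2_inner_def)

lemma L2_Cauchy_Schwarz:
  assumes f: "f \<in> L2 M" and g: "g \<in> L2 M"
  shows "\<bar>L2_inner M f g\<bar> \<le> L2_norm M f * L2_norm M g"
proof (cases "L2_norm M f = 0 \<or> L2_norm M g = 0")
  case True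
  have *: "L2_inner M f g = 0" if "L2_norm M f = 0" "f \<in> L2 M" "g \<in> L2 M" for f g
  proof -
    have "AE x in M. f x = 0"
      using that L2_norm_sq[of M f] by (intro L2_inner_self_eq_0) auto
    then have "L2_inner M f g = L2_inner M (\<lambda>x. 0) g"
      using that by (intro L2_inner_cong_AE) (auto simp: L2_def)
    then show ?thesis by (simp add: L2_inner_def)
  qed
  from True show ?thesis
    using *[of f g] *[of g f] f g L2_inner_commute[of M f g] by auto
next
  case False
  define a b where "a = L2_norm M f" and "b = L2_norm M g"
  have pos: "a > 0" "b > 0"
    using False L2_norm_nonneg[of M f] L2_norm_nonneg[of M g] unfolding a_def b_def by auto
  \<comment> \<open>The square of b f + \<sigma> a g is expanded, with \<open>a\<close> and
    \<open>b\<close> the two norms, so that both square terms equal a^2 b^2. The choices \<sigma> =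
    1 and \<sigma> = -1 give the two signs of the absolute value.\<close>
  have main: "0 \<le> 2 * a\<^sup>2 * b\<^sup>2 + 2 * \<sigma> * a * b * L2_inner M f g" if "\<sigma>\<^sup>2 = 1" for \<sigma> :: real
  proof -
    have "0 \<le> (LINT x|M. (b * f x + \<sigma> * a * g x)\<^sup>2)" by (intro integral_nonneg_AE) auto
    also have "(\<lambda>x. (b * f x + \<sigma> * a * g x)\<^sup>2) =
        (\<lambda>x. b\<^sup>2 * (f x * f x) + (2 * \<sigma> * a * b) * (f x * g x) + (\<sigma>\<^sup>2 * a\<^sup>2) * (g x * g x))"
      by (simp add: fun_eq_iff power2_eq_square algebra_simps)
    also have "(LINT x|M. \<dots> x) = b\<^sup>2 * L2_inner M f f + (2 * \<sigma> * a * b) * L2_inner M f g + (\<sigma>\<^sup>2 * a\<^sup>2) * L2_inner M g g"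
      using f g by (simp add: L2_inner_def L2_mult_integrable)
    finally show ?thesis using that by (simp add: a_def b_def L2_norm_sq[symmetric] mult_ac)
  qed
  have "0 \<le> (2 * (a * b)) * (a * b + L2_inner M f g)"
    using main[of 1] by (simp add: algebra_simps power2_eq_square)
  moreover have "0 \<le> (2 * (a * b)) * (a * b - L2_inner M f g)"
    using main[of "-1"] by (simp add: algebra_simps power2_eq_square)
  moreover have "0 < 2 * (a * b)" using pos by simp
  ultimately have "0 \<le> a * b + L2_inner M f g" "0 \<le> a * b - L2_inner M f g"
    using zero_le_mult_iff by (metis not_less)+
  then show ?thesis unfolding a_def b_def by linarith
qed

lemma L2_norm_triangle:
  assumes f: "f \<in> L2 M" and g: "g \<in> L2 M"
  shows "L2_norm M (\<lambda>x. f x + g x) \<le> L2_norm M f + L2_norm M g"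
proof (rule power2_le_imp_le)
  have "(L2_norm M (\<lambda>x. f x + g x))\<^sup>2 = L2_inner M f (\<lambda>x. f x + g x) + L2_inner M g (\<lambda>x. f x + g x)"
    unfolding L2_norm_sq by (intro L2_inner_add f g L2_add)
  also have "L2_inner M f (\<lambda>x. f x + g x) = L2_inner M f f + L2_inner M g f"
    by (subst L2_inner_commute) (intro L2_inner_add f g)
  also have "L2_inner M g (\<lambda>x. f x + g x) = L2_inner M f g + L2_inner M g g"
    by (subst L2_inner_commute) (intro L2_inner_add f g)
  also have "L2_inner M f f + L2_inner M g f + (L2_inner M f g + L2_inner M g g)
     \<le> (L2_norm M f + L2_norm M g)\<^sup>2"
    using L2_Cauchy_Schwarz[OF f g] L2_inner_commute[of M f g]
    by (simp add: power2_sum L2_norm_sq)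
  finally show "(L2_norm M (\<lambda>x. f x + g x))\<^sup>2 \<le> (L2_norm M f + L2_norm M g)\<^sup>2" .
qed (simp add: L2_norm_nonneg)

lemma L2_norm_cong_AE:
  assumes "f \<in> L2 M" "g \<in> L2 M" "AE x in M. f x = g x"
  shows "L2_norm M f = L2_norm M g"
  using L2_inner_cong_AE[of f M g f] L2_inner_cong_AE[of f M g g] assms L2_inner_commute[of M f g]
  by (simp add: L2_norm_def)

lemma nn_integral_L2:
  assumes "f \<in> L2 M"
  shows "(\<integral>\<^sup>+x. ennreal ((f x)\<^sup>2) \<partial>M) = ennreal ((L2_norm M f)\<^sup>2)"
  unfolding L2_norm_sq L2_inner_def
  using L2_square[OF assms] by (subst nn_integral_eq_integral) (auto simp: power2_eq_square)

text \<open>A nonnegative integral always exists, so one estimate of it delivers membership and norm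
  bound together. This is the way back from computations in \<open>ennreal\<close> to
  \<open>L2_norm\<close>.\<close>

lemma L2_bound_nn:
  assumes [measurable]: "f \<in> borel_measurable M"
    and le: "(\<integral>\<^sup>+x. ennreal ((f x)\<^sup>2) \<partial>M) \<le> ennreal (e\<^sup>2)" and e: "0 \<le> e"
  shows "f \<in> L2 M" "L2_norm M f \<le> e"
proof -
  have "integrable M (\<lambda>x. (f x)\<^sup>2)"
    using le by (intro integrableI_nonneg) (auto simp: le_less_trans[OF _ ennreal_less_top])
  then show f: "f \<in> L2 M" by (simp add: L2_def)
  have "(L2_norm M f)\<^sup>2 \<le> e\<^sup>2"
    using le e unfolding nn_integral_L2[OF f] by (simp add: ennreal_le_iff)
  then show "L2_norm M f \<le> e" using e by (rule power2_le_imp_le)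
qed

section \<open>Singular values and approximation by finite rank operators\<close>

text \<open>The rank \<open>m\<close> operator is given by its factors because the argument only
  evaluates the functionals \<open>L2_inner M c (a i)\<close>. For an operator \<open>T\<close> and
  nonnegative \<open>e\<close> this bounds the approximation number of index \<open>m + 1\<close> by
  \<open>e\<close>.\<close>

definition finite_rank_approx ::
  "'a measure \<Rightarrow> 'b measure \<Rightarrow> (('a \<Rightarrow> real) \<Rightarrow> 'b \<Rightarrow> real) \<Rightarrow> nat \<Rightarrow> real \<Rightarrow> bool" where
  "finite_rank_approx M N T m e \<longleftrightarrow>
     (\<exists>a b. (\<forall>i<m. a i \<in> L2 M \<and> b i \<in> L2 N) \<and>
        (\<forall>c\<in>L2 M. L2_norm N (\<lambda>t. T c t - (\<Sum>i<m. L2_inner M c (a i) * b i t)) \<le> e * L2_norm M c))"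

text \<open>Gaussian elimination: an unknown \<open>s0\<close> with nonzero coefficient in the last
  equation is solved for and substituted, which turns \<open>A\<close> into \<open>A'\<close> with
  one unknown fewer. The index set is arbitrary because the unknowns will be pairs of a singular
  value and a position in its eigenspace.\<close>

lemma homogeneous_system_nontrivial:
  fixes A :: "nat \<Rightarrow> 'i \<Rightarrow> real"
  assumes "finite S" "m < card S"
  shows "\<exists>y. (\<exists>s\<in>S. y s \<noteq> 0) \<and> (\<forall>i<m. (\<Sum>s\<in>S. A i s * y s) = 0)"
  using assms
proof (induction m arbitrary: S A)
  case 0
  then have "S \<noteq> {}" by auto
  then show ?case by (intro exI[of _ "\<lambda>_. 1"]) auto
next
  case (Suc m)
  show ?case
  proof (cases "\<forall>s\<in>S. A m s = 0")
    case True
    from Suc.IH[of S A] Suc.prems obtain y where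
      "\<exists>s\<in>S. y s \<noteq> 0" "\<forall>i<m. (\<Sum>s\<in>S. A i s * y s) = 0" by auto
    then show ?thesis using True by (intro exI[of _ y]) (auto simp: less_Suc_eq)
  next
    case False
    then obtain s0 where s0: "s0 \<in> S" "A m s0 \<noteq> 0" by auto
    define S' where "S' = S - {s0}"
    have S': "finite S'" "m < card S'" using Suc.prems s0 by (auto simp: S'_def)
    define A' where "A' i s = A i s - A i s0 * A m s / A m s0" for i s
    from Suc.IH[OF S', of A'] obtain y where
      y: "\<exists>s\<in>S'. y s \<noteq> 0" "\<And>i. i < m \<Longrightarrow> (\<Sum>s\<in>S'. A' i s * y s) = 0" by auto
    define z where "z = y(s0 := - (\<Sum>s\<in>S'. A m s * y s) / A m s0)"
    have sum_z: "(\<Sum>s\<in>S. A i s * z s) = (\<Sum>s\<in>S'. A' i s * y s)" for i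
    proof -
      have "(\<Sum>s\<in>S. A i s * z s) = A i s0 * z s0 + (\<Sum>s\<in>S'. A i s * z s)"
        unfolding S'_def using Suc.prems s0 by (subst sum.remove[of _ s0]) auto
      also have "(\<Sum>s\<in>S'. A i s * z s) = (\<Sum>s\<in>S'. A i s * y s)"
        by (intro sum.cong) (auto simp: z_def S'_def)
      also have "A i s0 * z s0 = - (\<Sum>s\<in>S'. A i s0 * A m s / A m s0 * y s)"
        by (simp add: z_def sum_distrib_left sum_divide_distrib sum_negf mult.assoc)
      finally show ?thesis by (simp add: A'_def left_diff_distrib sum_subtractf)
    qed
    have "(\<Sum>s\<in>S'. A' m s * y s) = 0" using s0 by (simp add: A'_def)
    then have "\<forall>i<Suc m. (\<Sum>s\<in>S. A i s * z s) = 0"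
      using y(2) by (auto simp: sum_z less_Suc_eq)
    moreover have "\<exists>s\<in>S. z s \<noteq> 0"
      using y(1) by (auto simp: z_def S'_def)
    ultimately show ?thesis by blast
  qed
qed

lemma L2_operator_linear:
  assumes "L2_operator M N T" "f \<in> L2 M" "g \<in> L2 M"
  shows "AE t in N. T (\<lambda>x. a * f x + b * g x) t = a * T f t + b * T g t"
  using assms by (simp add: L2_operator_def)

lemma L2_operator_sum:
  assumes T: "L2_operator M N T" and "finite A" "\<And>i. i \<in> A \<Longrightarrow> f i \<in> L2 M"
  shows "AE t in N. T (\<lambda>x. \<Sum>i\<in>A. y i * f i x) t = (\<Sum>i\<in>A. y i * T (f i) t)"
  using assms(2,3)
proof (induction A rule: finite_induct)
  case empty
  have "(\<lambda>x. 0) \<in> L2 M" by (simp add: L2_def)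
  from L2_operator_linear[OF T this this, of 0 0] show ?case by simp
next
  case (insert i A)
  let ?g = "\<lambda>x. \<Sum>i\<in>A. y i * f i x"
  have "f i \<in> L2 M" "?g \<in> L2 M" using insert by (auto intro!: L2_sum L2_scale)
  then have "AE t in N. T (\<lambda>x. y i * f i x + 1 * ?g x) t = y i * T (f i) t + 1 * T ?g t"
    by (rule L2_operator_linear[OF T])
  moreover have "AE t in N. T ?g t = (\<Sum>i\<in>A. y i * T (f i) t)"
    using insert by auto
  ultimately show ?case
    by eventually_elim (use insert in simp)
qed

text \<open>The adjoint moves \<open>T\<close> to the other side. It is chosen separately for each
  \<open>u\<close> and fixed only up to null sets; the eigenvector relation is therefore turned into
  an identity of inner products in which it no longer occurs.\<close>

lemma singular_space_inner:
  assumes "u \<in> singular_space M N T r" "f \<in> L2 M" "T u \<in> L2 N"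
  shows "L2_inner N (T f) (T u) = r\<^sup>2 * L2_inner M f u"
proof -
  obtain S where S: "L2_adjoint M N T S" "AE x in M. S (T u) x = r\<^sup>2 * u x" and u: "u \<in> L2 M"
    using assms(1) by (auto simp: singular_space_def)
  have ST: "S (T u) \<in> L2 M" using S(1) assms(3) by (auto simp: L2_adjoint_def)
  have "L2_inner N (T f) (T u) = L2_inner M f (S (T u))"
    using S(1) assms by (auto simp: L2_adjoint_def)
  also have "\<dots> = L2_inner M (\<lambda>x. r\<^sup>2 * u x) f"
    by (subst L2_inner_commute) (intro L2_inner_cong_AE L2_scale u ST S(2) assms(2))
  finally show ?thesis by (simp add: L2_inner_scale L2_inner_commute)
qed

text \<open>The supremum defining the multiplicity may be infinite. A finite
  \<open>j = Suc i\<close> is nevertheless reached: \<open>i\<close> lies strictly below the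
  supremum, so some admissible \<open>k\<close> exceeds \<open>i\<close>.\<close>

lemma singular_multiplicity_witness:
  assumes "enat j \<le> singular_multiplicity M N T r"
  shows "\<exists>k u. j \<le> k \<and> (\<forall>i<k. u i \<in> singular_space M N T r) \<and> L2_independent M k u"
proof (cases j)
  case 0
  show ?thesis unfolding 0 by (intro exI[of _ 0]) (auto simp: L2_independent_def)
next
  case (Suc i)
  then have "enat i < singular_multiplicity M N T r"
    using assms by (simp add: Suc_ile_eq)
  then obtain k u where "i < k" "\<forall>i<k. u i \<in> singular_space M N T r" "L2_independent M k u"
    unfolding singular_multiplicity_def less_Sup_iff by auto
  then show ?thesis unfolding Suc Suc_le_eq by blast
qed

text \<open>Among \<open>n > m\<close> independent eigenvectors of \<open>T\<^sup>*T\<close> some combination \<open>w\<close> is annihilated by the rank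
  \<open>m\<close> part; on it \<open>T\<close> is both at least \<open>s\<close> and at most \<open>e\<close>.\<close>

lemma singular_value_le_finite_rank:
  assumes T: "L2_operator M N T" and fr: "finite_rank_approx M N T m e"
    and mn: "m < n" and e: "0 \<le> e"
  shows "singular_value M N T n \<le> e"
  unfolding singular_value_def
proof (rule cSup_least)
  fix s assume "s \<in> {0} \<union> {s. 0 < s \<and> (\<exists>R. finite R \<and> R \<subseteq> {s..} \<and>
                          enat n \<le> (\<Sum>r\<in>R. singular_multiplicity M N T r))}"
  moreover have "s \<le> e" if s: "0 < s" and R: "finite R" "R \<subseteq> {s..}"
    and nR: "enat n \<le> (\<Sum>r\<in>R. singular_multiplicity M N T r)" for R
  proof -
    \<comment> \<open>Multiplicities may be infinite. Truncation at \<open>n\<close> keeps the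
      chosen families finite, and their total size over \<open>R\<close> still reaches
      \<open>n\<close>.\<close>
    have "\<exists>k u. (\<forall>i<k. u i \<in> singular_space M N T r) \<and> L2_independent M k u \<and>
        min (enat n) (singular_multiplicity M N T r) \<le> enat k" for r
    proof -
      obtain j where j: "min (enat n) (singular_multiplicity M N T r) = enat j"
        by (metis enat_iless linorder_not_less min.cobounded1 nless_le enat_ile)
      then have "enat j \<le> singular_multiplicity M N T r" by (metis min.cobounded2)
      from singular_multiplicity_witness[OF this] show ?thesis using j by auto
    qed
    then obtain k u where u: "\<And>r i. i < k r \<Longrightarrow> u r i \<in> singular_space M N T r"
      and ind: "\<And>r. L2_independent M (k r) (u r)"
      and k: "\<And>r. min (enat n) (singular_multiplicity M N T r) \<le> enat (k r)" by metis
    have nk: "n \<le> (\<Sum>r\<in>R. k r)"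
    proof (cases "\<exists>r\<in>R. enat n \<le> singular_multiplicity M N T r")
      case True
      then obtain r where r: "r \<in> R" "n \<le> k r" using k by (metis enat_ord_simps(1) min.absorb1)
      then show ?thesis using member_le_sum[of r R k] R(1) by auto
    next
      case False
      have "enat n \<le> (\<Sum>r\<in>R. enat (k r))"
        using nR by (rule order_trans) (intro sum_mono, metis False k linorder_linear min.absorb2)
      also have "\<dots> = enat (\<Sum>r\<in>R. k r)"
        by (induction R rule: infinite_finite_induct) (auto simp: zero_enat_def)
      finally show ?thesis by simp
    qed
    define Q where "Q = Sigma R (\<lambda>r. {..<k r})"
    define v where "v q = u (fst q) (snd q)" for q
    have finQ: "finite Q" and cardQ: "m < card Q"
      using R nk mn by (auto simp: Q_def)
    have vs: "v q \<in> singular_space M N T (fst q)" if "q \<in> Q" for q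
      using that u by (auto simp: Q_def v_def)
    have v: "v q \<in> L2 M" if "q \<in> Q" for q using vs[OF that] by (simp add: singular_space_def)
    have TL: "T f \<in> L2 N" if "f \<in> L2 M" for f using T that by (auto simp: L2_operator_def)
    \<comment> \<open>Eigenspaces of different values are orthogonal: the inner product of the two
      images is evaluated in both orders. The squares of the values differ because all elements of
      \<open>R\<close> are at least \<open>s\<close> and hence positive.\<close>
    have orth: "L2_inner M (v q) (v q') = 0" if q: "q \<in> Q" "q' \<in> Q" and ne: "fst q \<noteq> fst q'" for q q'
    proof -
      have "L2_inner N (T (v q)) (T (v q')) = (fst q')\<^sup>2 * L2_inner M (v q) (v q')"
        "L2_inner N (T (v q')) (T (v q)) = (fst q)\<^sup>2 * L2_inner M (v q') (v q)"
        using q by (auto intro!: singular_space_inner vs v TL)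
      moreover have "(fst q)\<^sup>2 \<noteq> (fst q')\<^sup>2"
      proof -
        have "fst q \<in> R" "fst q' \<in> R" using q by (auto simp: Q_def)
        then have "0 < fst q" "0 < fst q'" using R(2) s by force+
        then show ?thesis using ne by (simp add: power2_eq_iff)
      qed
      ultimately show ?thesis
        by (metis L2_inner_commute mult_right_cancel)
    qed
    obtain a b where ab: "\<And>i. i < m \<Longrightarrow> a i \<in> L2 M" and
      approx: "\<And>c. c \<in> L2 M \<Longrightarrow>
        L2_norm N (\<lambda>t. T c t - (\<Sum>i<m. L2_inner M c (a i) * b i t)) \<le> e * L2_norm M c"
      using fr unfolding finite_rank_approx_def by blast
    obtain y where y: "\<exists>q\<in>Q. y q \<noteq> 0" "\<And>i. i < m \<Longrightarrow> (\<Sum>q\<in>Q. L2_inner M (v q) (a i) * y q) = 0"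
      using homogeneous_system_nontrivial[OF finQ cardQ, of "\<lambda>i q. L2_inner M (v q) (a i)"] by blast
    define w where "w x = (\<Sum>q\<in>Q. y q * v q x)" for x
    define wr where "wr r x = (\<Sum>i<k r. y (r, i) * u r i x)" for r x
    have wL: "w \<in> L2 M" unfolding w_def by (intro L2_sum finQ L2_scale v)
    have uL: "u r i \<in> L2 M" if "i < k r" for r i using u[OF that] by (simp add: singular_space_def)
    have wrL: "wr r \<in> L2 M" for r unfolding wr_def by (intro L2_sum L2_scale uL) auto
    have wwr: "w x = (\<Sum>r\<in>R. wr r x)" for x
      unfolding w_def wr_def Q_def v_def using R by (subst sum.Sigma) (auto simp: case_prod_beta)
    have inner_w: "L2_inner M w f = (\<Sum>q\<in>Q. y q * L2_inner M (v q) f)" if "f \<in> L2 M" for f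
      unfolding w_def using that
      by (subst L2_inner_sum) (auto intro!: finQ v L2_scale simp: L2_inner_scale)
    have inner_wr: "L2_inner M (wr r) f = (\<Sum>i<k r. y (r, i) * L2_inner M (u r i) f)" if "f \<in> L2 M" for r f
      unfolding wr_def using that
      by (subst L2_inner_sum) (auto intro!: uL L2_scale simp: L2_inner_scale)
    have wa: "L2_inner M w (a i) = 0" if "i < m" for i
      using inner_w[OF ab[OF that]] y(2)[OF that] by (simp add: mult.commute)
    have upper: "L2_norm N (T w) \<le> e * L2_norm M w"
      using approx[OF wL] wa by simp
    \<comment> \<open>Orthogonality makes weighted quadratic forms of \<open>w\<close> diagonal over
      \<open>R\<close>. The weight r^2 will give the squared norm of \<open>T w\<close>, the weight
      1 that of \<open>w\<close>.\<close>
    have group: "(\<Sum>q\<in>Q. y q * (\<phi> (fst q) * L2_inner M w (v q))) = (\<Sum>r\<in>R. \<phi> r * L2_inner M (wr r) (wr r))"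
      for \<phi> :: "real \<Rightarrow> real"
    proof -
      have 1: "L2_inner M w (v q) = L2_inner M (wr (fst q)) (v q)" if q: "q \<in> Q" for q
      proof -
        have "L2_inner M (wr r) (v q) = 0" if "r \<noteq> fst q" "r \<in> R" for r
        proof -
          have "L2_inner M (wr r) (v q) = (\<Sum>i<k r. y (r, i) * L2_inner M (u r i) (v q))"
            using q v by (intro inner_wr)
          also have "\<dots> = 0"
            using orth[of "(r, _)" q] q that by (intro sum.neutral) (auto simp: v_def Q_def)
          finally show ?thesis .
        qed
        moreover have "L2_inner M w (v q) = (\<Sum>r\<in>R. L2_inner M (wr r) (v q))"
          unfolding wwr[abs_def] using R wrL v q by (intro L2_inner_sum) auto
        moreover have "fst q \<in> R" using q by (auto simp: Q_def)
        ultimately show ?thesis using R(1) by (simp add: sum.remove[of R "fst q"])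
      qed
      have "(\<Sum>q\<in>Q. y q * (\<phi> (fst q) * L2_inner M w (v q))) =
          (\<Sum>r\<in>R. \<Sum>i<k r. y (r, i) * (\<phi> r * L2_inner M (wr r) (u r i)))"
        unfolding Q_def using R 1 by (subst sum.Sigma) (auto simp: case_prod_beta v_def Q_def intro!: sum.cong)
      also have "\<dots> = (\<Sum>r\<in>R. \<phi> r * L2_inner M (wr r) (wr r))"
      proof (intro sum.cong refl)
        fix r
        have "L2_inner M (wr r) (wr r) = (\<Sum>i<k r. y (r, i) * L2_inner M (u r i) (wr r))"
          by (intro inner_wr wrL)
        then show "(\<Sum>i<k r. y (r, i) * (\<phi> r * L2_inner M (wr r) (u r i))) = \<phi> r * L2_inner M (wr r) (wr r)"
          by (simp add: sum_distrib_left mult.left_commute L2_inner_commute)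
      qed
      finally show ?thesis .
    qed
    have "L2_inner N (T w) (T w) = L2_inner N (\<lambda>t. \<Sum>q\<in>Q. y q * T (v q) t) (T w)"
      using L2_operator_sum[OF T finQ, where f = v and y = y] v unfolding w_def[symmetric]
      by (intro L2_inner_cong_AE TL wL L2_sum L2_scale finQ v) auto
    also have "\<dots> = (\<Sum>q\<in>Q. y q * L2_inner N (T (v q)) (T w))"
      by (subst L2_inner_sum) (auto intro!: finQ v L2_scale TL wL simp: L2_inner_scale)
    also have "\<dots> = (\<Sum>q\<in>Q. y q * ((fst q)\<^sup>2 * L2_inner M w (v q)))"
      by (intro sum.cong arg_cong2[where f=times] refl, subst L2_inner_commute)
         (auto intro!: singular_space_inner vs wL TL v)
    finally have TwTw: "L2_inner N (T w) (T w) = (\<Sum>r\<in>R. r\<^sup>2 * L2_inner M (wr r) (wr r))"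
      by (simp only: group[of "\<lambda>r. r\<^sup>2"])
    have ww: "L2_inner M w w = (\<Sum>r\<in>R. L2_inner M (wr r) (wr r))"
      using inner_w[OF wL] group[of "\<lambda>_. 1"] by (simp add: L2_inner_commute)
    have "s\<^sup>2 * L2_inner M w w \<le> L2_inner N (T w) (T w)"
      unfolding TwTw ww sum_distrib_left
    proof (intro sum_mono mult_right_mono L2_inner_nonneg)
      fix r assume "r \<in> R"
      then show "s\<^sup>2 \<le> r\<^sup>2" using R s by (intro power_mono) auto
    qed
    also have "\<dots> \<le> (e * L2_norm M w)\<^sup>2"
      unfolding L2_norm_sq[symmetric] using upper by (intro power_mono L2_norm_nonneg)
    finally have le: "s\<^sup>2 * L2_inner M w w \<le> e\<^sup>2 * L2_inner M w w"
      by (simp add: power_mult_distrib L2_norm_sq)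
    \<comment> \<open>If \<open>w\<close> were null, so would be each of its mutually orthogonal
      components \<open>wr r\<close>, and independence inside every eigenspace would make all
      coefficients vanish.\<close>
    have "L2_inner M w w \<noteq> 0"
    proof
      assume "L2_inner M w w = 0"
      then have "\<forall>r\<in>R. L2_inner M (wr r) (wr r) = 0"
        using R(1) by (simp add: ww sum_nonneg_eq_0_iff L2_inner_nonneg)
      then have "\<forall>r\<in>R. AE x in M. wr r x = 0" using wrL L2_inner_self_eq_0 by blast
      then have "\<forall>r\<in>R. \<forall>i<k r. y (r, i) = 0"
        using ind[unfolded L2_independent_def, rule_format, of "\<lambda>i. y (_, i)"] unfolding wr_def by blast
      then show False using y(1) by (auto simp: Q_def)
    qed
    then have "0 < L2_inner M w w" using L2_inner_nonneg[of M w] by simp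
    with le have "s\<^sup>2 \<le> e\<^sup>2" by simp
    then show "s \<le> e" using e by (rule power2_le_imp_le)
  qed
  ultimately show "s \<le> e" using e by auto
qed auto

section \<open>Completeness and compactness\<close>

lemma fast_Cauchy_subsequence:
  fixes d :: "nat \<Rightarrow> nat \<Rightarrow> real"
  assumes "\<And>e. 0 < e \<Longrightarrow> \<exists>K. \<forall>k\<ge>K. \<forall>l\<ge>K. d k l < e"
  shows "\<exists>r. strict_mono (r::nat \<Rightarrow> nat) \<and> (\<forall>k. d (r (Suc k)) (r k) < (1/2) ^ k)"
proof -
  obtain K where K: "\<And>j k l. k \<ge> K j \<Longrightarrow> l \<ge> K j \<Longrightarrow> d k l < (1/2) ^ j"
    using assms[of "(1/2) ^ _"] by (metis zero_less_divide_1_iff zero_less_numeral zero_less_power)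
  define r where "r = rec_nat (K 0) (\<lambda>j m. max (Suc m) (K (Suc j)))"
  have r: "r 0 = K 0" "\<And>j. r (Suc j) = max (Suc (r j)) (K (Suc j))" by (simp_all add: r_def)
  have "strict_mono r" by (simp add: strict_mono_Suc_iff r less_max_iff_disj)
  moreover have "K j \<le> r j" for j by (cases j) (auto simp: r)
  then have "d (r (Suc k)) (r k) < (1/2) ^ k" for k
    by (intro K) (auto simp: r intro: order_trans[of _ "r k"])
  ultimately show ?thesis by blast
qed

text \<open>Riesz-Fischer. Along a subsequence with increments below 2^(-k), the sum of the absolute
  increments has norm at most 2 by monotone convergence, so it is finite almost everywhere and the
  subsequence converges there. Fatou's lemma then shows that the whole sequence converges to this
  limit in norm.\<close>

theorem L2_complete:
  assumes y: "\<And>k. y k \<in> L2 N"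
    and Cauchy: "\<And>e. 0 < e \<Longrightarrow> \<exists>K. \<forall>k\<ge>K. \<forall>l\<ge>K. L2_norm N (\<lambda>t. y k t - y l t) < e"
  shows "\<exists>g\<in>L2 N. (\<lambda>k. L2_norm N (\<lambda>t. y k t - g t)) \<longlonglongrightarrow> 0"
proof -
  have [measurable]: "y k \<in> borel_measurable N" for k using y by (rule L2_measurable)
  obtain r :: "nat \<Rightarrow> nat" where r: "strict_mono r"
    "\<And>k. L2_norm N (\<lambda>t. y (r (Suc k)) t - y (r k) t) < (1/2) ^ k"
    using fast_Cauchy_subsequence[OF Cauchy] by blast
  define d where "d k t = \<bar>y (r (Suc k)) t - y (r k) t\<bar>" for k t
  have [measurable]: "d k \<in> borel_measurable N" for k unfolding d_def by measurable
  have dL: "d k \<in> L2 N" for k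
    using L2_diff[OF y y] unfolding d_def by (auto simp: L2_def)
  have dn: "L2_norm N (d k) < (1/2) ^ k" for k
    using r(2)[of k] by (simp add: d_def L2_norm_def L2_inner_def)
  define S where "S K t = (\<Sum>k<K. d k t)" for K t
  have [measurable]: "S K \<in> borel_measurable N" for K unfolding S_def by measurable
  have SL: "S K \<in> L2 N" for K unfolding S_def by (intro L2_sum dL) auto
  have "L2_norm N (S K) \<le> (\<Sum>k<K. (1/2) ^ k)" for K
  proof (induction K)
    case 0 show ?case by (simp add: S_def L2_norm_def L2_inner_def)
  next
    case (Suc K)
    have "L2_norm N (S (Suc K)) \<le> L2_norm N (S K) + L2_norm N (d K)"
      using L2_norm_triangle[OF SL dL, of K K] by (simp add: S_def[abs_def])
    then show ?case using Suc dn[of K] by simp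
  qed
  also have "(\<Sum>k<K. (1/2::real) ^ k) \<le> 2" for K
  proof -
    have "(\<Sum>k<K. (1/2::real) ^ k) = 2 - 2 * (1/2) ^ K" by (induction K) auto
    then show ?thesis by simp
  qed
  finally have Sn: "L2_norm N (S K) \<le> 2" for K .
  have Spos: "0 \<le> S K t" and Smono: "S K t \<le> S (Suc K) t" for K t
    by (auto simp: S_def d_def intro!: sum_nonneg)
  have "(\<integral>\<^sup>+t. (SUP K. ennreal ((S K t)\<^sup>2)) \<partial>N) = (SUP K. \<integral>\<^sup>+t. ennreal ((S K t)\<^sup>2) \<partial>N)"
    using Smono Spos
    by (intro nn_integral_monotone_convergence_SUP)
       (auto intro!: incseq_SucI le_funI ennreal_leI power_mono)
  also have "\<dots> \<le> ennreal 4"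
  proof (intro SUP_least)
    fix K
    have "(L2_norm N (S K))\<^sup>2 \<le> 2\<^sup>2" using Sn by (intro power_mono L2_norm_nonneg)
    then show "(\<integral>\<^sup>+t. ennreal ((S K t)\<^sup>2) \<partial>N) \<le> ennreal 4"
      unfolding nn_integral_L2[OF SL] by (intro ennreal_leI) simp
  qed
  finally have "(\<integral>\<^sup>+t. (SUP K. ennreal ((S K t)\<^sup>2)) \<partial>N) \<noteq> \<infinity>"
    by (auto simp: top_unique)
  then have "AE t in N. (SUP K. ennreal ((S K t)\<^sup>2)) \<noteq> \<infinity>"
    by (intro nn_integral_PInf_AE) auto
  then have conv: "AE t in N. convergent (\<lambda>k. y (r k) t)"
  proof eventually_elim
    fix t assume "(SUP K. ennreal ((S K t)\<^sup>2)) \<noteq> \<infinity>"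
    then obtain B where B: "0 \<le> B" "(SUP K. ennreal ((S K t)\<^sup>2)) = ennreal B"
      by (cases "SUP K. ennreal ((S K t)\<^sup>2)") (auto simp: top_unique)
    have "S K t \<le> sqrt B" for K
    proof -
      have "ennreal ((S K t)\<^sup>2) \<le> ennreal B" unfolding B(2)[symmetric] by (rule SUP_upper) simp
      then show ?thesis using B(1) by (simp add: real_le_rsqrt)
    qed
    then have "summable (\<lambda>k. d k t)"
      unfolding S_def lessThan_Suc_atMost[symmetric]
      by (intro bounded_imp_summable[of _ "sqrt B"]) (auto simp: d_def lessThan_Suc_atMost[symmetric] simp del: sum.lessThan_Suc)
    then have "summable (\<lambda>k. y (r (Suc k)) t - y (r k) t)"
      unfolding d_def by (rule summable_rabs_cancel)
    then have "convergent (\<lambda>K. \<Sum>k<K. y (r (Suc k)) t - y (r k) t)"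
      by (simp add: summable_iff_convergent)
    moreover have "(\<Sum>k<K. y (r (Suc k)) t - y (r k) t) = y (r K) t - y (r 0) t" for K
      by (rule sum_lessThan_telescope)
    ultimately have "convergent (\<lambda>K. y (r K) t - y (r 0) t)" by simp
    then have "convergent (\<lambda>K. (y (r K) t - y (r 0) t) + y (r 0) t)"
      by (intro convergent_add convergent_const)
    then show "convergent (\<lambda>k. y (r k) t)" by simp
  qed
  define g where "g t = lim (\<lambda>k. y (r k) t)" for t
  have [measurable]: "g \<in> borel_measurable N" unfolding g_def by measurable
  have lim: "AE t in N. (\<lambda>k. y (r k) t) \<longlonglongrightarrow> g t"
    using conv by eventually_elim (simp add: g_def convergent_LIMSEQ_iff)
  have bound: "(\<lambda>t. y m t - g t) \<in> L2 N" "L2_norm N (\<lambda>t. y m t - g t) \<le> e"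
    if "0 < e" and K: "\<forall>k\<ge>K. \<forall>l\<ge>K. L2_norm N (\<lambda>t. y k t - y l t) < e" and "K \<le> m" for e K m
  proof -
    have "(\<integral>\<^sup>+t. ennreal ((y m t - g t)\<^sup>2) \<partial>N) = (\<integral>\<^sup>+t. liminf (\<lambda>k. ennreal ((y m t - y (r k) t)\<^sup>2)) \<partial>N)"
      using lim
    proof (intro nn_integral_cong_AE, eventually_elim)
      fix t assume "(\<lambda>k. y (r k) t) \<longlonglongrightarrow> g t"
      then have "(\<lambda>k. ennreal ((y m t - y (r k) t)\<^sup>2)) \<longlonglongrightarrow> ennreal ((y m t - g t)\<^sup>2)"
        by (intro tendsto_intros)
      then show "ennreal ((y m t - g t)\<^sup>2) = liminf (\<lambda>k. ennreal ((y m t - y (r k) t)\<^sup>2))"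
        by (intro lim_imp_Liminf[symmetric]) simp_all
    qed
    also have "\<dots> \<le> liminf (\<lambda>k. \<integral>\<^sup>+t. ennreal ((y m t - y (r k) t)\<^sup>2) \<partial>N)"
      by (intro nn_integral_liminf) measurable
    also have "\<dots> \<le> ennreal (e\<^sup>2)"
    proof (intro Liminf_le eventually_sequentiallyI[of K])
      fix k assume "K \<le> k"
      then have "K \<le> r k" using seq_suble[OF r(1), of k] by simp
      then have "L2_norm N (\<lambda>t. y m t - y (r k) t) < e" using K \<open>K \<le> m\<close> by simp
      then have "(L2_norm N (\<lambda>t. y m t - y (r k) t))\<^sup>2 \<le> e\<^sup>2"
        by (intro power_mono L2_norm_nonneg) simp
      then show "(\<integral>\<^sup>+t. ennreal ((y m t - y (r k) t)\<^sup>2) \<partial>N) \<le> ennreal (e\<^sup>2)"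
        by (simp add: nn_integral_L2[OF L2_diff[OF y y]])
    qed auto
    finally have "(\<integral>\<^sup>+t. ennreal ((y m t - g t)\<^sup>2) \<partial>N) \<le> ennreal (e\<^sup>2)" .
    then show "(\<lambda>t. y m t - g t) \<in> L2 N" "L2_norm N (\<lambda>t. y m t - g t) \<le> e"
      using \<open>0 < e\<close> by (auto intro: L2_bound_nn)
  qed
  obtain K1 where "\<forall>k\<ge>K1. \<forall>l\<ge>K1. L2_norm N (\<lambda>t. y k t - y l t) < 1"
    using Cauchy[of 1] by auto
  from L2_diff[OF y bound(1)[OF _ this order_refl], of K1] have "g \<in> L2 N" by simp
  moreover have "(\<lambda>k. L2_norm N (\<lambda>t. y k t - g t)) \<longlonglongrightarrow> 0"
  proof (rule LIMSEQ_I)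
    fix e :: real assume e: "0 < e"
    then obtain K where K: "\<forall>k\<ge>K. \<forall>l\<ge>K. L2_norm N (\<lambda>t. y k t - y l t) < e/2"
      using Cauchy[of "e/2"] by auto
    show "\<exists>K. \<forall>k\<ge>K. norm (L2_norm N (\<lambda>t. y k t - g t) - 0) < e"
    proof (intro exI[of _ K] allI impI)
      fix k assume "K \<le> k"
      then show "norm (L2_norm N (\<lambda>t. y k t - g t) - 0) < e"
        using bound(2)[OF _ K, of k] e L2_norm_nonneg[of N "\<lambda>t. y k t - g t"] by simp
    qed
  qed
  ultimately show ?thesis by blast
qed

text \<open>Bolzano-Weierstrass for each \<open>q\<close>, followed by a diagonal choice. The
  diagonal sequence is a subsequence of the \<open>q\<close>-th refinement only from index
  \<open>Suc q\<close> on, hence the detour through a tail.\<close>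

lemma bounded_functionals_subsequence:
  fixes l :: "nat \<Rightarrow> nat \<Rightarrow> real"
  assumes "\<And>q. \<exists>B. \<forall>k. \<bar>l q k\<bar> \<le> B"
  shows "\<exists>r. strict_mono (r::nat \<Rightarrow> nat) \<and> (\<forall>q. convergent (\<lambda>k. l q (r k)))"
proof -
  interpret subseqs "\<lambda>q s. convergent (\<lambda>k. l q (s k))"
  proof
    fix q and s :: "nat \<Rightarrow> nat" assume "strict_mono s"
    obtain B where "\<forall>k. \<bar>l q k\<bar> \<le> B" using assms by blast
    then have "bounded (range (\<lambda>k. l q (s k)))" by (auto simp: bounded_iff)
    then obtain L r where "strict_mono (r::nat \<Rightarrow> nat)" "((\<lambda>k. l q (s k)) \<circ> r) \<longlonglongrightarrow> L"
      using bounded_imp_convergent_subsequence by blast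
    then show "\<exists>r'. strict_mono r' \<and> convergent (\<lambda>k. l q ((s \<circ> r') k))"
      by (auto simp: o_def convergent_def)
  qed
  have "convergent (\<lambda>k. l q (diagseq k))" for q
  proof -
    have "convergent (\<lambda>k. l q ((diagseq \<circ> (+) (Suc q)) k))"
    proof (rule diagseq_holds)
      fix r s q assume r: "strict_mono (r::nat \<Rightarrow> nat)" and "convergent (\<lambda>k. l q (s k))"
      then show "convergent (\<lambda>k. l q ((s \<circ> r) k))"
        using convergent_subseq_convergent[of "\<lambda>k. l q (s k)" r] by (simp add: o_def)
    qed
    then have "convergent (\<lambda>k. l q (diagseq (k + Suc q)))" by (simp add: o_def add.commute)
    then show ?thesis using convergent_ignore_initial_segment[of "\<lambda>k. l q (diagseq k)" "Suc q"] by simp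
  qed
  then show ?thesis using subseq_diagseq by blast
qed

text \<open>All coefficient functionals of all approximants form a countable family, so one
  subsequence makes every one of them converge. Along it the images are Cauchy: on differences of
  norm at most 2B, the approximant of level \<open>n\<close> errs by at most 2B/(n+1), and its own
  values are governed by finitely many convergent coefficients.\<close>

lemma compact_of_finite_rank_approx:
  assumes T: "L2_operator M N T"
    and fr: "\<And>e. 0 < e \<Longrightarrow> \<exists>m. finite_rank_approx M N T m e"
  shows "compact_L2_operator M N T"
  unfolding compact_L2_operator_def
proof (intro conjI T allI impI)
  fix f :: "nat \<Rightarrow> 'a \<Rightarrow> real"
  assume "(\<forall>k. f k \<in> L2 M) \<and> (\<exists>B. \<forall>k. L2_norm M (f k) \<le> B)"
  then obtain B where f: "\<And>k. f k \<in> L2 M" and B: "\<And>k. L2_norm M (f k) \<le> B" by blast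
  have B0: "0 \<le> B" using B[of 0] L2_norm_nonneg[of M "f 0"] by linarith
  have TL: "T f \<in> L2 N" if "f \<in> L2 M" for f using T that by (auto simp: L2_operator_def)
  have "\<forall>n. \<exists>m. finite_rank_approx M N T m (1 / real (Suc n))"
    using fr by simp
  then obtain m where "\<forall>n. finite_rank_approx M N T (m n) (1 / real (Suc n))"
    unfolding choice_iff by blast
  then have "\<exists>a b. \<forall>n. (\<forall>i<m n. a n i \<in> L2 M \<and> b n i \<in> L2 N) \<and>
        (\<forall>c\<in>L2 M. L2_norm N (\<lambda>t. T c t - (\<Sum>i<m n. L2_inner M c (a n i) * b n i t)) \<le> 1 / real (Suc n) * L2_norm M c)"
    unfolding finite_rank_approx_def choice_iff .
  then obtain a b where a: "\<And>n i. i < m n \<Longrightarrow> a n i \<in> L2 M" and b: "\<And>n i. i < m n \<Longrightarrow> b n i \<in> L2 N"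
    and approx: "\<And>n c. c \<in> L2 M \<Longrightarrow>
      L2_norm N (\<lambda>t. T c t - (\<Sum>i<m n. L2_inner M c (a n i) * b n i t)) \<le> 1 / real (Suc n) * L2_norm M c"
    by blast
  \<comment> \<open>Pairs of a level \<open>n\<close> and a position \<open>i\<close> are coded into
    one index; positions beyond the rank receive the constant sequence 0.\<close>
  define l where "l q k = (case prod_decode q of (n, i) \<Rightarrow> if i < m n then L2_inner M (f k) (a n i) else 0)" for q k
  have "\<exists>B. \<forall>k. \<bar>l q k\<bar> \<le> B" for q
  proof -
    obtain n i where ni: "prod_decode q = (n, i)" by fastforce
    have "\<bar>l q k\<bar> \<le> B * L2_norm M (a n i)" for k
    proof (cases "i < m n")
      case True
      have "\<bar>L2_inner M (f k) (a n i)\<bar> \<le> L2_norm M (f k) * L2_norm M (a n i)"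
        by (intro L2_Cauchy_Schwarz f a True)
      also have "\<dots> \<le> B * L2_norm M (a n i)" by (intro mult_right_mono B L2_norm_nonneg)
      finally show ?thesis using True ni by (simp add: l_def)
    qed (use ni B0 in \<open>simp add: l_def L2_norm_nonneg\<close>)
    then show ?thesis by blast
  qed
  then obtain r :: "nat \<Rightarrow> nat" where r: "strict_mono r" and conv: "\<And>q. convergent (\<lambda>k. l q (r k))"
    using bounded_functionals_subsequence[of l] by blast
  have lconv: "convergent (\<lambda>k. L2_inner M (f (r k)) (a n i))" if "i < m n" for n i
    using conv[of "prod_encode (n, i)"] that by (simp add: l_def)
  have "\<exists>g\<in>L2 N. (\<lambda>k. L2_norm N (\<lambda>t. T (f (r k)) t - g t)) \<longlonglongrightarrow> 0"
  proof (rule L2_complete)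
    show "T (f (r k)) \<in> L2 N" for k by (intro TL f)
    fix e :: real assume e: "0 < e"
    obtain n where n: "2 * B / e < real n" using reals_Archimedean2 by blast
    have n': "1 / real (Suc n) * (2 * B) < e"
    proof -
      have "2 * B < real n * e" using n e by (simp add: pos_divide_less_eq)
      also have "\<dots> \<le> real (Suc n) * e" using e by simp
      finally show ?thesis by (simp add: pos_divide_less_eq mult.commute)
    qed
    define e' where "e' = e - 1 / real (Suc n) * (2 * B)"
    have e': "0 < e'" using n' by (simp add: e'_def)
    \<comment> \<open>The tolerance per coefficient that keeps the finite rank part below
      \<open>e'\<close>. The summand 1 excludes a zero denominator and makes the final inequality
      strict.\<close>
    define \<eta> where "\<eta> = e' / (1 + (\<Sum>i<m n. L2_norm N (b n i)))"
    have sum0: "0 \<le> (\<Sum>i<m n. L2_norm N (b n i))" by (intro sum_nonneg L2_norm_nonneg)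
    have \<eta>: "0 < \<eta>" using e' sum0 by (simp add: \<eta>_def)
    have "\<exists>K. \<forall>k\<ge>K. \<forall>j\<ge>K. \<bar>L2_inner M (f (r k)) (a n i) - L2_inner M (f (r j)) (a n i)\<bar> < \<eta>"
      if "i < m n" for i
      using convergent_Cauchy[OF lconv[OF that]] \<eta> unfolding Cauchy_def dist_real_def by blast
    then obtain K where K: "\<And>i k j. i < m n \<Longrightarrow> K i \<le> k \<Longrightarrow> K i \<le> j \<Longrightarrow>
        \<bar>L2_inner M (f (r k)) (a n i) - L2_inner M (f (r j)) (a n i)\<bar> < \<eta>" by metis
    define K' where "K' = (\<Sum>i<m n. K i)"
    have K': "K i \<le> K'" if "i < m n" for i
      unfolding K'_def using that by (intro member_le_sum) auto
    show "\<exists>K. \<forall>k\<ge>K. \<forall>j\<ge>K. L2_norm N (\<lambda>t. T (f (r k)) t - T (f (r j)) t) < e"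
    proof (intro exI[of _ K'] allI impI)
      fix k j assume kj: "K' \<le> k" "K' \<le> j"
      define c where "c x = f (r k) x - f (r j) x" for x
      have c: "c \<in> L2 M" unfolding c_def by (intro L2_diff f)
      have cn: "L2_norm M c \<le> 2 * B"
        using L2_norm_triangle[OF f L2_scale[OF f], of "r k" "-1" "r j"] B[of "r k"] B[of "r j"]
        unfolding c_def L2_norm_scale by simp
      define P where "P t = (\<Sum>i<m n. L2_inner M c (a n i) * b n i t)" for t
      have PL: "P \<in> L2 N" unfolding P_def by (intro L2_sum L2_scale b) auto
      have Pn: "L2_norm N (\<lambda>t. \<Sum>i\<in>A. L2_inner M c (a n i) * b n i t)
          \<le> (\<Sum>i\<in>A. \<bar>L2_inner M c (a n i)\<bar> * L2_norm N (b n i))" if "finite A" "A \<subseteq> {..<m n}" for A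
        using that
      proof (induction A rule: finite_induct)
        case empty show ?case by (simp add: L2_norm_def L2_inner_def)
      next
        case (insert i A)
        have "L2_norm N (\<lambda>t. L2_inner M c (a n i) * b n i t + (\<Sum>i\<in>A. L2_inner M c (a n i) * b n i t))
          \<le> L2_norm N (\<lambda>t. L2_inner M c (a n i) * b n i t) + L2_norm N (\<lambda>t. \<Sum>i\<in>A. L2_inner M c (a n i) * b n i t)"
          using insert by (intro L2_norm_triangle L2_sum L2_scale b) auto
        then show ?case using insert by (simp add: L2_norm_scale)
      qed
      have small: "\<bar>L2_inner M c (a n i)\<bar> \<le> \<eta>" if "i < m n" for i
        using K[OF that, of k j] K'[OF that] kj a[OF that] f unfolding c_def
        by (simp add: L2_inner_diff)
      have "L2_norm N P \<le> (\<Sum>i<m n. \<bar>L2_inner M c (a n i)\<bar> * L2_norm N (b n i))"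
        unfolding P_def by (intro Pn) auto
      also have "\<dots> \<le> (\<Sum>i<m n. \<eta> * L2_norm N (b n i))"
        using small by (intro sum_mono mult_right_mono L2_norm_nonneg) auto
      also have "\<dots> = \<eta> * (\<Sum>i<m n. L2_norm N (b n i))" by (simp add: sum_distrib_left)
      also have "\<dots> < \<eta> * (1 + (\<Sum>i<m n. L2_norm N (b n i)))" using \<eta> by simp
      also have "\<dots> = e'" using sum0 by (simp add: \<eta>_def)
      finally have P: "L2_norm N P < e'" .
      have TcP: "(\<lambda>t. T c t - P t) \<in> L2 N" by (intro L2_diff TL c PL)
      have "L2_norm N (T c) \<le> L2_norm N (\<lambda>t. T c t - P t) + L2_norm N P"
        using L2_norm_triangle[OF TcP PL] by simp
      also have "L2_norm N (\<lambda>t. T c t - P t) \<le> 1 / real (Suc n) * (2 * B)"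
        unfolding P_def by (rule order_trans[OF approx[OF c]]) (intro mult_left_mono cn, simp)
      finally have *: "L2_norm N (T c) < e" using P by (simp add: e'_def)
      have "AE t in N. T (\<lambda>x. 1 * f (r k) x + (-1) * f (r j) x) t = 1 * T (f (r k)) t + (-1) * T (f (r j)) t"
        by (intro L2_operator_linear[OF T] f)
      then have "AE t in N. T c t = T (f (r k)) t - T (f (r j)) t" by (simp add: c_def[abs_def])
      then have "L2_norm N (T c) = L2_norm N (\<lambda>t. T (f (r k)) t - T (f (r j)) t)"
        by (intro L2_norm_cong_AE TL L2_diff c f)
      with * show "L2_norm N (\<lambda>t. T (f (r k)) t - T (f (r j)) t) < e" by simp
    qed
  qed
  with r show "\<exists>r g. strict_mono (r :: nat \<Rightarrow> nat) \<and> g \<in> L2 N \<and>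
     (\<lambda>k. L2_norm N (\<lambda>t. T (f (r k)) t - g t)) \<longlonglongrightarrow> 0" by blast
qed

section \<open>Weakly singular kernels\<close>

text \<open>Dyadic layers: where 2^(-k-1) < r \<le> 2^(-k), the integrand is at most 2^((k+1)q), and
  the layer has measure at most C 2^((1-k)d). The resulting geometric series has ratio 2^(q-d) < 1.
  The exponent \<open>d\<close> plays the part of the codimension of the singular set.\<close>

lemma nn_integral_powr_neg_bound:
  assumes [measurable]: "r \<in> borel_measurable M"
    and pos: "\<And>x. x \<in> space M \<Longrightarrow> 0 \<le> r x"
    and small: "\<And>\<rho>. 0 < \<rho> \<Longrightarrow> emeasure M {x \<in> space M. r x < \<rho>} \<le> ennreal (C * \<rho> powr d)"
    and V: "emeasure M (space M) \<le> ennreal V"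
    and nonneg: "0 \<le> C" "0 \<le> V" "0 \<le> q" and qd: "q < d"
  shows "(\<integral>\<^sup>+x. ennreal (r x powr (-q)) \<partial>M) \<le> ennreal (V + C * 2 powr (q + d) / (1 - 2 powr (q - d)))"
proof -
  \<comment> \<open>The threshold is twice the upper end of the layer, because the measure bound is
    available for strict sublevel sets.\<close>
  define A where "A k = {x \<in> space M. r x < 2 powr (1 - real k)}" for k :: nat
  have [measurable]: "A k \<in> sets M" for k unfolding A_def by measurable
  define w where "w k = 2 powr ((real k + 1) * q)" for k :: nat
  have pw: "ennreal (r x powr (-q)) \<le> 1 + (\<Sum>k. ennreal (w k) * indicator (A k) x)"
    if x: "x \<in> space M" for x
  proof -
    consider "r x = 0" | "1 \<le> r x" | "0 < r x" "r x < 1" using pos[OF x] by linarith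
    then show ?thesis
    proof cases
      \<comment> \<open>A power with base 0 is 0, so the singular set itself contributes
        nothing.\<close>
      case 1 then show ?thesis by simp
    next
      case 2
      then have "r x powr (-q) \<le> 1 powr (-q)" using nonneg by (intro powr_mono2') auto
      then have "ennreal (r x powr (-q)) \<le> 1" using ennreal_leI by fastforce
      then show ?thesis by (rule order_trans) simp
    next
      case 3
      define y where "y = - log 2 (r x)"
      have y: "0 \<le> y" and rx: "r x = 2 powr (-y)" using 3 by (simp_all add: y_def)
      define k where "k = nat \<lfloor>y\<rfloor>"
      have k: "real k \<le> y" "y < real k + 1" using y by (simp_all add: k_def)
      have "x \<in> A k" using x k by (simp add: A_def rx)
      have "r x powr (-q) = 2 powr (y * q)" by (simp add: rx powr_powr)
      also have "\<dots> \<le> w k" unfolding w_def using k nonneg by (intro powr_mono mult_right_mono) auto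
      finally have "ennreal (r x powr (-q)) \<le> ennreal (w k) * indicator (A k) x"
        using \<open>x \<in> A k\<close> by (simp add: ennreal_leI)
      also have "\<dots> \<le> (\<Sum>k. ennreal (w k) * indicator (A k) x)"
      proof -
        have "f k \<le> suminf f" for f :: "nat \<Rightarrow> ennreal" using sum_le_suminf[of f "{k}"] by simp
        then show ?thesis .
      qed
      finally show ?thesis by (rule order_trans) simp
    qed
  qed
  have e2: "0 < (2::real) powr (q - d)" "(2::real) powr (q - d) < 1"
    using qd by (auto simp: powr_less_one)
  have coeff: "w k * (C * (2 powr (1 - real k)) powr d) = C * 2 powr (q + d) * (2 powr (q - d)) ^ k" for k
  proof -
    have "w k * (2 powr (1 - real k)) powr d = 2 powr ((real k + 1) * q + (1 - real k) * d)"
      by (simp add: w_def powr_powr powr_add)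
    also have "(real k + 1) * q + (1 - real k) * d = (q + d) + real k * (q - d)" by (simp add: algebra_simps)
    also have "2 powr \<dots> = 2 powr (q + d) * (2 powr (q - d)) ^ k"
      by (simp add: powr_add powr_realpow[symmetric] powr_powr mult.commute)
    finally show ?thesis by (simp add: mult_ac)
  qed
  have sums: "(\<lambda>k. C * 2 powr (q + d) * (2 powr (q - d)) ^ k) sums (C * 2 powr (q + d) * (1 / (1 - 2 powr (q - d))))"
    using e2 by (intro sums_mult geometric_sums) auto
  have "(\<integral>\<^sup>+x. ennreal (r x powr (-q)) \<partial>M) \<le> (\<integral>\<^sup>+x. 1 + (\<Sum>k. ennreal (w k) * indicator (A k) x) \<partial>M)"
    by (intro nn_integral_mono pw)
  also have "\<dots> = emeasure M (space M) + (\<Sum>k. ennreal (w k) * emeasure M (A k))"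
    by (subst nn_integral_add) (auto simp: nn_integral_suminf nn_integral_cmult_indicator)
  also have "\<dots> \<le> ennreal V + (\<Sum>k. ennreal (C * 2 powr (q + d) * (2 powr (q - d)) ^ k))"
  proof (intro add_mono V suminf_le)
    fix k
    have "ennreal (w k) * emeasure M (A k) \<le> ennreal (w k) * ennreal (C * (2 powr (1 - real k)) powr d)"
      unfolding A_def by (intro mult_left_mono small) auto
    also have "\<dots> = ennreal (C * 2 powr (q + d) * (2 powr (q - d)) ^ k)"
      unfolding coeff[symmetric] by (rule ennreal_mult[symmetric]) (use nonneg in \<open>auto simp: w_def\<close>)
    finally show "ennreal (w k) * emeasure M (A k) \<le> ennreal (C * 2 powr (q + d) * (2 powr (q - d)) ^ k)" .
  qed auto
  also have "(\<Sum>k. ennreal (C * 2 powr (q + d) * (2 powr (q - d)) ^ k)) =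
      ennreal (C * 2 powr (q + d) * (1 / (1 - 2 powr (q - d))))"
    using nonneg sums by (intro suminf_ennreal_eq) auto
  also have "ennreal V + \<dots> = ennreal (V + C * 2 powr (q + d) / (1 - 2 powr (q - d)))"
    using nonneg e2 by (subst ennreal_plus[symmetric]) (auto intro!: divide_nonneg_pos)
  finally show ?thesis .
qed

text \<open>This holds without integrability, since the integral of a non-integrable function is 0
  by convention.\<close>

lemma norm_integral_le_nn_integral:
  fixes f :: "'a \<Rightarrow> real"
  shows "ennreal \<bar>LINT x|M. f x\<bar> \<le> (\<integral>\<^sup>+x. ennreal \<bar>f x\<bar> \<partial>M)"
proof (cases "integrable M f")
  case True
  then show ?thesis using integral_norm_bound_ennreal[of M f] by simp
qed (simp add: not_integrable_integral_eq)

text \<open>The exponent \<open>5/4\<close> splits as \<open>7/8 + 3/8\<close>, and \<open>2 \<cdot> 7/8\<close> resp. \<open>2 \<cdot> 3/8\<close> is integrable against a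
  two-dimensional resp. a one-dimensional singularity.\<close>

locale weakly_singular = M: finite_measure M + N: finite_measure N
  for M :: "'a measure" and N :: "'b measure" +
  fixes r :: "'a \<Rightarrow> 'b \<Rightarrow> real" and KM KN :: real
  assumes r_measurable [measurable]: "(\<lambda>(x, t). r x t) \<in> borel_measurable (M \<Otimes>\<^sub>M N)"
    and KM_nonneg: "0 \<le> KM" and KN_nonneg: "0 \<le> KN"
    and int_M: "\<And>t. t \<in> space N \<Longrightarrow> (\<integral>\<^sup>+x. ennreal (r x t powr (- (7/4))) \<partial>M) \<le> ennreal KM"
    and int_N: "\<And>x. x \<in> space M \<Longrightarrow> (\<integral>\<^sup>+t. ennreal (r x t powr (- (3/4))) \<partial>N) \<le> ennreal KN"
begin

sublocale pair_sigma_finite M N ..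

text \<open>Values are taken in \<open>ennreal\<close>, because finiteness is known only for almost
  every \<open>t\<close>, and only after the estimate below.\<close>

definition potential :: "('a \<Rightarrow> real) \<Rightarrow> 'b \<Rightarrow> ennreal" where
  "potential c t = (\<integral>\<^sup>+x. ennreal (\<bar>c x\<bar> * r x t powr (- (5/4))) \<partial>M)"

lemma potential_measurable [measurable]:
  assumes [measurable]: "c \<in> borel_measurable M"
  shows "potential c \<in> borel_measurable N"
  unfolding potential_def by measurable

text \<open>Cauchy-Schwarz in \<open>x\<close> at fixed \<open>t\<close> isolates the power -7/4,
  which \<open>int_M\<close> bounds uniformly. Tonelli's theorem then lets \<open>int_N\<close>
  absorb the power -3/4 in \<open>t\<close>, leaving the square of \<open>c\<close>.\<close>

lemma Schur:
  assumes c: "c \<in> L2 M"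
  shows "(\<integral>\<^sup>+t. (potential c t)\<^sup>2 \<partial>N)
    \<le> ennreal ((sqrt (KM * KN) * L2_norm M c)\<^sup>2)"
proof -
  have [measurable]: "c \<in> borel_measurable M" using c by (rule L2_measurable)
  have "(potential c t)\<^sup>2
      \<le> ennreal KM * (\<integral>\<^sup>+x. ennreal ((c x)\<^sup>2 * r x t powr (- (3/4))) \<partial>M)"
    if t[measurable]: "t \<in> space N" for t
  proof -
    have *: "\<bar>c x\<bar> * r x t powr (- (5/4)) = r x t powr (- (7/8)) * (\<bar>c x\<bar> * r x t powr (- (3/8)))" for x
      by (simp add: powr_add[symmetric])
    have "ennreal (\<bar>c x\<bar> * r x t powr (- (5/4))) =
        ennreal (r x t powr (- (7/8))) * ennreal (\<bar>c x\<bar> * r x t powr (- (3/8)))" for x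
      unfolding * by (rule ennreal_mult) auto
    then have "(potential c t)\<^sup>2 =
        (\<integral>\<^sup>+x. ennreal (r x t powr (- (7/8))) * ennreal (\<bar>c x\<bar> * r x t powr (- (3/8))) \<partial>M)\<^sup>2"
      by (simp only: potential_def)
    also have "\<dots> \<le> (\<integral>\<^sup>+x. (ennreal (r x t powr (- (7/8))))\<^sup>2 \<partial>M) *
        (\<integral>\<^sup>+x. (ennreal (\<bar>c x\<bar> * r x t powr (- (3/8))))\<^sup>2 \<partial>M)"
      by (intro Cauchy_Schwarz_nn_integral) measurable
    also have "(\<lambda>x. (ennreal (r x t powr (- (7/8))))\<^sup>2) = (\<lambda>x. ennreal (r x t powr (- (7/4))))"
    proof
      fix x
      have "(r x t powr (- (7/8)))\<^sup>2 = r x t powr (- (7/4))"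
        by (simp add: power2_eq_square powr_add[symmetric])
      then show "(ennreal (r x t powr (- (7/8))))\<^sup>2 = ennreal (r x t powr (- (7/4)))"
        by (simp add: ennreal_power)
    qed
    also have "(\<lambda>x. (ennreal (\<bar>c x\<bar> * r x t powr (- (3/8))))\<^sup>2) = (\<lambda>x. ennreal ((c x)\<^sup>2 * r x t powr (- (3/4))))"
    proof
      fix x
      have "(r x t powr (- (3/8)))\<^sup>2 = r x t powr (- (3/4))"
        by (simp add: power2_eq_square powr_add[symmetric])
      then show "(ennreal (\<bar>c x\<bar> * r x t powr (- (3/8))))\<^sup>2 = ennreal ((c x)\<^sup>2 * r x t powr (- (3/4)))"
        by (simp add: ennreal_power power_mult_distrib)
    qed
    also have "(\<integral>\<^sup>+x. ennreal (r x t powr (- (7/4))) \<partial>M) * (\<integral>\<^sup>+x. ennreal ((c x)\<^sup>2 * r x t powr (- (3/4))) \<partial>M)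
       \<le> ennreal KM * (\<integral>\<^sup>+x. ennreal ((c x)\<^sup>2 * r x t powr (- (3/4))) \<partial>M)"
      using int_M[OF t] by (rule mult_right_mono) simp
    finally show ?thesis .
  qed
  then have "(\<integral>\<^sup>+t. (potential c t)\<^sup>2 \<partial>N)
      \<le> (\<integral>\<^sup>+t. ennreal KM * (\<integral>\<^sup>+x. ennreal ((c x)\<^sup>2 * r x t powr (- (3/4))) \<partial>M) \<partial>N)"
    by (intro nn_integral_mono)
  also have "\<dots> = ennreal KM * (\<integral>\<^sup>+t. (\<integral>\<^sup>+x. ennreal ((c x)\<^sup>2 * r x t powr (- (3/4))) \<partial>M) \<partial>N)"
    by (intro nn_integral_cmult) measurable
  also have "(\<integral>\<^sup>+t. (\<integral>\<^sup>+x. ennreal ((c x)\<^sup>2 * r x t powr (- (3/4))) \<partial>M) \<partial>N)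
      = (\<integral>\<^sup>+x. (\<integral>\<^sup>+t. ennreal ((c x)\<^sup>2 * r x t powr (- (3/4))) \<partial>N) \<partial>M)"
    by (rule Fubini') measurable
  also have "\<dots> \<le> (\<integral>\<^sup>+x. ennreal KN * ennreal ((c x)\<^sup>2) \<partial>M)"
  proof (intro nn_integral_mono)
    fix x assume x[measurable]: "x \<in> space M"
    have "(\<integral>\<^sup>+t. ennreal ((c x)\<^sup>2 * r x t powr (- (3/4))) \<partial>N) = ennreal ((c x)\<^sup>2) * (\<integral>\<^sup>+t. ennreal (r x t powr (- (3/4))) \<partial>N)"
      by (subst nn_integral_cmult[symmetric]) (auto simp: ennreal_mult)
    also have "\<dots> \<le> ennreal ((c x)\<^sup>2) * ennreal KN"
      using int_N[OF x] by (rule mult_left_mono) simp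
    finally show "(\<integral>\<^sup>+t. ennreal ((c x)\<^sup>2 * r x t powr (- (3/4))) \<partial>N) \<le> ennreal KN * ennreal ((c x)\<^sup>2)"
      by (simp add: mult.commute)
  qed
  also have "\<dots> = ennreal KN * ennreal ((L2_norm M c)\<^sup>2)"
    by (subst nn_integral_cmult) (auto simp: nn_integral_L2[OF c])
  also have "ennreal KM * \<dots> = ennreal ((sqrt (KM * KN) * L2_norm M c)\<^sup>2)"
    using KM_nonneg KN_nonneg by (simp add: ennreal_mult[symmetric] power_mult_distrib mult.assoc)
  finally show ?thesis by (simp add: mult_left_mono)
qed

text \<open>The exceptional null set of \<open>x\<close> is independent of \<open>t\<close>: it
  comes from the essential bound on the coefficient p, while the singular factor is controlled
  pointwise. Where \<open>r\<close> vanishes the right-hand side is 0, which fits kernels that are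
  set to 0 on their singular set.\<close>

definition dominated :: "real \<Rightarrow> ('a \<Rightarrow> 'b \<Rightarrow> real) \<Rightarrow> bool" where
  "dominated K k \<longleftrightarrow> (\<lambda>(x, t). k x t) \<in> borel_measurable (M \<Otimes>\<^sub>M N) \<and>
     (AE x in M. \<forall>t\<in>space N. \<bar>k x t\<bar> \<le> K * r x t powr (- (5/4)))"

context
  fixes k :: "'a \<Rightarrow> 'b \<Rightarrow> real" and K :: real
  assumes dom: "dominated K k" and K: "0 \<le> K"
begin

lemma dominated_measurable [measurable]: "(\<lambda>(x, t). k x t) \<in> borel_measurable (M \<Otimes>\<^sub>M N)"
  using dom by (simp add: dominated_def)

lemma dominated_nn_integral_le:
  assumes c: "c \<in> L2 M" and t[measurable]: "t \<in> space N"
  shows "(\<integral>\<^sup>+x. ennreal \<bar>c x * k x t\<bar> \<partial>M) \<le> ennreal K * potential c t"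
proof -
  have [measurable]: "c \<in> borel_measurable M" using c by (rule L2_measurable)
  have "AE x in M. \<forall>t\<in>space N. \<bar>k x t\<bar> \<le> K * r x t powr (- (5/4))"
    using dom by (simp add: dominated_def)
  then have "AE x in M. ennreal \<bar>c x * k x t\<bar> \<le> ennreal K * ennreal (\<bar>c x\<bar> * r x t powr (- (5/4)))"
  proof eventually_elim
    fix x assume "\<forall>t\<in>space N. \<bar>k x t\<bar> \<le> K * r x t powr (- (5/4))"
    then have "\<bar>c x\<bar> * \<bar>k x t\<bar> \<le> \<bar>c x\<bar> * (K * r x t powr (- (5/4)))" using t by (intro mult_left_mono) auto
    then show "ennreal \<bar>c x * k x t\<bar> \<le> ennreal K * ennreal (\<bar>c x\<bar> * r x t powr (- (5/4)))"
      using K by (simp add: ennreal_mult[symmetric] abs_mult mult.left_commute)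
  qed
  then have "(\<integral>\<^sup>+x. ennreal \<bar>c x * k x t\<bar> \<partial>M) \<le> (\<integral>\<^sup>+x. ennreal K * ennreal (\<bar>c x\<bar> * r x t powr (- (5/4))) \<partial>M)"
    by (rule nn_integral_mono_AE)
  then show ?thesis unfolding potential_def by (subst (asm) nn_integral_cmult) auto
qed

text \<open>The potential has finite square integral and is thus finite almost everywhere. Splitting
  the integral of a sum relies on this, so linearity of the operator is an identity for almost every
  \<open>t\<close>.\<close>

lemma dominated_AE_integrable:
  assumes c: "c \<in> L2 M"
  shows "AE t in N. integrable M (\<lambda>x. c x * k x t)"
proof -
  have [measurable]: "c \<in> borel_measurable M" using c by (rule L2_measurable)
  have "(\<integral>\<^sup>+t. (potential c t)\<^sup>2 \<partial>N) \<noteq> \<infinity>"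
    using Schur[OF c] by (auto simp: top_unique)
  then have "AE t in N. (potential c t)\<^sup>2 \<noteq> \<infinity>"
    by (intro nn_integral_PInf_AE) measurable
  then show ?thesis
  proof (rule AE_mp, intro AE_I2 impI)
    fix t assume t[measurable]: "t \<in> space N"
      and fin: "(potential c t)\<^sup>2 \<noteq> \<infinity>"
    have "potential c t < \<infinity>"
      using fin by (auto simp: power2_eq_square top.not_eq_extremum ennreal_mult_less_top)
    then have "(\<integral>\<^sup>+x. ennreal \<bar>c x * k x t\<bar> \<partial>M) < \<infinity>"
      by (intro le_less_trans[OF dominated_nn_integral_le[OF c t]]) (simp add: ennreal_mult_less_top)
    then show "integrable M (\<lambda>x. c x * k x t)" by (intro integrableI_bounded) auto
  qed
qed

lemma dominated_L2:
  assumes c: "c \<in> L2 M"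
  shows "(\<lambda>t. LINT x|M. c x * k x t) \<in> L2 N"
    and "L2_norm N (\<lambda>t. LINT x|M. c x * k x t) \<le> K * sqrt (KM * KN) * L2_norm M c"
proof -
  have [measurable]: "c \<in> borel_measurable M" using c by (rule L2_measurable)
  have "(\<integral>\<^sup>+t. ennreal ((LINT x|M. c x * k x t)\<^sup>2) \<partial>N)
      \<le> (\<integral>\<^sup>+t. (ennreal K)\<^sup>2 * (potential c t)\<^sup>2 \<partial>N)"
  proof (intro nn_integral_mono)
    fix t assume t: "t \<in> space N"
    have "ennreal ((LINT x|M. c x * k x t)\<^sup>2) = (ennreal \<bar>LINT x|M. c x * k x t\<bar>)\<^sup>2"
      by (simp add: ennreal_power)
    also have "\<dots> \<le> (ennreal K * potential c t)\<^sup>2"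
      by (intro power_mono order_trans[OF norm_integral_le_nn_integral] dominated_nn_integral_le c t) simp
    finally show "ennreal ((LINT x|M. c x * k x t)\<^sup>2) \<le>
      (ennreal K)\<^sup>2 * (potential c t)\<^sup>2"
      by (simp add: power_mult_distrib)
  qed
  also have "\<dots> = (ennreal K)\<^sup>2 * (\<integral>\<^sup>+t. (potential c t)\<^sup>2 \<partial>N)"
    by (intro nn_integral_cmult) measurable
  also have "\<dots> \<le> (ennreal K)\<^sup>2 * ennreal ((sqrt (KM * KN) * L2_norm M c)\<^sup>2)"
    by (intro mult_left_mono Schur c) simp
  also have "\<dots> = ennreal ((K * sqrt (KM * KN) * L2_norm M c)\<^sup>2)"
    using K by (simp add: ennreal_power ennreal_mult[symmetric] power_mult_distrib mult.assoc)
  finally have *: "(\<integral>\<^sup>+t. ennreal ((LINT x|M. c x * k x t)\<^sup>2) \<partial>N) \<le> ennreal ((K * sqrt (KM * KN) * L2_norm M c)\<^sup>2)" .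
  have [measurable]: "(\<lambda>t. LINT x|M. c x * k x t) \<in> borel_measurable N"
    by (rule M.borel_measurable_lebesgue_integral) measurable
  have nn: "0 \<le> K * sqrt (KM * KN) * L2_norm M c"
    using K KM_nonneg KN_nonneg by (simp add: L2_norm_nonneg)
  show "(\<lambda>t. LINT x|M. c x * k x t) \<in> L2 N"
    by (rule L2_bound_nn(1)[OF _ * nn]) measurable
  show "L2_norm N (\<lambda>t. LINT x|M. c x * k x t) \<le> K * sqrt (KM * KN) * L2_norm M c"
    by (rule L2_bound_nn(2)[OF _ * nn]) measurable
qed

lemma dominated_L2_operator: "L2_operator M N (\<lambda>c t. LINT x|M. c x * k x t)"
  unfolding L2_operator_def
proof (intro conjI ballI allI impI)
  fix f assume f: "f \<in> L2 M"
  then have [measurable]: "f \<in> borel_measurable M" by (rule L2_measurable)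
  show "(\<lambda>t. LINT x|M. f x * k x t) \<in> L2 N" using f by (rule dominated_L2)
  fix g assume g: "g \<in> L2 M"
  then have [measurable]: "g \<in> borel_measurable M" by (rule L2_measurable)
  show "AE t in N. (LINT x|M. f x * k x t) = (LINT x|M. g x * k x t)" if "AE x in M. f x = g x"
  proof (intro AE_I2)
    fix t assume [measurable]: "t \<in> space N"
    show "(LINT x|M. f x * k x t) = (LINT x|M. g x * k x t)"
      using that by (intro integral_cong_AE) auto
  qed
  fix a b :: real
  show "AE t in N. (LINT x|M. (a * f x + b * g x) * k x t) =
      a * (LINT x|M. f x * k x t) + b * (LINT x|M. g x * k x t)"
    using dominated_AE_integrable[OF f] dominated_AE_integrable[OF g]
  proof eventually_elim
    fix t assume "integrable M (\<lambda>x. f x * k x t)" "integrable M (\<lambda>x. g x * k x t)"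
    then have "(LINT x|M. a * (f x * k x t) + b * (g x * k x t)) =
      a * (LINT x|M. f x * k x t) + b * (LINT x|M. g x * k x t)" by simp
    then show "(LINT x|M. (a * f x + b * g x) * k x t) =
      a * (LINT x|M. f x * k x t) + b * (LINT x|M. g x * k x t)"
      by (simp add: distrib_right mult.assoc)
  qed
qed

end

text \<open>A separated kernel gives a finite rank operator, and the error is the operator of the
  difference kernel, whose norm the Schur bound controls. The finite index set \<open>J\<close> is
  arbitrary so that nodes and coordinates can be used together as an index.\<close>

lemma dominated_finite_rank_approx:
  fixes a :: "'i \<Rightarrow> 'a \<Rightarrow> real" and b :: "'i \<Rightarrow> 'b \<Rightarrow> real"
  assumes k: "dominated K k" "0 \<le> K" and J: "finite J"
    and a: "\<And>i. i \<in> J \<Longrightarrow> a i \<in> L2 M" and b: "\<And>i. i \<in> J \<Longrightarrow> b i \<in> L2 N"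
    and d: "dominated K' (\<lambda>x t. k x t - (\<Sum>i\<in>J. a i x * b i t))" and K': "0 \<le> K'"
  shows "finite_rank_approx M N (\<lambda>c t. LINT x|M. c x * k x t) (card J) (K' * sqrt (KM * KN))"
proof -
  obtain \<phi> where \<phi>: "bij_betw \<phi> {..<card J} J"
    using ex_bij_betw_nat_finite[OF J] by (auto simp: atLeast0LessThan)
  have \<phi>J: "\<phi> i \<in> J" if "i < card J" for i using \<phi> that by (auto simp: bij_betw_def)
  have "L2_norm N (\<lambda>t. (LINT x|M. c x * k x t) - (\<Sum>i<card J. L2_inner M c (a (\<phi> i)) * b (\<phi> i) t))
      \<le> K' * sqrt (KM * KN) * L2_norm M c" if c: "c \<in> L2 M" for c
  proof -
    let ?d = "\<lambda>t. LINT x|M. c x * (k x t - (\<Sum>i\<in>J. a i x * b i t))"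
    have reindex: "(\<Sum>i<card J. L2_inner M c (a (\<phi> i)) * b (\<phi> i) t) = (\<Sum>i\<in>J. L2_inner M c (a i) * b i t)" for t
      using sum.reindex_bij_betw[OF \<phi>, of "\<lambda>i. L2_inner M c (a i) * b i t"] by simp
    have "AE t in N. (LINT x|M. c x * k x t) - (\<Sum>i\<in>J. L2_inner M c (a i) * b i t) = ?d t"
      using dominated_AE_integrable[OF k c]
    proof eventually_elim
      fix t assume ck: "integrable M (\<lambda>x. c x * k x t)"
      have ca: "integrable M (\<lambda>x. \<Sum>i\<in>J. c x * a i x * b i t)"
        using c a by (intro Bochner_Integration.integrable_sum integrable_mult_left L2_mult_integrable) auto
      have "?d t = (LINT x|M. c x * k x t - (\<Sum>i\<in>J. c x * a i x * b i t))"
        by (simp add: right_diff_distrib sum_distrib_left mult.assoc)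
      also have "\<dots> = (LINT x|M. c x * k x t) - (LINT x|M. (\<Sum>i\<in>J. c x * a i x * b i t))"
        using ck ca by (rule Bochner_Integration.integral_diff)
      also have "(LINT x|M. (\<Sum>i\<in>J. c x * a i x * b i t)) = (\<Sum>i\<in>J. L2_inner M c (a i) * b i t)"
        using c a unfolding L2_inner_def
        by (subst Bochner_Integration.integral_sum) (auto intro!: integrable_mult_left L2_mult_integrable)
      finally show "(LINT x|M. c x * k x t) - (\<Sum>i\<in>J. L2_inner M c (a i) * b i t) = ?d t" by simp
    qed
    then have "L2_norm N (\<lambda>t. (LINT x|M. c x * k x t) - (\<Sum>i\<in>J. L2_inner M c (a i) * b i t)) = L2_norm N ?d"
      using c J b by (intro L2_norm_cong_AE L2_diff L2_sum L2_scale dominated_L2(1)[OF k] dominated_L2(1)[OF d K'])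
    also have "\<dots> \<le> K' * sqrt (KM * KN) * L2_norm M c" by (rule dominated_L2(2)[OF d K' c])
    finally show ?thesis by (simp add: reindex)
  qed
  then show ?thesis unfolding finite_rank_approx_def using a b \<phi>J
    by (intro exI[of _ "\<lambda>i. a (\<phi> i)"] exI[of _ "\<lambda>i. b (\<phi> i)"]) auto
qed

end

section \<open>Smooth cut-off functions\<close>

text \<open>The differentiability clause of \<open>test_function\<close>, separated from the
  condition on the support.\<close>

definition smooth :: "(real \<Rightarrow> real) \<Rightarrow> bool" where
  "smooth f \<longleftrightarrow> (\<forall>k x. (deriv ^^ k) f field_differentiable at x)"

text \<open>Coinduction for smoothness: in a class closed under differentiation every function can
  be differentiated arbitrarily often. This replaces formulas for higher derivatives by the choice
  of a suitable class.\<close>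

lemma smooth_coinduct:
  assumes "f \<in> X" and X: "\<And>f. f \<in> X \<Longrightarrow> \<exists>f'\<in>X. \<forall>x. (f has_field_derivative f' x) (at x)"
  shows "smooth f"
proof -
  have step: "deriv f \<in> X \<and> (\<forall>x. f field_differentiable at x)" if f: "f \<in> X" for f
  proof -
    obtain f' where f': "f' \<in> X" "\<And>x. (f has_field_derivative f' x) (at x)" using X[OF f] by blast
    have "deriv f = f'" using f'(2) by (auto intro: DERIV_imp_deriv)
    then show ?thesis using f' by (auto simp: field_differentiable_def)
  qed
  have "(deriv ^^ k) f \<in> X" for k by (induction k) (use assms(1) step in auto)
  then show ?thesis using step by (auto simp: smooth_def)
qed

lemma smooth_deriv: "smooth f \<Longrightarrow> smooth (deriv f)"
  unfolding smooth_def by (metis comp_apply funpow_Suc_right)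

lemma smooth_has_derivative: "smooth f \<Longrightarrow> (f has_field_derivative deriv f x) (at x)"
  using field_differentiable_derivI[of f x] by (auto simp: smooth_def dest: spec[of _ 0])

lemma smooth_antiderivative:
  assumes "\<And>x. (F has_field_derivative f x) (at x)" "smooth f"
  shows "smooth F"
proof (rule smooth_coinduct[of F "insert F (Collect smooth)"])
  fix g assume "g \<in> insert F (Collect smooth)"
  then show "\<exists>f'\<in>insert F (Collect smooth). \<forall>x. (g has_field_derivative f' x) (at x)"
  proof
    assume "g = F"
    then show ?thesis using assms by (intro bexI[of _ f]) auto
  next
    assume "g \<in> Collect smooth"
    then show ?thesis
      using smooth_has_derivative[of g] smooth_deriv[of g] by (intro bexI[of _ "deriv g"]) auto
  qed
qed simp

lemma smooth_linear_combination:
  assumes "smooth f" "smooth g"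
  shows "smooth (\<lambda>x. a * f x + b * g x)"
proof (rule smooth_coinduct[of _ "{\<lambda>x. a * f x + b * g x | f g. smooth f \<and> smooth g}"])
  fix h assume "h \<in> {\<lambda>x. a * f x + b * g x | f g. smooth f \<and> smooth g}"
  then obtain f g where h: "h = (\<lambda>x. a * f x + b * g x)" and fg: "smooth f" "smooth g" by blast
  have "(h has_field_derivative a * deriv f x + b * deriv g x) (at x)" for x
    unfolding h by (intro DERIV_add DERIV_cmult smooth_has_derivative fg)
  then show "\<exists>f'\<in>{\<lambda>x. a * f x + b * g x | f g. smooth f \<and> smooth g}.
      \<forall>x. (h has_field_derivative f' x) (at x)"
    using fg smooth_deriv by (intro bexI[of _ "\<lambda>x. a * deriv f x + b * deriv g x"]) blast+
qed (use assms in blast)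

lemma smooth_affine:
  assumes "smooth f"
  shows "smooth (\<lambda>x. f (a * x + b))"
proof (rule smooth_coinduct[of _ "{\<lambda>x. c * f (a * x + b) | c f. smooth f}"])
  fix h assume "h \<in> {\<lambda>x. c * f (a * x + b) | c f. smooth f}"
  then obtain c f where h: "h = (\<lambda>x. c * f (a * x + b))" and f: "smooth f" by blast
  have "(h has_field_derivative (c * a) * deriv f (a * x + b)) (at x)" for x
  proof -
    have "((\<lambda>x. f (a * x + b)) has_field_derivative deriv f (a * x + b) * a) (at x)"
      by (rule DERIV_chain2[OF smooth_has_derivative[OF f]]) (auto intro!: derivative_eq_intros)
    from DERIV_cmult[OF this, of c] show ?thesis unfolding h by (simp add: mult_ac)
  qed
  then show "\<exists>f'\<in>{\<lambda>x. c * f (a * x + b) | c f. smooth f}. \<forall>x. (h has_field_derivative f' x) (at x)"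
    using f smooth_deriv by (intro bexI[of _ "\<lambda>x. (c * a) * deriv f (a * x + b)"]) blast+
next
  show "(\<lambda>x. f (a * x + b)) \<in> {\<lambda>x. c * f (a * x + b) | c f. smooth f}"
    using assms by (intro CollectI exI[of _ 1] exI[of _ f]) simp
qed

text \<open>The derivative of a product is a sum of two products, so sums must be included to obtain
  a class closed under differentiation.\<close>

inductive_set sums_of_products :: "(real \<Rightarrow> real) set" where
  prod: "smooth u \<Longrightarrow> smooth v \<Longrightarrow> (\<lambda>x. u x * v x) \<in> sums_of_products"
| sum: "f \<in> sums_of_products \<Longrightarrow> g \<in> sums_of_products \<Longrightarrow> (\<lambda>x. f x + g x) \<in> sums_of_products"

lemma smooth_mult:
  assumes "smooth u" "smooth v"
  shows "smooth (\<lambda>x. u x * v x)"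
proof (rule smooth_coinduct[of _ sums_of_products])
  show "(\<lambda>x. u x * v x) \<in> sums_of_products" using assms by (rule prod)
next
  fix f assume "f \<in> sums_of_products"
  then show "\<exists>f'\<in>sums_of_products. \<forall>x. (f has_field_derivative f' x) (at x)"
  proof induction
    case (prod u v)
    have "((\<lambda>x. u x * v x) has_field_derivative deriv u x * v x + deriv v x * u x) (at x)" for x
      by (intro DERIV_mult smooth_has_derivative prod)
    moreover have "(\<lambda>x. deriv u x * v x + deriv v x * u x) \<in> sums_of_products"
      by (intro sums_of_products.intros smooth_deriv prod)
    ultimately show ?case by (rule_tac bexI[of _ "\<lambda>x. deriv u x * v x + deriv v x * u x"]) auto
  next
    case (sum f g)
    then obtain f' g' where "f' \<in> sums_of_products" "g' \<in> sums_of_products"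
      "\<And>x. (f has_field_derivative f' x) (at x)" "\<And>x. (g has_field_derivative g' x) (at x)" by blast
    then show ?case
      by (intro bexI[of _ "\<lambda>x. f' x + g' x"] sums_of_products.intros) (auto intro!: DERIV_add)
  qed
qed

text \<open>Polynomials in 1/x times exp(-1/x), extended by 0 to the left: the class of functions
  that contains all derivatives of the standard flat function, which is
  \<open>flat 1\<close>.\<close>

definition flat :: "real poly \<Rightarrow> real \<Rightarrow> real" where
  "flat p x = (if x \<le> 0 then 0 else poly p (1 / x) * exp (- (1 / x)))"

text \<open>For x > 0 the derivative carries the polynomial (1/x)^2 (p - p')(1/x), and
  \<open>[:0, 0, 1:]\<close> is the factor (1/x)^2. At 0 the substitution y = 1/h turns the right
  difference quotient into a polynomial in y divided by exp y, which tends to 0.\<close>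

lemma flat_derivative:
  "(flat p has_field_derivative flat ([:0, 0, 1:] * (p - pderiv p)) x) (at x)"
proof -
  consider "x < 0" | "0 < x" | "x = 0" by linarith
  then show ?thesis
  proof cases
    case 1
    have "((\<lambda>x. 0) has_field_derivative 0) (at x)" by simp
    then have "(flat p has_field_derivative 0) (at x)"
      by (rule has_field_derivative_transform_within_open[of _ _ _ "{..<0}"]) (use 1 in \<open>auto simp: flat_def\<close>)
    then show ?thesis using 1 by (simp add: flat_def)
  next
    case 2
    have inner: "((\<lambda>x. 1 / x) has_field_derivative - (1 / x)\<^sup>2) (at x)"
      using 2 by (auto intro!: derivative_eq_intros simp: power2_eq_square)
    have "((\<lambda>x. poly p (1 / x) * exp (- (1 / x))) has_field_derivative
        poly (pderiv p) (1 / x) * - (1 / x)\<^sup>2 * exp (- (1 / x)) +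
        exp (- (1 / x)) * - (- (1 / x)\<^sup>2) * poly p (1 / x)) (at x)"
      by (rule DERIV_mult[OF DERIV_chain2[OF poly_DERIV inner] DERIV_chain2[OF DERIV_exp DERIV_minus[OF inner]]])
    also have "poly (pderiv p) (1 / x) * - (1 / x)\<^sup>2 * exp (- (1 / x)) +
        exp (- (1 / x)) * - (- (1 / x)\<^sup>2) * poly p (1 / x) =
        poly ([:0, 0, 1:] * (p - pderiv p)) (1 / x) * exp (- (1 / x))"
      by (simp add: algebra_simps power2_eq_square)
    finally have "((\<lambda>x. poly p (1 / x) * exp (- (1 / x))) has_field_derivative
        poly ([:0, 0, 1:] * (p - pderiv p)) (1 / x) * exp (- (1 / x))) (at x)" .
    then have "(flat p has_field_derivative
        poly ([:0, 0, 1:] * (p - pderiv p)) (1 / x) * exp (- (1 / x))) (at x)"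
      by (rule has_field_derivative_transform_within_open[of _ _ _ "{0<..}"]) (use 2 in \<open>auto simp: flat_def\<close>)
    then show ?thesis using 2 by (simp add: flat_def)
  next
    case 3
    have "((\<lambda>h. (flat p (0 + h) - flat p 0) / h) \<longlongrightarrow> 0) (at 0)"
    proof (rule filterlim_split_at)
      have "eventually (\<lambda>h. 0 = (flat p (0 + h) - flat p 0) / h) (at_left 0)"
        by (auto simp: eventually_at_filter flat_def)
      then show "((\<lambda>h. (flat p (0 + h) - flat p 0) / h) \<longlongrightarrow> 0) (at_left 0)"
        by (rule Lim_transform_eventually[OF tendsto_const])
      have "((\<lambda>y::real. \<Sum>i\<le>degree p. coeff p i * (y ^ Suc i / exp y)) \<longlongrightarrow> (\<Sum>i\<le>degree p. coeff p i * 0)) at_top"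
        by (intro tendsto_sum tendsto_mult tendsto_const tendsto_power_div_exp_0)
      then have "((\<lambda>y::real. \<Sum>i\<le>degree p. coeff p i * (y ^ Suc i / exp y)) \<longlongrightarrow> 0) at_top" by simp
      moreover have "eventually (\<lambda>y. (\<Sum>i\<le>degree p. coeff p i * (y ^ Suc i / exp y)) =
          (flat p (0 + inverse y) - flat p 0) / inverse y) at_top"
        using eventually_gt_at_top[of 0]
      proof eventually_elim
        fix y :: real assume y: "0 < y"
        have "(flat p (0 + inverse y) - flat p 0) / inverse y = poly p y * exp (- y) * y"
          using y by (simp add: flat_def field_simps)
        also have "\<dots> = (\<Sum>i\<le>degree p. coeff p i * (y ^ Suc i / exp y))"
          by (simp add: poly_altdef sum_distrib_right sum_distrib_left exp_minus field_simps)
        finally show "(\<Sum>i\<le>degree p. coeff p i * (y ^ Suc i / exp y)) =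
          (flat p (0 + inverse y) - flat p 0) / inverse y" by simp
      qed
      ultimately have "((\<lambda>y. (flat p (0 + inverse y) - flat p 0) / inverse y) \<longlongrightarrow> 0) at_top"
        by (rule Lim_transform_eventually)
      then show "((\<lambda>h. (flat p (0 + h) - flat p 0) / h) \<longlongrightarrow> 0) (at_right 0)"
        by (simp add: filterlim_at_right_to_top)
    qed
    then show ?thesis unfolding 3 DERIV_def by (simp add: flat_def)
  qed
qed

lemma smooth_flat: "smooth (flat p)"
proof (rule smooth_coinduct[of _ "range flat"])
  fix f assume "f \<in> range flat"
  then obtain p where "f = flat p" by blast
  then show "\<exists>f'\<in>range flat. \<forall>x. (f has_field_derivative f' x) (at x)"
    using flat_derivative[of p] by (intro bexI[of _ "flat ([:0, 0, 1:] * (p - pderiv p))"]) simp_all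
qed simp

section \<open>Antiderivatives and construction of the mollifier\<close>

lemma continuous_on_of_derivative:
  fixes f :: "real \<Rightarrow> real"
  assumes "\<And>x. (f has_field_derivative f' x) (at x)"
  shows "continuous_on S f"
  by (rule DERIV_continuous_on[OF has_field_derivative_at_within[OF assms]])

lemma antiderivative_right_supported:
  fixes f :: "real \<Rightarrow> real"
  assumes cont: "continuous_on UNIV f" and zero: "\<And>x. x \<le> 0 \<Longrightarrow> f x = 0"
  shows "\<exists>F. (\<forall>x. (F has_field_derivative f x) (at x)) \<and> (\<forall>x\<le>0. F x = 0)"
\<comment> \<open>The lower limit -1 lies where \<open>f\<close> vanishes, so every x \<ge> 0 is
  interior to the interval from -1 to x + 1 and the derivative there is two-sided.\<close>
proof (intro exI[of _ "\<lambda>x. integral {-1..x} f"] conjI allI impI)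
  have neg: "integral {-1..x} f = 0" if "x \<le> 0" for x
  proof -
    have "integral {-1..x} f = integral {-1..x} (\<lambda>x. 0)"
      using that by (intro integral_cong zero) auto
    then show ?thesis by simp
  qed
  then show "\<And>x. x \<le> 0 \<Longrightarrow> integral {-1..x} f = 0" .
  fix x :: real
  show "((\<lambda>x. integral {-1..x} f) has_field_derivative f x) (at x)"
  proof (cases "x < 0")
    case True
    have "((\<lambda>x. 0) has_field_derivative 0) (at x)" by simp
    then have "((\<lambda>x. integral {-1..x} f) has_field_derivative 0) (at x)"
      by (rule has_field_derivative_transform_within_open[of _ _ _ "{..<0}"]) (use True neg in auto)
    then show ?thesis using True zero[of x] by simp
  next
    case False
    have "((\<lambda>x. integral {-1..x} f) has_vector_derivative f x) (at x within {-1..x+1})"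
      using cont False by (intro integral_has_vector_derivative) (auto intro: continuous_on_subset)
    then show ?thesis
      using False by (simp add: at_within_Icc_at has_real_derivative_iff_has_vector_derivative)
  qed
qed

text \<open>Three levels of one object: \<rho> is a bump of mass 1 on [0,1], \<open>R\<close> is a
  smoothed unit step, and \<open>Q\<close> is a smoothed positive part, up to a constant. Rescaled
  and shifted, they approximate point evaluations, indicators of intervals (by differences of
  \<open>R\<close>) and tents (by second differences of \<open>Q\<close>).\<close>

locale mollifier =
  fixes \<rho> R Q :: "real \<Rightarrow> real"
  assumes smooth_Q: "smooth Q"
    and Q': "\<And>x. (Q has_field_derivative R x) (at x)"
    and R': "\<And>x. (R has_field_derivative \<rho> x) (at x)"
    and \<rho>_nonneg: "\<And>x. 0 \<le> \<rho> x" and \<rho>_cont: "continuous_on UNIV \<rho>"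
    and \<rho>_0: "\<And>x. x \<le> 0 \<Longrightarrow> \<rho> x = 0" "\<And>x. 1 \<le> x \<Longrightarrow> \<rho> x = 0"
    and R_0: "\<And>x. x \<le> 0 \<Longrightarrow> R x = 0" and R_1: "\<And>x. 1 \<le> x \<Longrightarrow> R x = 1"
    and Q_0: "\<And>x. x \<le> 0 \<Longrightarrow> Q x = 0"

lemma mollifier_exists: "\<exists>\<rho> R Q. mollifier \<rho> R Q"
proof -
  \<comment> \<open>The product is positive exactly on (0,1). Its mass \<open>R 1\<close> is divided
    out afterwards.\<close>
  define \<rho> where "\<rho> x = flat 1 x * flat 1 ((-1) * x + 1)" for x
  have "smooth \<rho>" unfolding \<rho>_def by (intro smooth_mult smooth_affine smooth_flat)
  then have cont: "continuous_on UNIV \<rho>"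
    by (intro continuous_on_of_derivative[OF smooth_has_derivative])
  have \<rho>0: "\<rho> x = 0" if "x \<le> 0" for x using that by (simp add: \<rho>_def flat_def)
  have \<rho>1: "\<rho> x = 0" if "1 \<le> x" for x using that by (simp add: \<rho>_def flat_def)
  have \<rho>nn: "0 \<le> \<rho> x" for x by (simp add: \<rho>_def flat_def)
  have \<rho>pos: "0 < \<rho> x" if "0 < x" "x < 1" for x using that by (simp add: \<rho>_def flat_def)
  obtain R where R: "\<And>x. (R has_field_derivative \<rho> x) (at x)" and R0: "\<And>x. x \<le> 0 \<Longrightarrow> R x = 0"
    using antiderivative_right_supported[OF cont \<rho>0] by blast
  have "R 0 < R 1"
  proof (rule DERIV_pos_imp_increasing_open[of 0 1 R])
    show "\<exists>y. (R has_field_derivative y) (at x) \<and> 0 < y" if "0 < x" "x < 1" for x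
      using R \<rho>pos[OF that] by blast
    show "continuous_on {0..1} R" by (rule continuous_on_of_derivative[OF R])
  qed simp
  then have pos: "0 < R 1" using R0[of 0] by simp
  have R1: "R x = R 1" if "1 \<le> x" for x
  proof (cases "x = 1")
    case False
    then show ?thesis
    proof (intro DERIV_isconst_end[of 1 x R])
      show "continuous_on {1..x} R" by (rule continuous_on_of_derivative[OF R])
      show "(R has_field_derivative 0) (at y)" if "1 < y" "y < x" for y using R[of y] \<rho>1[of y] that by simp
    qed (use that in auto)
  qed simp
  define \<rho>' where "\<rho>' x = \<rho> x / R 1" for x
  define R' where "R' x = R x / R 1" for x
  have R': "(R' has_field_derivative \<rho>' x) (at x)" for x
    unfolding R'_def \<rho>'_def by (intro DERIV_cdivide R)
  have sR: "smooth R'"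
  proof (rule smooth_antiderivative[OF R'])
    show "smooth \<rho>'" using smooth_linear_combination[OF \<open>smooth \<rho>\<close> \<open>smooth \<rho>\<close>, of "1 / R 1" 0]
      by (simp add: \<rho>'_def[abs_def])
  qed
  have "continuous_on UNIV R'" by (rule continuous_on_of_derivative[OF R'])
  moreover have R'0: "R' x = 0" if "x \<le> 0" for x using R0[OF that] by (simp add: R'_def)
  ultimately obtain Q where Q: "\<And>x. (Q has_field_derivative R' x) (at x)" and Q0: "\<And>x. x \<le> 0 \<Longrightarrow> Q x = 0"
    using antiderivative_right_supported by blast
  have R'1: "R' x = 1" if "1 \<le> x" for x
    unfolding R'_def R1[OF that] using pos by simp
  have "mollifier \<rho>' R' Q"
  proof
    show "smooth Q" by (rule smooth_antiderivative[OF Q sR])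
    show "continuous_on UNIV \<rho>'" unfolding \<rho>'_def using pos by (intro continuous_intros cont) auto
  qed (use Q R' \<rho>nn \<rho>0 \<rho>1 R'0 R'1 Q0 pos in \<open>auto simp: \<rho>'_def\<close>)
  then show ?thesis by blast
qed

context mollifier
begin

lemma smooth_R: "smooth R"
proof -
  have "deriv Q = R" using Q' by (auto intro: DERIV_imp_deriv)
  then show ?thesis using smooth_deriv[OF smooth_Q] by simp
qed

lemma R_mono: "x \<le> y \<Longrightarrow> R x \<le> R y"
  using R' \<rho>_nonneg by (auto intro: DERIV_nonneg_imp_nondecreasing[of x y R])

lemma R_bounds: "0 \<le> R x" "R x \<le> 1"
  using R_mono[of 0 "max x 0"] R_mono[of "min x 0" x] R_0[of 0] R_0[of "min x 0"] R_mono[of x "max x 1"] R_1[of "max x 1"]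
  by auto

lemma Q_increment:
  assumes "x \<le> y"
  shows "0 \<le> Q y - Q x" "Q y - Q x \<le> y - x"
proof -
  have "Q x \<le> Q y"
    using Q' R_bounds assms by (intro DERIV_nonneg_imp_nondecreasing[of x y Q]) blast+
  then show "0 \<le> Q y - Q x" by simp
  have "((\<lambda>x. x - Q x) has_field_derivative 1 - R z) (at z)" for z
    by (intro DERIV_diff DERIV_ident Q')
  then have "x - Q x \<le> y - Q y"
    using R_bounds(2) assms by (intro DERIV_nonneg_imp_nondecreasing[of x y "\<lambda>x. x - Q x"]) (auto intro: diff_ge_0_iff_ge[THEN iffD2])
  then show "Q y - Q x \<le> y - x" by simp
qed

lemma Q_linear:
  assumes "1 \<le> x" "1 \<le> y"
  shows "Q y - Q x = y - x"
proof -
  have *: "Q y - Q x = y - x" if "1 \<le> x" "x < y" for x y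
  proof -
    have d: "((\<lambda>x. x - Q x) has_field_derivative 1 - R z) (at z)" for z
      by (intro DERIV_diff DERIV_ident Q')
    have "y - Q y = x - Q x"
    proof (rule DERIV_isconst_end[of x y "\<lambda>x. x - Q x"])
      show "continuous_on {x..y} (\<lambda>x. x - Q x)"
        by (rule continuous_on_of_derivative[OF d])
      show "((\<lambda>x. x - Q x) has_field_derivative 0) (at z)" if "x < z" "z < y" for z
        using d[of z] R_1[of z] that \<open>1 \<le> x\<close> by simp
    qed (use that in auto)
    then show ?thesis by simp
  qed
  show ?thesis using *[of x y] *[of y x] assms by (cases x y rule: linorder_cases) auto
qed

end

section \<open>Slopes\<close>

definition slope :: "(real \<Rightarrow> real) \<Rightarrow> real \<Rightarrow> real \<Rightarrow> real" where
  "slope f u v = (f v - f u) / (v - u)"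

lemma slope_split:
  assumes "u < m" "m < v"
  shows "(v - u) * slope f u v = (m - u) * slope f u m + (v - m) * slope f m v"
  using assms by (simp add: slope_def)

text \<open>Comparing slopes along a chain of intervals, each half as long as the previous one.\<close>

lemma slope_chain:
  fixes f :: "real \<Rightarrow> real"
  assumes \<alpha>: "0 < \<alpha>" and C: "0 \<le> C"
    and half: "\<And>u v c d. a \<le> u \<Longrightarrow> u \<le> c \<Longrightarrow> c < d \<Longrightarrow> d \<le> v \<Longrightarrow> v \<le> b \<Longrightarrow> v - u \<le> 2 * (d - c) \<Longrightarrow>
      \<bar>slope f c d - slope f u v\<bar> \<le> C * (v - u) powr \<alpha>"
    and uv: "a \<le> u" "u \<le> c" "c < d" "d \<le> v" "v \<le> b"
  shows "\<bar>slope f c d - slope f u v\<bar> \<le> C / (1 - 2 powr (-\<alpha>)) * (v - u) powr \<alpha>"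
proof -
  define C' where "C' = C / (1 - 2 powr (-\<alpha>))"
  have p: "0 < (2::real) powr (-\<alpha>)" "(2::real) powr (-\<alpha>) < 1" using \<alpha> by (auto simp: powr_less_one)
  \<comment> \<open>\<open>C'\<close> is the geometric series of C 2^(-\<alpha> j), recorded as a
    fixed point equation: one halving step costs \<open>C\<close>, and the rest of the chain costs
    \<open>C'\<close> on an interval of half the length.\<close>
  have C': "C + C' * 2 powr (-\<alpha>) = C'"
  proof -
    have *: "C / x * x = C" if "x \<noteq> 0" for x using that by simp
    have "1 - (2::real) powr (-\<alpha>) \<noteq> 0" using p(2) by linarith
    from *[OF this] have "C' * (1 - 2 powr (-\<alpha>)) = C" unfolding C'_def .
    then show ?thesis by (simp only: right_diff_distrib)
  qed
  have C'0: "0 \<le> C'" using p C by (simp add: C'_def)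
  have CC': "C \<le> C'"
  proof -
    have "0 \<le> C' * 2 powr (-\<alpha>)" using C'0 by simp
    then show ?thesis using C' by linarith
  qed
  have main: "\<bar>slope f c d - slope f u v\<bar> \<le> C' * (v - u) powr \<alpha>"
    if "v - u \<le> 2 ^ Suc n * (d - c)" "a \<le> u" "u \<le> c" "d \<le> v" "v \<le> b" for n u v
    using that
  proof (induction n arbitrary: u v)
    case 0
    then have "\<bar>slope f c d - slope f u v\<bar> \<le> C * (v - u) powr \<alpha>" using uv by (intro half) auto
    also have "\<dots> \<le> C' * (v - u) powr \<alpha>" by (intro mult_right_mono CC') simp
    finally show ?case .
  next
    case (Suc n)
    show ?case
    proof (cases "v - u \<le> 2 * (d - c)")
      case True
      then have "\<bar>slope f c d - slope f u v\<bar> \<le> C * (v - u) powr \<alpha>" using uv Suc.prems by (intro half) auto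
      also have "\<dots> \<le> C' * (v - u) powr \<alpha>" by (intro mult_right_mono CC') simp
      finally show ?thesis .
    next
      case False
      define w where "w = (v - u) / 2"
      have w: "2 * w = v - u" by (simp add: w_def)
      \<comment> \<open>An interval of half the length of [u,v] is placed between [c,d] and [u,v].
        It ends at \<open>d\<close> if that keeps it to the right of \<open>u\<close>, and otherwise
        starts at \<open>u\<close>.\<close>
      define p where "p = max u (d - w)"
      define q where "q = p + w"
      have dw: "d - w < c" using w False by argo
      have pq: "u \<le> p" "p \<le> c" "d \<le> q" "q \<le> v" "q - p = w"
        using w dw Suc.prems(3,4) uv(3) by (auto simp: p_def q_def max_def)
      have "\<bar>slope f c d - slope f p q\<bar> \<le> C' * (q - p) powr \<alpha>"
      proof (rule Suc.IH)
        have "2 * w \<le> 2 * (2 ^ Suc n * (d - c))" unfolding w using Suc.prems(1) by (simp add: mult.assoc)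
        then show "q - p \<le> 2 ^ Suc n * (d - c)" unfolding pq(5) by (simp only: mult_le_cancel_left_pos zero_less_numeral)
      qed (use Suc.prems pq in auto)
      also have "(q - p) powr \<alpha> = 2 powr (-\<alpha>) * (v - u) powr \<alpha>"
      proof -
        have "((v - u) / 2) powr \<alpha> = (v - u) powr \<alpha> / 2 powr \<alpha>" by (rule powr_divide)
        then show ?thesis unfolding pq(5) w_def powr_minus_divide by simp
      qed
      finally have 1: "\<bar>slope f c d - slope f p q\<bar> \<le> C' * (2 powr (-\<alpha>) * (v - u) powr \<alpha>)" .
      have 2: "\<bar>slope f p q - slope f u v\<bar> \<le> C * (v - u) powr \<alpha>"
      proof (rule half)
        show "v - u \<le> 2 * (q - p)" unfolding pq(5) w by simp
      qed (use pq Suc.prems uv in auto)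
      have "\<bar>slope f c d - slope f u v\<bar> \<le> (C + C' * 2 powr (-\<alpha>)) * (v - u) powr \<alpha>"
        using 1 2 unfolding distrib_right mult.assoc by linarith
      then show ?thesis unfolding C' .
    qed
  qed
  obtain n where "(v - u) / (d - c) < 2 ^ n" using real_arch_pow[of 2 "(v - u) / (d - c)"] by auto
  then have "v - u < 2 ^ n * (d - c)" using uv by (simp add: pos_divide_less_eq)
  also have "\<dots> \<le> 2 ^ Suc n * (d - c)" using uv by simp
  finally show ?thesis using main[of v u n] uv unfolding C'_def by simp
qed

text \<open>Slopes over intervals shrinking to \<open>t\<close> form a Cauchy sequence with limit
  \<open>D t\<close>, and the slope over any interval containing \<open>t\<close> differs from
  \<open>D t\<close> by at most a multiple of its length to the power \<alpha>. Applied to the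
  interval between two points, this bounds both the error of the difference quotient and the
  oscillation of \<open>D\<close>, end points included.\<close>

lemma C1_of_slopes:
  fixes f :: "real \<Rightarrow> real"
  assumes ab: "a < b" and \<alpha>: "0 < \<alpha>" and C: "0 \<le> C"
    and half: "\<And>u v c d. a \<le> u \<Longrightarrow> u \<le> c \<Longrightarrow> c < d \<Longrightarrow> d \<le> v \<Longrightarrow> v \<le> b \<Longrightarrow> v - u \<le> 2 * (d - c) \<Longrightarrow>
      \<bar>slope f c d - slope f u v\<bar> \<le> C * (v - u) powr \<alpha>"
  shows "\<exists>D. continuous_on {a..b} D \<and>
    (\<forall>t\<in>{a..b}. (f has_vector_derivative D t) (at t within {a..b}))"
proof -
  define C' where "C' = C / (1 - 2 powr (-\<alpha>))"
  have "(2::real) powr (-\<alpha>) < 1" using \<alpha> by (auto simp: powr_less_one)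
  then have C'0: "0 \<le> C'" using C by (simp add: C'_def)
  note chain = slope_chain[of \<alpha> C a b f, OF \<alpha> C half, folded C'_def]
  \<comment> \<open>Both distances from \<open>t\<close> to the ends of [a,b] are scaled by 2^(-n).
    The intervals stay inside [a,b] and have length (b-a)/2^n for every \<open>t\<close>, including
    the end points, where one side degenerates.\<close>
  define lo where "lo t n = t - (t - a) * (1/2) ^ n" for t and n :: nat
  define hi where "hi t n = t + (b - t) * (1/2) ^ n" for t and n :: nat
  have len: "hi t n - lo t n = (b - a) * (1/2) ^ n" for t n
    by (simp add: lo_def hi_def field_simps)
  have len0: "(\<lambda>n. (b - a) * (1/2) ^ n) \<longlonglongrightarrow> 0"
    by (rule tendsto_mult_right_zero) (simp add: LIMSEQ_realpow_zero)
  have lt: "lo t n < hi t n" for t n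
  proof -
    have "0 < (b - a) * (1/2) ^ n" using ab by simp
    then show ?thesis using len[of t n] by linarith
  qed
  have in_ab: "a \<le> lo t n" "lo t n \<le> t" "t \<le> hi t n" "hi t n \<le> b" if t: "t \<in> {a..b}" for t n
  proof -
    have "(t - a) * (1/2) ^ n \<le> (t - a) * 1" "(b - t) * (1/2) ^ n \<le> (b - t) * 1"
      using t by (intro mult_left_mono; simp add: power_le_one)+
    then show "a \<le> lo t n" "hi t n \<le> b" by (auto simp: lo_def hi_def)
    show "lo t n \<le> t" "t \<le> hi t n" using t by (auto simp: lo_def hi_def)
  qed
  define \<sigma> where "\<sigma> t n = slope f (lo t n) (hi t n)" for t n
  have near: "\<bar>slope f c d - \<sigma> t n\<bar> \<le> 2 * C' * (d - c + (b - a) * (1/2) ^ n) powr \<alpha>"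
    if t: "t \<in> {c..d}" and cd: "a \<le> c" "c < d" "d \<le> b" for t c d n
  proof -
    have tab: "t \<in> {a..b}" using t cd by auto
    note i = in_ab[OF tab, of n]
    \<comment> \<open>Two intervals that share \<open>t\<close> are compared through the smallest
      interval containing both, whose length is at most the sum of theirs.\<close>
    define u where "u = min c (lo t n)"
    define v where "v = max d (hi t n)"
    have uv: "a \<le> u" "u \<le> c" "d \<le> v" "v \<le> b" "u \<le> lo t n" "hi t n \<le> v" using i cd by (auto simp: u_def v_def)
    have vu: "v - u \<le> d - c + (b - a) * (1/2) ^ n"
      using len[of t n] t i by (auto simp: u_def v_def min_def max_def)
    have 1: "\<bar>slope f c d - slope f u v\<bar> \<le> C' * (v - u) powr \<alpha>"
      by (rule chain) (use uv cd in auto)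
    have 2: "\<bar>\<sigma> t n - slope f u v\<bar> \<le> C' * (v - u) powr \<alpha>"
      unfolding \<sigma>_def by (rule chain) (use uv lt in auto)
    have "C' * (v - u) powr \<alpha> \<le> C' * (d - c + (b - a) * (1/2) ^ n) powr \<alpha>"
      using vu uv cd \<alpha> C'0 by (intro mult_left_mono powr_mono2) auto
    with 1 2 show ?thesis by linarith
  qed
  have Cauchy: "Cauchy (\<sigma> t)" if t: "t \<in> {a..b}" for t
  proof (rule metric_CauchyI)
    fix e :: real assume e: "0 < e"
    have "((\<lambda>n. 2 * C' * ((b - a) * (1/2) ^ n + (b - a) * (1/2) ^ n) powr \<alpha>) \<longlongrightarrow> 2 * C' * ((0 + 0) powr \<alpha>)) sequentially"
      using \<alpha> ab by (intro tendsto_mult tendsto_const tendsto_powr2 tendsto_add len0) (auto intro!: always_eventually)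
    then have "((\<lambda>n. 2 * C' * ((b - a) * (1/2) ^ n + (b - a) * (1/2) ^ n) powr \<alpha>) \<longlongrightarrow> 0) sequentially" by simp
    then obtain N where N: "\<And>n. n \<ge> N \<Longrightarrow> 2 * C' * ((b - a) * (1/2) ^ n + (b - a) * (1/2) ^ n) powr \<alpha> < e / 2"
      using order_tendstoD(2)[of _ 0 sequentially "e / 2"] e unfolding eventually_sequentially by force
    have "\<bar>\<sigma> t N - \<sigma> t n\<bar> < e / 2" if "n \<ge> N" for n
    proof -
      have "(1/2::real) ^ n \<le> (1/2) ^ N" using that by (intro power_decreasing) auto
      then have le: "(b - a) * (1/2) ^ n \<le> (b - a) * (1/2) ^ N" using ab by simp
      have "\<bar>slope f (lo t N) (hi t N) - \<sigma> t n\<bar> \<le> 2 * C' * (hi t N - lo t N + (b - a) * (1/2) ^ n) powr \<alpha>"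
        by (rule near) (use in_ab[OF t, of N] lt[of t N] in auto)
      also have "\<dots> \<le> 2 * C' * ((b - a) * (1/2) ^ N + (b - a) * (1/2) ^ N) powr \<alpha>"
        unfolding len using ab \<alpha> C'0 le by (intro mult_left_mono powr_mono2) auto
      finally show ?thesis using N[of N] by (simp add: \<sigma>_def)
    qed
    then have "dist (\<sigma> t m) (\<sigma> t n) < e" if "m \<ge> N" "n \<ge> N" for m n
      unfolding dist_real_def using that by (smt (verit) field_sum_of_halves)
    then show "\<exists>M. \<forall>m\<ge>M. \<forall>n\<ge>M. dist (\<sigma> t m) (\<sigma> t n) < e" by blast
  qed
  define D where "D t = lim (\<sigma> t)" for t
  have \<sigma>D: "\<sigma> t \<longlonglongrightarrow> D t" if "t \<in> {a..b}" for t
    unfolding D_def using Cauchy[OF that] by (simp add: Cauchy_convergent_iff convergent_LIMSEQ_iff)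
  have slope_D: "\<bar>slope f c d - D t\<bar> \<le> 2 * C' * (d - c) powr \<alpha>"
    if t: "t \<in> {c..d}" and cd: "a \<le> c" "c < d" "d \<le> b" for t c d
  proof (rule LIMSEQ_le)
    show "(\<lambda>n. \<bar>slope f c d - \<sigma> t n\<bar>) \<longlonglongrightarrow> \<bar>slope f c d - D t\<bar>"
      using t cd by (intro tendsto_intros \<sigma>D) auto
    have "(\<lambda>n. 2 * C' * (d - c + (b - a) * (1/2) ^ n) powr \<alpha>) \<longlonglongrightarrow> 2 * C' * (d - c + 0) powr \<alpha>"
      using cd by (intro tendsto_intros len0) auto
    then show "(\<lambda>n. 2 * C' * (d - c + (b - a) * (1/2) ^ n) powr \<alpha>) \<longlonglongrightarrow> 2 * C' * (d - c) powr \<alpha>" by simp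
    show "\<exists>N. \<forall>n\<ge>N. \<bar>slope f c d - \<sigma> t n\<bar> \<le> 2 * C' * (d - c + (b - a) * (1/2) ^ n) powr \<alpha>"
      using near[OF that] by blast
  qed
  have slope_D': "\<bar>(f y - f t) / (y - t) - D t\<bar> \<le> 2 * C' * \<bar>y - t\<bar> powr \<alpha>"
    and D_diff: "\<bar>D y - D t\<bar> \<le> 4 * C' * \<bar>y - t\<bar> powr \<alpha>"
    if "t \<in> {a..b}" "y \<in> {a..b}" "y \<noteq> t" for t y
  proof -
    have sl: "(f y - f t) / (y - t) = slope f (min y t) (max y t)"

    proof (cases "t < y")
      case False
      then have "min y t = y" "max y t = t" by auto
      then show ?thesis using minus_divide_divide[of "f y - f t" "y - t"] by (simp only: slope_def minus_diff_eq)
    qed (simp add: slope_def)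
    have ab: "max y t - min y t = \<bar>y - t\<bar>" by auto
    show 1: "\<bar>(f y - f t) / (y - t) - D t\<bar> \<le> 2 * C' * \<bar>y - t\<bar> powr \<alpha>"
      unfolding sl ab[symmetric] using that by (intro slope_D) auto
    have 2: "\<bar>(f y - f t) / (y - t) - D y\<bar> \<le> 2 * C' * \<bar>y - t\<bar> powr \<alpha>"
      unfolding sl ab[symmetric] using that by (intro slope_D) auto
    show "\<bar>D y - D t\<bar> \<le> 4 * C' * \<bar>y - t\<bar> powr \<alpha>" using 1 2 by linarith
  qed
  have lim0: "((\<lambda>y. K * \<bar>y - t\<bar> powr \<alpha>) \<longlongrightarrow> 0) (at t within {a..b})" for K t
  proof -
    have "((\<lambda>y. K * \<bar>y - t\<bar> powr \<alpha>) \<longlongrightarrow> K * \<bar>t - t\<bar> powr \<alpha>) (at t within {a..b})"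
      using \<alpha> by (intro tendsto_mult tendsto_const tendsto_powr2 tendsto_intros) auto
    then show ?thesis by simp
  qed
  show ?thesis
  proof (intro exI[of _ D] conjI ballI)
    show "continuous_on {a..b} D"
      unfolding continuous_on
    proof
      fix t assume t: "t \<in> {a..b}"
      have "((\<lambda>y. D y - D t) \<longlongrightarrow> 0) (at t within {a..b})"
        by (rule Lim_null_comparison[OF _ lim0[of "4 * C'"]])
          (use D_diff[OF t] in \<open>auto simp: eventually_at intro!: exI[of _ 1]\<close>)
      then show "(D \<longlongrightarrow> D t) (at t within {a..b})" by (rule LIM_zero_cancel)
    qed
    fix t assume t: "t \<in> {a..b}"
    have "((\<lambda>y. (f y - f t) / (y - t) - D t) \<longlongrightarrow> 0) (at t within {a..b})"
      by (rule Lim_null_comparison[OF _ lim0[of "2 * C'"]])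
        (use slope_D'[OF t] in \<open>auto simp: eventually_at intro!: exI[of _ 1]\<close>)
    then have "((\<lambda>y. (f y - f t) / (y - t)) \<longlongrightarrow> D t) (at t within {a..b})" by (rule LIM_zero_cancel)
    then show "(f has_vector_derivative D t) (at t within {a..b})"
      by (simp add: has_field_derivative_iff has_real_derivative_iff_has_vector_derivative[symmetric])
  qed
qed

lemma slope_limit_interior:
  fixes f :: "real \<Rightarrow> real"
  assumes ab: "a < b" and cont: "continuous_on {a..b} f" and x: "x \<in> {a..b}"
  shows "((\<lambda>\<epsilon>. f (x + \<epsilon> * ((a + b) / 2 - x))) \<longlongrightarrow> f x) (at_right 0)"
proof -
  have "((\<lambda>\<epsilon>. x + \<epsilon> * ((a + b) / 2 - x)) \<longlongrightarrow> x + 0 * ((a + b) / 2 - x)) (at_right 0)"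
    by (intro tendsto_intros)
  moreover have "eventually (\<lambda>\<epsilon>. x + \<epsilon> * ((a + b) / 2 - x) \<in> {a..b}) (at_right 0)"
  proof -
    have "eventually (\<lambda>\<epsilon>::real. \<epsilon> \<in> {0<..<1}) (at_right 0)" by (rule eventually_at_right_real) simp
    then show ?thesis
    proof eventually_elim
      fix \<epsilon> :: real assume e: "\<epsilon> \<in> {0<..<1}"
      have "x + \<epsilon> * ((a + b) / 2 - x) = (1 - \<epsilon>) * x + \<epsilon> * ((a + b) / 2)" by (simp add: algebra_simps)
      moreover have "\<dots> \<in> {a..b}"
        using convexD_alt[of "{a..b}" x "(a+b)/2" \<epsilon>] e x ab by (simp add: convex_real_interval)
      ultimately show "x + \<epsilon> * ((a + b) / 2 - x) \<in> {a..b}" by simp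
    qed
  qed
  ultimately show ?thesis
    using continuous_on_tendsto_compose[OF cont, of "\<lambda>\<epsilon>. x + \<epsilon> * ((a + b) / 2 - x)" x] x by simp
qed

text \<open>Estimates obtained by testing reach only intervals strictly inside.
  \<open>S \<epsilon>\<close> contracts towards the midpoint; being affine, it preserves the ratio
  of lengths in the half-length condition, and continuity of \<open>f\<close> lets the slopes pass
  to the limit \<epsilon> = 0.\<close>

lemma C1_of_interior_slopes:
  fixes f :: "real \<Rightarrow> real"
  assumes ab: "a < b" and \<alpha>: "0 < \<alpha>" and C: "0 \<le> C" and cont: "continuous_on {a..b} f"
    and half: "\<And>u v c d. a < u \<Longrightarrow> u \<le> c \<Longrightarrow> c < d \<Longrightarrow> d \<le> v \<Longrightarrow> v < b \<Longrightarrow> v - u \<le> 2 * (d - c) \<Longrightarrow>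
      \<bar>slope f c d - slope f u v\<bar> \<le> C * (v - u) powr \<alpha>"
  shows "\<exists>D. continuous_on {a..b} D \<and>
    (\<forall>t\<in>{a..b}. (f has_vector_derivative D t) (at t within {a..b}))"
proof (rule C1_of_slopes[OF ab \<alpha> C])
  fix u v c d :: real
  assume uv: "a \<le> u" "u \<le> c" "c < d" "d \<le> v" "v \<le> b" "v - u \<le> 2 * (d - c)"
  define S where "S \<epsilon> x = x + \<epsilon> * ((a + b) / 2 - x)" for \<epsilon> x :: real
  have fS: "((\<lambda>\<epsilon>. f (S \<epsilon> x)) \<longlongrightarrow> f x) (at_right 0)" if "x \<in> {a..b}" for x
    unfolding S_def by (rule slope_limit_interior[OF ab cont that])
  have S: "((\<lambda>\<epsilon>. S \<epsilon> x) \<longlongrightarrow> x) (at_right 0)" for x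
    unfolding S_def by (rule tendsto_eq_rhs, (rule tendsto_intros)+) simp
  show "\<bar>slope f c d - slope f u v\<bar> \<le> C * (v - u) powr \<alpha>"
  proof (rule tendsto_le[of "at_right 0"])
    show "((\<lambda>\<epsilon>. \<bar>slope f (S \<epsilon> c) (S \<epsilon> d) - slope f (S \<epsilon> u) (S \<epsilon> v)\<bar>) \<longlongrightarrow> \<bar>slope f c d - slope f u v\<bar>) (at_right 0)"
      unfolding slope_def using uv by (intro tendsto_intros fS S) auto
    show "((\<lambda>\<epsilon>. C * (S \<epsilon> v - S \<epsilon> u) powr \<alpha>) \<longlongrightarrow> C * (v - u) powr \<alpha>) (at_right 0)"
      using uv by (intro tendsto_intros S) auto
    have "eventually (\<lambda>\<epsilon>::real. \<epsilon> \<in> {0<..<1}) (at_right 0)" by (rule eventually_at_right_real) simp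
    then show "eventually (\<lambda>\<epsilon>. \<bar>slope f (S \<epsilon> c) (S \<epsilon> d) - slope f (S \<epsilon> u) (S \<epsilon> v)\<bar> \<le> C * (S \<epsilon> v - S \<epsilon> u) powr \<alpha>) (at_right 0)"
    proof eventually_elim
      fix \<epsilon> :: real assume e: "\<epsilon> \<in> {0<..<1}"
      have S: "S \<epsilon> x = (1 - \<epsilon>) * x + \<epsilon> * ((a + b) / 2)" for x by (simp add: S_def algebra_simps)
      have mono: "S \<epsilon> x \<le> S \<epsilon> y" if "x \<le> y" for x y using that e by (simp add: S)
      have "0 < \<epsilon> * (b - a)" using e ab by simp
      then have "a < S \<epsilon> a" "S \<epsilon> b < b" by (auto simp: S_def field_simps)
      moreover have "S \<epsilon> c < S \<epsilon> d" using e uv by (simp add: S)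
      moreover have "S \<epsilon> v - S \<epsilon> u \<le> 2 * (S \<epsilon> d - S \<epsilon> c)"
      proof -
        have len: "S \<epsilon> y - S \<epsilon> x = (1 - \<epsilon>) * (y - x)" for x y by (simp add: S algebra_simps)
        have "(1 - \<epsilon>) * (v - u) \<le> (1 - \<epsilon>) * (2 * (d - c))" using e uv by (intro mult_left_mono) auto
        also have "\<dots> = 2 * ((1 - \<epsilon>) * (d - c))" by (rule mult.left_commute)
        finally show ?thesis unfolding len .
      qed
      ultimately show "\<bar>slope f (S \<epsilon> c) (S \<epsilon> d) - slope f (S \<epsilon> u) (S \<epsilon> v)\<bar> \<le> C * (S \<epsilon> v - S \<epsilon> u) powr \<alpha>"
        using mono[of a u] mono[of u c] mono[of d v] mono[of v b] uv by (intro half) simp_all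
    qed
  qed simp
qed

section \<open>Continuous differentiability of Sobolev functions\<close>

lemma finite_measure_Ioo: "finite_measure (lebesgue_on {0<..<T::real})"
  by (rule finite_measure_lebesgue_on) (simp add: lmeasurable_interval)

lemma continuous_integrable_Ioo:
  fixes f :: "real \<Rightarrow> real"
  assumes "continuous_on {0..T} f"
  shows "integrable (lebesgue_on {0<..<T}) f"
proof -
  interpret finite_measure "lebesgue_on {0<..<T}" by (rule finite_measure_Ioo)
  have "bounded (f ` {0..T})" using assms by (intro compact_imp_bounded compact_continuous_image) auto
  then obtain B where "\<forall>y\<in>f ` {0..T}. norm y \<le> B" unfolding bounded_iff by blast
  then have B: "\<bar>f x\<bar> \<le> B" if "x \<in> {0..T}" for x using that by simp
  have "f \<in> borel_measurable (lebesgue_on {0<..<T})"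
    using assms by (intro continuous_imp_measurable_on_sets_lebesgue) (auto intro: continuous_on_subset)
  then show ?thesis using B by (intro integrable_const_bound[of _ B] AE_I2) auto
qed

lemma L2_Ioo_integrable:
  assumes "g \<in> L2 (lebesgue_on {0<..<T::real})"
  shows "integrable (lebesgue_on {0<..<T}) g"
proof -
  interpret finite_measure "lebesgue_on {0<..<T}" by (rule finite_measure_Ioo)
  have "(\<lambda>x. 1) \<in> L2 (lebesgue_on {0<..<T})" by (simp add: L2_def)
  from L2_mult_integrable[OF assms this] show ?thesis by simp
qed

lemma test_function_compact_support:
  assumes "smooth \<phi>" and zero: "\<And>x. x \<notin> {c..d} \<Longrightarrow> \<phi> x = 0" and "{c..d} \<subseteq> U"
  shows "test_function U \<phi>"
proof -
  have "closure {x. \<phi> x \<noteq> 0} \<subseteq> {c..d}" by (intro closure_minimal) (use zero in blast, simp)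
  moreover from this have "compact (closure {x. \<phi> x \<noteq> 0})"
    unfolding compact_eq_bounded_closed by (auto intro: bounded_subset[OF bounded_closed_interval])
  ultimately show ?thesis using assms by (auto simp: test_function_def smooth_def)
qed

section \<open>Shifted mollifiers as test functions, and their limits\<close>

lemma smooth_shift: "smooth h \<Longrightarrow> smooth (\<lambda>x. h (n * (x - u)))"
  using smooth_affine[of h n "- (n * u)"] by (simp add: right_diff_distrib)

context mollifier
begin

lemma R_shift_derivative: "((\<lambda>x. R (n * (x - u))) has_field_derivative n * \<rho> (n * (x - u))) (at x)"
proof -
  have "((\<lambda>x. n * (x - u)) has_field_derivative n) (at x)" by (auto intro!: derivative_eq_intros)
  from DERIV_chain2[OF R' this] show ?thesis by (simp add: mult.commute)
qed

lemma Q_shift_derivative: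
  assumes "n \<noteq> 0"
  shows "((\<lambda>x. Q (n * (x - u)) / n) has_field_derivative R (n * (x - u))) (at x)"
proof -
  have "((\<lambda>x. n * (x - u)) has_field_derivative n) (at x)" by (auto intro!: derivative_eq_intros)
  from DERIV_cdivide[OF DERIV_chain2[OF Q' this], of n] show ?thesis using assms by simp
qed

text \<open>The mollification is one-sided, with limit 0 at \<open>x = u\<close> itself. Differences
  of two such steps therefore converge at every point to the indicator of a half-open
  interval.\<close>

lemma R_shift_tendsto: "(\<lambda>n. R (real n * (x - u))) \<longlonglongrightarrow> (if u < x then 1 else 0)"
proof (cases "u < x")
  case True
  obtain N where N: "1 / (x - u) < real N" using reals_Archimedean2 by blast
  have "R (real n * (x - u)) = 1" if "N \<le> n" for n
  proof (rule R_1)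
    have "1 < real N * (x - u)" using N True by (simp add: pos_divide_less_eq)
    also have "\<dots> \<le> real n * (x - u)" using that True by (intro mult_right_mono) auto
    finally show "1 \<le> real n * (x - u)" by simp
  qed
  then have "eventually (\<lambda>n. R (real n * (x - u)) = 1) sequentially" by (auto simp: eventually_sequentially)
  then show ?thesis using True by (simp add: tendsto_eventually)
next
  case False
  then have "R (real n * (x - u)) = 0" for n by (intro R_0) (simp add: mult_nonneg_nonpos)
  then show ?thesis using False by simp
qed

lemma continuous_on_\<rho>_shift: "continuous_on A (\<lambda>x. n * \<rho> (n * (x - u)))"
proof (rule continuous_on_mult[OF continuous_on_const])
  show "continuous_on A (\<lambda>x. \<rho> (n * (x - u)))"
    by (rule continuous_on_compose2[OF \<rho>_cont]) (auto intro!: continuous_intros)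
qed

text \<open>The rescaled bump has mass 1 on the interval from u to u + 1/n, so the integral averages
  \<open>f\<close> just to the right of \<open>u\<close>.\<close>

lemma delta_sequence:
  assumes u: "0 < u" "u < T" and f: "continuous_on {0..T} f"
  shows "(\<lambda>n. LINT x|lebesgue_on {0<..<T}. f x * (real n * \<rho> (real n * (x - u)))) \<longlonglongrightarrow> f u"
proof (rule LIMSEQ_I)
  fix e :: real assume e: "0 < e"
  have "u \<in> {0..T}" using u by simp
  then obtain d where "0 < d" "\<forall>x\<in>{0..T}. dist x u < d \<longrightarrow> dist (f x) (f u) < e / 2"
    using f e unfolding continuous_on_iff by (meson half_gt_zero)
  then have d: "0 < d" "\<And>x. x \<in> {0..T} \<Longrightarrow> \<bar>x - u\<bar> < d \<Longrightarrow> \<bar>f x - f u\<bar> < e / 2"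
    by (auto simp: dist_real_def)
  \<comment> \<open>The bound d controls the oscillation of \<open>f\<close>; the bound T - u keeps
    the support of the bump inside the domain, so that no mass is lost.\<close>
  define \<delta> where "\<delta> = min d (T - u)"
  have \<delta>: "0 < \<delta>" using d u by (simp add: \<delta>_def)
  obtain N where N: "1 / \<delta> < real N" using reals_Archimedean2 by blast
  show "\<exists>N. \<forall>n\<ge>N. norm ((LINT x|lebesgue_on {0<..<T}. f x * (real n * \<rho> (real n * (x - u)))) - f u) < e"
  proof (intro exI[of _ N] allI impI)
    fix n assume "N \<le> n"
    then have n: "1 / \<delta> < real n" using N by simp
    have "0 < 1 / \<delta>" using \<delta> by simp
    then have npos: "0 < real n" using n by (rule less_trans)
    have small: "1 / real n < \<delta>" using n \<delta> npos by (simp add: pos_divide_less_eq mult.commute)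
    define h where "h x = real n * \<rho> (real n * (x - u))" for x
    have hcont: "continuous_on S h" for S
      unfolding h_def by (rule continuous_on_\<rho>_shift)
    have h0: "0 \<le> h x" for x using \<rho>_nonneg by (simp add: h_def)
    have hz: "h x = 0" if "x \<notin> {u..u + 1 / real n}" for x
    proof -
      have "real n * (x - u) \<le> 0 \<or> 1 \<le> real n * (x - u)"
      proof (cases "x < u")
        case True then show ?thesis using npos by (simp add: mult_nonneg_nonpos)
      next
        case False
        then have "1 / real n \<le> x - u" using that by auto
        then have "real n * (1 / real n) \<le> real n * (x - u)" using npos by (intro mult_left_mono) auto
        then show ?thesis using npos by simp
      qed
      then have "\<rho> (real n * (x - u)) = 0" using \<rho>_0 by blast
      then show ?thesis by (simp only: h_def mult_zero_right)
    qed
    have "(h has_integral R (real n * (u + 1 / real n - u)) - R (real n * (u - u))) {u..u + 1 / real n}"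
    proof (rule fundamental_theorem_of_calculus[of _ _ "\<lambda>x. R (real n * (x - u))"])
      show "((\<lambda>x. R (real n * (x - u))) has_vector_derivative h x) (at x within A)" for x A
        unfolding h_def
        by (rule has_vector_derivative_at_within[OF R_shift_derivative[unfolded has_real_derivative_iff_has_vector_derivative]])
    qed (use npos in simp)
    moreover have "R (real n * (u + 1 / real n - u)) - R (real n * (u - u)) = 1"
    proof -
      have "real n * (u + 1 / real n - u) = 1" "real n * (u - u) = 0" using npos by auto
      then show ?thesis using R_0[of 0] R_1[of 1] by (simp only:)
    qed
    ultimately have "(h has_integral 1) {u..u + 1 / real n}" by (simp only:)
    moreover have "{u..u + 1 / real n} \<subseteq> {0<..<T}"
      unfolding subset_iff atLeastAtMost_iff greaterThanLessThan_iff
      using u(1) small unfolding \<delta>_def by linarith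
    ultimately have h1: "(h has_integral 1) {0<..<T}" using hz by (blast intro: has_integral_on_superset)
    have hi: "integrable (lebesgue_on {0<..<T}) h" by (intro continuous_integrable_Ioo hcont)
    have hint: "(LINT x|lebesgue_on {0<..<T}. h x) = 1"
      using lebesgue_integral_eq_integral[OF hi] h1 by (simp add: integral_unique)
    have fh: "integrable (lebesgue_on {0<..<T}) (\<lambda>x. f x * h x)"
      by (intro continuous_integrable_Ioo continuous_intros f hcont)
    have dh: "integrable (lebesgue_on {0<..<T}) (\<lambda>x. (f x - f u) * h x)"
      by (intro continuous_integrable_Ioo continuous_intros f hcont)
    have "(LINT x|lebesgue_on {0<..<T}. f x * h x) - f u = (LINT x|lebesgue_on {0<..<T}. (f x - f u) * h x)"
      unfolding left_diff_distrib using fh hi hint by (subst Bochner_Integration.integral_diff) auto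
    also have "\<bar>\<dots>\<bar> \<le> (LINT x|lebesgue_on {0<..<T}. \<bar>(f x - f u) * h x\<bar>)"
      using integral_norm_bound[of "lebesgue_on {0<..<T}" "\<lambda>x. (f x - f u) * h x"] by simp
    also have "\<dots> \<le> (LINT x|lebesgue_on {0<..<T}. (e / 2) * h x)"
    proof (intro integral_mono)
      fix x assume x: "x \<in> space (lebesgue_on {0<..<T})"
      show "\<bar>(f x - f u) * h x\<bar> \<le> (e / 2) * h x"
      proof (cases "x \<in> {u..u + 1 / real n}")
        case True
        then have "\<bar>f x - f u\<bar> < e / 2" using small x by (intro d(2)) (auto simp: \<delta>_def)
        then have "\<bar>f x - f u\<bar> * h x \<le> e / 2 * h x" using h0[of x] by (intro mult_right_mono) auto
        then show ?thesis using h0[of x] by (simp only: abs_mult abs_of_nonneg)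
      qed (simp add: hz)
    qed (use dh hi in auto)
    also have "\<dots> = e / 2" using hint by simp
    finally show "norm ((LINT x|lebesgue_on {0<..<T}. f x * (real n * \<rho> (real n * (x - u)))) - f u) < e"
      using e by (simp add: h_def)
  qed
qed

lemma delta_integrable:
  assumes f: "continuous_on {0..T} f"
  shows "integrable (lebesgue_on {0<..<T}) (\<lambda>x. f x * (n * \<rho> (n * (x - u))))"
  by (intro continuous_integrable_Ioo continuous_on_mult[OF f] continuous_on_\<rho>_shift)

lemma eventually_inverse_lt:
  assumes "v < T"
  shows "eventually (\<lambda>n. 0 < real n \<and> v + 1 / real n < T) sequentially"
proof -
  have "(\<lambda>n. v + 1 / real n) \<longlonglongrightarrow> v + 0" by (intro tendsto_intros lim_1_over_n)
  then have "eventually (\<lambda>n. v + 1 / real n < T) sequentially" using assms by (intro order_tendstoD) auto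
  then show ?thesis using eventually_gt_at_top[of 0] by eventually_elim simp
qed

lemma shift_args:
  assumes "0 < (n::real)" "v + 1 / n \<le> x" "u \<le> v"
  shows "1 \<le> n * (x - u)"
proof -
  have "n * (1 / n) \<le> n * (x - u)" using assms by (intro mult_left_mono) auto
  then show ?thesis using assms by simp
qed

text \<open>Testing with a smoothed indicator of the interval from \<open>u\<close> to
  \<open>v\<close>: its derivative is a difference of two bumps, which yields f u - f v in the
  limit, while dominated convergence handles the side of \<open>g\<close>. Pointwise values of
  \<open>f\<close> are legitimate because \<open>f\<close> is continuous.\<close>

lemma weak_deriv_increment:
  assumes f: "continuous_on {0..T} f" and g: "g \<in> L2 (lebesgue_on {0<..<T})"
    and fg: "weak_deriv {0<..<T} 1 f g" and uv: "0 < u" "u < v" "v < T"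
  shows "f v - f u = (LINT x|lebesgue_on {0<..<T}. indicator {u<..v} x * g x)"
proof -
  let ?M = "lebesgue_on {0<..<T}"
  have gM: "g \<in> borel_measurable ?M" using g by (rule L2_measurable)
  define \<phi> where "\<phi> n x = R (n * (x - u)) - R (n * (x - v))" for n x :: real
  have \<phi>': "(\<phi> n has_field_derivative n * \<rho> (n * (x - u)) - n * \<rho> (n * (x - v))) (at x)" for n x
    unfolding \<phi>_def by (intro DERIV_diff R_shift_derivative)
  have smooth_\<phi>: "smooth (\<phi> n)" for n
    using smooth_linear_combination[OF smooth_shift[OF smooth_R, of n u] smooth_shift[OF smooth_R, of n v], of 1 "-1"]
    unfolding \<phi>_def by simp
  have \<phi>M: "\<phi> n \<in> borel_measurable ?M" for n
    by (intro continuous_imp_measurable_on_sets_lebesgue continuous_on_of_derivative[OF \<phi>']) simp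
  have eq: "eventually (\<lambda>n. (LINT x|?M. f x * (real n * \<rho> (real n * (x - u)))) -
      (LINT x|?M. f x * (real n * \<rho> (real n * (x - v)))) = - (LINT x|?M. g x * \<phi> (real n) x)) sequentially"
    using eventually_inverse_lt[OF uv(3)]
  proof eventually_elim
    fix n assume n: "0 < real n \<and> v + 1 / real n < T"
    have "test_function {0<..<T} (\<phi> (real n))"
    proof (rule test_function_compact_support[OF smooth_\<phi>, of u "v + 1 / real n"])
      fix x assume x: "x \<notin> {u..v + 1 / real n}"
      show "\<phi> (real n) x = 0"
      proof (cases "x < u")
        case True
        then show ?thesis using uv n by (simp add: \<phi>_def R_0 mult_nonneg_nonpos)
      next
        case False
        then have "v + 1 / real n \<le> x" using x by auto
        then show ?thesis using shift_args[of "real n" v x u] shift_args[of "real n" v x v] n uv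
          by (simp add: \<phi>_def R_1)
      qed
    qed (use uv n in auto)
    then have "(LINT x|?M. f x * deriv (\<phi> (real n)) x) = - (LINT x|?M. g x * \<phi> (real n) x)"
      using fg unfolding weak_deriv_def by simp
    moreover have "deriv (\<phi> (real n)) x = real n * \<rho> (real n * (x - u)) - real n * \<rho> (real n * (x - v))" for x
      by (rule DERIV_imp_deriv[OF \<phi>'])
    ultimately show "(LINT x|?M. f x * (real n * \<rho> (real n * (x - u)))) -
      (LINT x|?M. f x * (real n * \<rho> (real n * (x - v)))) = - (LINT x|?M. g x * \<phi> (real n) x)"
      using delta_integrable[OF f] by (simp add: right_diff_distrib)
  qed
  have lim1: "(\<lambda>n. (LINT x|?M. f x * (real n * \<rho> (real n * (x - u)))) -
      (LINT x|?M. f x * (real n * \<rho> (real n * (x - v))))) \<longlonglongrightarrow> f u - f v"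
    using uv by (intro tendsto_diff delta_sequence f) auto
  have "(\<lambda>n. LINT x|?M. g x * \<phi> (real n) x) \<longlonglongrightarrow> (LINT x|?M. g x * indicator {u<..v} x)"
  proof (rule integral_dominated_convergence[where w = "\<lambda>x. \<bar>g x\<bar>"])
    show "integrable ?M (\<lambda>x. \<bar>g x\<bar>)" using L2_Ioo_integrable[OF g] by simp
    show "AE x in ?M. (\<lambda>n. g x * \<phi> (real n) x) \<longlonglongrightarrow> g x * indicator {u<..v} x"
    proof (intro AE_I2 tendsto_mult tendsto_const)
      fix x
      have "(\<lambda>n. \<phi> (real n) x) \<longlonglongrightarrow> (if u < x then 1 else 0) - (if v < x then 1 else 0)"
        unfolding \<phi>_def by (intro tendsto_diff R_shift_tendsto)
      also have "(if u < x then 1 else 0) - (if v < x then 1 else 0) = (indicator {u<..v} x :: real)"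
        using uv by (auto simp: indicator_def)
      finally show "(\<lambda>n. \<phi> (real n) x) \<longlonglongrightarrow> indicator {u<..v} x" .
    qed
    show "AE x in ?M. norm (g x * \<phi> (real n) x) \<le> \<bar>g x\<bar>" for n
    proof (intro AE_I2)
      fix x
      have "\<bar>\<phi> (real n) x\<bar> \<le> 1"
        using R_bounds[of "real n * (x - u)"] R_bounds[of "real n * (x - v)"] unfolding \<phi>_def by linarith
      then show "norm (g x * \<phi> (real n) x) \<le> \<bar>g x\<bar>" by (simp add: abs_mult mult_left_le)
    qed
    show "(\<lambda>x. g x * \<phi> (real n) x) \<in> borel_measurable ?M" for n by (intro borel_measurable_times gM \<phi>M)
    show "(\<lambda>x. g x * indicator {u<..v} x) \<in> borel_measurable ?M"
      using uv by (intro borel_measurable_times gM borel_measurable_indicator) (auto simp: sets_restrict_space_iff)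
  qed
  then have "(\<lambda>n. - (LINT x|?M. g x * \<phi> (real n) x)) \<longlonglongrightarrow> - (LINT x|?M. g x * indicator {u<..v} x)"
    by (rule tendsto_minus)
  with lim1 have "f u - f v = - (LINT x|?M. g x * indicator {u<..v} x)"
    by (rule LIMSEQ_unique[OF Lim_transform_eventually[OF _ eq]])
  then show ?thesis by (simp add: mult.commute)
qed

text \<open>The test function approximates the tent on \<open>[u,v]\<close> with peak \<open>1\<close> at \<open>m\<close>.\<close>

lemma weak_deriv_2_slopes:
  assumes f: "continuous_on {0..T} f" and g: "g \<in> L2 (lebesgue_on {0<..<T})"
    and fg: "weak_deriv {0<..<T} 2 f g" and uv: "0 < u" "u < m" "m < v" "v < T"
  shows "\<bar>slope f m v - slope f u m\<bar> \<le> (1 + (LINT x|lebesgue_on {0<..<T}. (g x)\<^sup>2)) / 2 * (v - u) powr (1/2)"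
proof -
  let ?M = "lebesgue_on {0<..<T}"
  interpret M: finite_measure ?M by (rule finite_measure_Ioo)
  have [measurable]: "g \<in> borel_measurable ?M" using g by (rule L2_measurable)
  \<comment> \<open>The weight in Young's inequality |g| \<le> l g^2 / 2 + 1/(2l). The square root
    of v - u makes both terms proportional to \<open>l\<close> once the second is integrated over an
    interval of length v - u = l^2.\<close>
  define l where "l = (v - u) powr (1/2)"
  have l: "0 < l" using uv by (simp add: l_def)
  define S where "S = (LINT x|?M. (g x)\<^sup>2)"
  \<comment> \<open>The difference of the two adjacent slopes, as a linear combination of the values
    at u, m, v. The same combination of shifted copies of \<open>Q\<close> is the test function, and
    its second derivative is that combination of bumps, so that in the limit \<open>bend f\<close>
    appears.\<close>
  define bend where "bend h = (h u - h m) / (m - u) - (h m - h v) / (v - m)" for h :: "real \<Rightarrow> real"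
  define comb where "comb h x = bend (\<lambda>w. h w x)" for h :: "real \<Rightarrow> real \<Rightarrow> real" and x
  define q where "q n w x = Q (n * (x - w)) / n" for n w x :: real
  define q' where "q' n w x = R (n * (x - w))" for n w x :: real
  define q'' where "q'' n w x = n * \<rho> (n * (x - w))" for n w x :: real
  define \<phi> where "\<phi> n = comb (q n)" for n
  have d1: "(\<phi> n has_field_derivative comb (q' n) x) (at x)" if "n \<noteq> 0" for n x
    unfolding \<phi>_def comb_def bend_def q_def q'_def
    by (intro DERIV_diff DERIV_cdivide Q_shift_derivative that)
  have d2: "(comb (q' n) has_field_derivative comb (q'' n) x) (at x)" for n x
    unfolding comb_def bend_def q'_def q''_def by (intro DERIV_diff DERIV_cdivide R_shift_derivative)
  have smooth_comb: "smooth (comb (q' n))" for n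
  proof -
    have *: "smooth (\<lambda>x. (q' n a x - q' n b x) / c)" for a b c
      using smooth_linear_combination[OF smooth_shift[OF smooth_R, of n a] smooth_shift[OF smooth_R, of n b], of "1/c" "-(1/c)"]
      by (simp add: q'_def diff_divide_distrib)
    show ?thesis
      using smooth_linear_combination[OF *[of u m "m - u"] *[of m v "v - m"], of 1 "-1"]
      unfolding comb_def bend_def mult_1 mult_minus1 add_uminus_conv_diff .
  qed
  have smooth_\<phi>: "smooth (\<phi> n)" if "n \<noteq> 0" for n
    by (rule smooth_antiderivative[OF d1[OF that] smooth_comb])
  have \<phi>_abs: "\<bar>\<phi> n x\<bar> \<le> 1" if "0 < n" for n x
  proof -
    have *: "0 \<le> (q n a x - q n b x) / (b - a)" "(q n a x - q n b x) / (b - a) \<le> 1" if ab: "a < b" for a b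
    proof -
      have ord: "n * (x - b) \<le> n * (x - a)" using ab \<open>0 < n\<close> by (intro mult_left_mono) auto
      have "0 \<le> Q (n * (x - a)) - Q (n * (x - b))"
        "Q (n * (x - a)) - Q (n * (x - b)) \<le> n * (b - a)"
        using Q_increment[OF ord] by (auto simp: algebra_simps)
      then show "0 \<le> (q n a x - q n b x) / (b - a)" "(q n a x - q n b x) / (b - a) \<le> 1"
        using ab \<open>0 < n\<close> by (auto simp: q_def diff_divide_distrib[symmetric] pos_divide_le_eq mult_ac)
    qed
    show ?thesis using *[of u m] *[of m v] uv unfolding \<phi>_def comb_def bend_def by linarith
  qed
  have bound: "eventually (\<lambda>n. \<bar>bend (\<lambda>w. LINT x|?M. f x * q'' (real n) w x)\<bar> \<le>
      l / 2 * S + 1 / (2 * l) * (v - u + 1 / real n)) sequentially"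
    using eventually_inverse_lt[OF uv(4)]
  proof eventually_elim
    fix n assume n: "0 < real n \<and> v + 1 / real n < T"
    define J where "J = {u..v + 1 / real n}"
    have J: "J \<subseteq> {0<..<T}" using uv n by (auto simp: J_def)
    have \<phi>0: "\<phi> (real n) x = 0" if x: "x \<notin> J" for x
    proof (cases "x < u")
      case True
      then show ?thesis using uv n by (simp add: \<phi>_def comb_def bend_def q_def Q_0 mult_nonneg_nonpos)
    next
      case False
      then have "v + 1 / real n \<le> x" using x by (auto simp: J_def)
      then have ge1: "1 \<le> real n * (x - u)" "1 \<le> real n * (x - m)" "1 \<le> real n * (x - v)"
        using n uv by (auto intro!: shift_args[of "real n" v x])
      \<comment> \<open>To the right of all transition zones \<open>Q\<close> has slope 1, so both
        difference quotients equal 1 and cancel; this gives the test function compact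
        support.\<close>
      have "q n a x - q n b x = b - a" if "1 \<le> real n * (x - a)" "1 \<le> real n * (x - b)" for a b
      proof -
        have "q n a x - q n b x = (real n * (x - a) - real n * (x - b)) / real n"
          unfolding q_def diff_divide_distrib[symmetric] Q_linear[OF that(2,1)] ..
        also have "\<dots> = b - a" using n by (simp add: field_simps)
        finally show ?thesis .
      qed
      from this[OF ge1(1,2)] this[OF ge1(2,3)] show ?thesis
        using uv by (simp add: \<phi>_def comb_def bend_def)
    qed
    have test: "test_function {0<..<T} (\<phi> (real n))"
      by (rule test_function_compact_support[OF smooth_\<phi>, of _ u "v + 1 / real n"])
         (use \<phi>0 J n in \<open>auto simp: J_def\<close>)
    have "deriv (\<phi> (real n)) = comb (q' (real n))"
      using d1[of "real n"] n by (auto intro!: DERIV_imp_deriv)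
    moreover have "deriv (comb (q' (real n))) = comb (q'' (real n))"
      using d2[of "real n"] by (auto intro!: DERIV_imp_deriv)
    ultimately have "(deriv ^^ 2) (\<phi> (real n)) = comb (q'' (real n))" by (simp add: numeral_2_eq_2)
    then have eq: "(LINT x|?M. f x * comb (q'' (real n)) x) = (LINT x|?M. g x * \<phi> (real n) x)"
    proof -
      assume d2: "(deriv ^^ 2) (\<phi> (real n)) = comb (q'' (real n))"
      have "(LINT x|?M. f x * (deriv ^^ 2) (\<phi> (real n)) x) = (-1) ^ 2 * (LINT x|?M. g x * \<phi> (real n) x)"
        using fg test unfolding weak_deriv_def by blast
      then show ?thesis unfolding d2 by simp
    qed
    have i: "integrable ?M (\<lambda>x. f x * q'' (real n) w x)" for w
      unfolding q''_def by (rule delta_integrable[OF f])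
    have "(LINT x|?M. f x * comb (q'' (real n)) x) = (LINT x|?M. (f x * q'' (real n) u x - f x * q'' (real n) m x) / (m - u) -
        (f x * q'' (real n) m x - f x * q'' (real n) v x) / (v - m))"
      by (simp add: comb_def bend_def right_diff_distrib)
    also have "\<dots> = bend (\<lambda>w. LINT x|?M. f x * q'' (real n) w x)"
      unfolding comb_def bend_def by (simp add: i)
    finally have "\<bar>bend (\<lambda>w. LINT x|?M. f x * q'' (real n) w x)\<bar> = \<bar>LINT x|?M. g x * \<phi> (real n) x\<bar>"
      using eq by simp
    also have "\<dots> \<le> (LINT x|?M. \<bar>g x * \<phi> (real n) x\<bar>)"
      using integral_norm_bound[of ?M "\<lambda>x. g x * \<phi> (real n) x"] by simp
    also have "\<dots> \<le> (LINT x|?M. l / 2 * (g x)\<^sup>2 + 1 / (2 * l) * indicator J x)"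
    proof (intro integral_mono_AE' AE_I2)
      have [measurable]: "J \<in> sets ?M" using J by (simp add: J_def sets_restrict_space_iff)
      show "integrable ?M (\<lambda>x. l / 2 * (g x)\<^sup>2 + 1 / (2 * l) * indicator J x)"
        using L2_square[OF g] M.emeasure_finite[of J]
        by (intro Bochner_Integration.integrable_add integrable_mult_right integrable_real_indicator)
           (auto simp: less_top[symmetric])
      fix x
      show "\<bar>g x * \<phi> (real n) x\<bar> \<le> l / 2 * (g x)\<^sup>2 + 1 / (2 * l) * indicator J x"
      proof (cases "x \<in> J")
        case True
        have "\<bar>g x * \<phi> (real n) x\<bar> \<le> \<bar>g x\<bar>"
          using \<phi>_abs[of "real n" x] n by (simp add: abs_mult mult_left_le)
        moreover have "0 \<le> (l * \<bar>g x\<bar> - 1)\<^sup>2 / (2 * l)" using l by simp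
        then have "\<bar>g x\<bar> \<le> l / 2 * (g x)\<^sup>2 + 1 / (2 * l)"
          using l by (simp add: power2_diff power_mult_distrib field_simps power2_eq_square)
        ultimately show ?thesis using True by simp
      qed (use l in \<open>simp add: \<phi>0\<close>)
    qed (use l in \<open>auto intro!: add_nonneg_nonneg mult_nonneg_nonneg divide_nonneg_nonneg\<close>)
    also have "\<dots> = l / 2 * S + 1 / (2 * l) * measure ?M J"
    proof -
      have [measurable]: "J \<in> sets ?M" using J by (simp add: J_def sets_restrict_space_iff)
      have "integrable ?M (indicator J :: real \<Rightarrow> real)"
        using M.emeasure_finite[of J] by (intro integrable_real_indicator) (auto simp: less_top[symmetric])
      then show ?thesis using L2_square[OF g] J by (simp add: S_def Int_absorb2)
    qed
    also have "measure ?M J = v - u + 1 / real n"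
    proof -
      have "0 \<le> 1 / real n" by simp
      then have "u \<le> v + 1 / real n" using uv by linarith
      then show ?thesis using J uv n by (simp add: measure_restrict_space J_def)
    qed
    finally show "\<bar>bend (\<lambda>w. LINT x|?M. f x * q'' (real n) w x)\<bar> \<le>
      l / 2 * S + 1 / (2 * l) * (v - u + 1 / real n)" .
  qed
  have "(\<lambda>n. bend (\<lambda>w. LINT x|?M. f x * q'' (real n) w x)) \<longlonglongrightarrow> bend f"
    unfolding comb_def bend_def q''_def using uv by (intro tendsto_intros delta_sequence f) auto
  then have l1: "(\<lambda>n. \<bar>bend (\<lambda>w. LINT x|?M. f x * q'' (real n) w x)\<bar>) \<longlonglongrightarrow> \<bar>bend f\<bar>"
    by (rule tendsto_rabs)
  have l2: "(\<lambda>n. l / 2 * S + 1 / (2 * l) * (v - u + 1 / real n)) \<longlonglongrightarrow>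
      l / 2 * S + 1 / (2 * l) * (v - u + 0)"
    by (intro tendsto_intros lim_1_over_n)
  have "\<bar>bend f\<bar> \<le> l / 2 * S + 1 / (2 * l) * (v - u + 0)"
    by (rule tendsto_le[OF sequentially_bot l2 l1 bound])
  also have "bend f = slope f m v - slope f u m"
  proof -
    have "(f u - f m) / (m - u) = - ((f m - f u) / (m - u))" "(f m - f v) / (v - m) = - ((f v - f m) / (v - m))"
      by (simp_all add: minus_divide_left)
    then show ?thesis by (simp add: comb_def bend_def slope_def)
  qed
  also have "l / 2 * S + 1 / (2 * l) * (v - u + 0) = (1 + S) / 2 * l"
  proof -
    have "v - u = l * l" using uv by (simp add: l_def powr_add[symmetric])
    then show ?thesis using l by (simp add: field_simps)
  qed
  finally show ?thesis by (simp add: S_def l_def)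
qed

end

text \<open>With r = v - u, the product r (d - c) times the difference of the slopes is the double
  integral of g x - g y over \<open>x\<close> in the inner and \<open>y\<close> in the outer
  interval. Young's inequality bounds it by the Slobodeckij integrand plus a power of
  \<open>r\<close>. The exponent \<theta> - 1/2 is positive exactly when \<theta> + 1 > 3/2.\<close>

lemma slobodeckij_slopes:
  assumes g: "g \<in> L2 (lebesgue_on {0<..<T})"
    and incr: "\<And>u v. 0 < u \<Longrightarrow> u < v \<Longrightarrow> v < T \<Longrightarrow>
      f v - f u = (LINT x|lebesgue_on {0<..<T}. indicator {u<..v} x * g x)"
    and S: "(\<integral>\<^sup>+x. (\<integral>\<^sup>+y. ennreal ((g x - g y)\<^sup>2 / \<bar>x - y\<bar> powr (1 + 2 * \<theta>))
        \<partial>lebesgue_on {0<..<T}) \<partial>lebesgue_on {0<..<T}) = ennreal S" and S0: "0 \<le> S" and \<theta>: "0 < \<theta>"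
    and uv: "0 < u" "u \<le> c" "c < d" "d \<le> v" "v < T" "v - u \<le> 2 * (d - c)"
  shows "\<bar>slope f c d - slope f u v\<bar> \<le> (S + 1 / 2) * (v - u) powr (\<theta> - 1 / 2)"
proof -
  let ?M = "lebesgue_on {0<..<T}"
  interpret M: finite_measure ?M by (rule finite_measure_Ioo)
  have gM[measurable]: "g \<in> borel_measurable ?M" using g by (rule L2_measurable)
  have idM[measurable]: "(\<lambda>x. x) \<in> borel_measurable ?M" using id_borel_measurable_lebesgue_on by (simp add: id_def)
  have gi: "integrable ?M g" by (rule L2_Ioo_integrable[OF g])
  define r where "r = v - u"
  have r: "0 < r" using uv by (simp add: r_def)
  define J where "J = {u<..v}"
  define J' where "J' = {c<..d}"
  have JM[measurable]: "J \<in> sets ?M" "J' \<in> sets ?M" and JJ: "J \<subseteq> {0<..<T}" "J' \<subseteq> J"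
    using uv by (auto simp: J_def J'_def sets_restrict_space_iff)
  have iJ: "integrable ?M (indicator J :: real \<Rightarrow> real)" "integrable ?M (indicator J' :: real \<Rightarrow> real)"
    using M.emeasure_finite[of J] M.emeasure_finite[of J']
    by (auto intro!: integrable_real_indicator simp: less_top[symmetric])
  have igJ: "integrable ?M (\<lambda>x. indicator J x * g x)" "integrable ?M (\<lambda>x. indicator J' x * g x)"
    using gi by (auto intro!: integrable_real_mult_indicator simp: mult.commute)
  have mJ: "measure ?M J = r" "measure ?M J' = d - c"
    using uv JJ by (auto simp: measure_restrict_space Int_absorb2 J_def J'_def r_def)
  have eJ: "emeasure ?M J = ennreal r" "emeasure ?M J' = ennreal (d - c)"
    using mJ by (simp_all add: M.emeasure_eq_measure)
  have spJ: "LINT x|?M. indicator J x = r" "LINT x|?M. indicator J' x = d - c"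
    using mJ JJ by (auto simp: Int_absorb2 subset_trans[OF JJ(2,1)])
  \<comment> \<open>The Young weight that balances the two contributions: l / r^2 and W / l, with W
    = r^(1 + 2\<theta>), both equal r^(\<theta> - 1/2).\<close>
  define l where "l = r powr (\<theta> + 3/2)"
  have l: "0 < l" using r by (simp add: l_def)
  define q where "q x y = (g x - g y)\<^sup>2 / \<bar>x - y\<bar> powr (1 + 2 * \<theta>)" for x y
  have q0: "0 \<le> q x y" for x y by (simp add: q_def)
  have qM[measurable]: "(\<lambda>(x, y). q x y) \<in> borel_measurable (?M \<Otimes>\<^sub>M ?M)" unfolding q_def by measurable
  define W where "W = r powr (1 + 2 * \<theta>)"
  have W: "0 < W" using r by (simp add: W_def)
  \<comment> \<open>Young's inequality with the singular weight |x - y|^(1 + 2\<theta>), which is at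
    most \<open>W\<close> since both points lie in an interval of length \<open>r\<close>. On the
    diagonal the left-hand side vanishes.\<close>
  have pw: "indicator J' x * (indicator J y * \<bar>g x - g y\<bar>) \<le> l / 2 * q x y + W / (2 * l) * (indicator J' x * indicator J y)"
    for x y :: real
  proof (cases "x \<in> J' \<and> y \<in> J \<and> x \<noteq> y")
    case True
    define w where "w = \<bar>x - y\<bar> powr (1 + 2 * \<theta>)"
    have w: "0 < w" using True by (simp add: w_def)
    have "\<bar>x - y\<bar> \<le> r" using True JJ uv by (auto simp: J_def J'_def r_def)
    then have wW: "w \<le> W" unfolding w_def W_def using \<theta> by (intro powr_mono2) auto
    have "0 \<le> (l * \<bar>g x - g y\<bar> - w)\<^sup>2 / (2 * l * w)" using l w by simp
    then have "\<bar>g x - g y\<bar> \<le> l / 2 * ((g x - g y)\<^sup>2 / w) + w / (2 * l)"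
    proof -
      have "(l * \<bar>g x - g y\<bar> - w)\<^sup>2 = l\<^sup>2 * (g x - g y)\<^sup>2 - 2 * (l * w * \<bar>g x - g y\<bar>) + w\<^sup>2"
        by (simp add: power2_diff power_mult_distrib mult_ac)
      then have "(l * \<bar>g x - g y\<bar> - w)\<^sup>2 / (2 * l * w) = l / 2 * ((g x - g y)\<^sup>2 / w) + w / (2 * l) - \<bar>g x - g y\<bar>"
        using l w by (simp add: power2_eq_square add_divide_distrib diff_divide_distrib)
      then show ?thesis using \<open>0 \<le> (l * \<bar>g x - g y\<bar> - w)\<^sup>2 / (2 * l * w)\<close> by linarith
    qed
    also have "w / (2 * l) \<le> W / (2 * l)" using wW l by (intro divide_right_mono) auto
    finally show ?thesis using True by (simp add: q_def w_def)
  next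
    case False
    have "0 \<le> l / 2 * q x y" "0 \<le> W / (2 * l) * (indicator J' x * indicator J y)"
      using l W q0 by (auto intro!: mult_nonneg_nonneg)
    then have "0 \<le> l / 2 * q x y + W / (2 * l) * (indicator J' x * indicator J y)" by linarith
    moreover have "indicator J' x * (indicator J y * \<bar>g x - g y\<bar>) = 0" using False by (auto simp: indicator_def)
    ultimately show ?thesis by (simp only:)
  qed
  have G: "(LINT y|?M. indicator J y * (g x - g y)) = r * g x - (f v - f u)" for x
    using iJ igJ spJ uv incr[of u v] by (simp add: right_diff_distrib J_def)
  have "(LINT x|?M. indicator J' x * (LINT y|?M. indicator J y * (g x - g y))) = r * (f d - f c) - (d - c) * (f v - f u)"
  proof -
    have "(LINT x|?M. indicator J' x * (LINT y|?M. indicator J y * (g x - g y))) =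
        (LINT x|?M. r * (indicator J' x * g x) - (f v - f u) * indicator J' x)"
      unfolding G by (simp add: algebra_simps)
    also have "\<dots> = r * (LINT x|?M. indicator J' x * g x) - (f v - f u) * (LINT x|?M. indicator J' x)"
      using iJ igJ by (subst Bochner_Integration.integral_diff) auto
    finally show ?thesis using spJ incr[of c d] uv by (simp add: J'_def mult.commute)
  qed
  also have "r * (f d - f c) - (d - c) * (f v - f u) = r * (d - c) * (slope f c d - slope f u v)"
  proof -
    have "f d - f c = (d - c) * slope f c d" "f v - f u = r * slope f u v"
      using uv r by (simp_all add: slope_def r_def)
    then show ?thesis by algebra
  qed
  finally have main: "\<bar>r * (d - c) * (slope f c d - slope f u v)\<bar> =
      \<bar>LINT x|?M. indicator J' x * (LINT y|?M. indicator J y * (g x - g y))\<bar>" by simp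
  have "ennreal \<bar>r * (d - c) * (slope f c d - slope f u v)\<bar>
      \<le> (\<integral>\<^sup>+x. ennreal \<bar>indicator J' x * (LINT y|?M. indicator J y * (g x - g y))\<bar> \<partial>?M)"
    unfolding main by (rule norm_integral_le_nn_integral)
  also have "\<dots> \<le> (\<integral>\<^sup>+x. (\<integral>\<^sup>+y. ennreal (indicator J' x * (indicator J y * \<bar>g x - g y\<bar>)) \<partial>?M) \<partial>?M)"
  proof (intro nn_integral_mono)
    fix x
    have "\<bar>indicator J' x * (LINT y|?M. indicator J y * (g x - g y))\<bar> =
        \<bar>LINT y|?M. indicator J' x * (indicator J y * (g x - g y))\<bar>" by simp
    also have "ennreal \<dots> \<le> (\<integral>\<^sup>+y. ennreal \<bar>indicator J' x * (indicator J y * (g x - g y))\<bar> \<partial>?M)"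
      by (rule norm_integral_le_nn_integral)
    finally show "ennreal \<bar>indicator J' x * (LINT y|?M. indicator J y * (g x - g y))\<bar>
      \<le> (\<integral>\<^sup>+y. ennreal (indicator J' x * (indicator J y * \<bar>g x - g y\<bar>)) \<partial>?M)"
      by (simp add: abs_mult)
  qed
  also have "\<dots> \<le> (\<integral>\<^sup>+x. (\<integral>\<^sup>+y. ennreal (l / 2) * ennreal (q x y) +
      ennreal (W / (2 * l)) * (indicator J' x * indicator J y) \<partial>?M) \<partial>?M)"
  proof (intro nn_integral_mono)
    fix x y
    have "ennreal (indicator J' x * (indicator J y * \<bar>g x - g y\<bar>))
        \<le> ennreal (l / 2 * q x y + W / (2 * l) * (indicator J' x * indicator J y))"
      by (rule ennreal_leI[OF pw])
    also have "\<dots> = ennreal (l / 2) * ennreal (q x y) + ennreal (W / (2 * l)) * (indicator J' x * indicator J y)"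
    proof -
      have "ennreal (l / 2 * q x y) = ennreal (l / 2) * ennreal (q x y)"
        using l q0[of x y] by (intro ennreal_mult) auto
      moreover have "ennreal (W / (2 * l) * (indicator J' x * indicator J y)) = ennreal (W / (2 * l)) * (indicator J' x * indicator J y)"
        by (auto simp: indicator_def)
      moreover have "0 \<le> l / 2 * q x y" "0 \<le> W / (2 * l) * (indicator J' x * indicator J y)"
        using l W q0[of x y] by (auto intro!: mult_nonneg_nonneg)
      ultimately show ?thesis by (simp only: ennreal_plus)
    qed
    finally show "ennreal (indicator J' x * (indicator J y * \<bar>g x - g y\<bar>)) \<le>
      ennreal (l / 2) * ennreal (q x y) + ennreal (W / (2 * l)) * (indicator J' x * indicator J y)" .
  qed
  also have "\<dots> = (\<integral>\<^sup>+x. ennreal (l / 2) * (\<integral>\<^sup>+y. ennreal (q x y) \<partial>?M) +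
      ennreal (W / (2 * l) * r) * indicator J' x \<partial>?M)"
  proof (intro nn_integral_cong)
    fix x assume [measurable]: "x \<in> space ?M"
    have "(\<integral>\<^sup>+y. ennreal (W / (2 * l)) * (indicator J' x * indicator J y) \<partial>?M) = ennreal (W / (2 * l) * r) * indicator J' x"
    proof -
      have "(\<integral>\<^sup>+y. ennreal (W / (2 * l)) * (indicator J' x * indicator J y) \<partial>?M) =
          (\<integral>\<^sup>+y. (ennreal (W / (2 * l)) * indicator J' x) * indicator J y \<partial>?M)" by (simp only: mult.assoc)
      also have "\<dots> = (ennreal (W / (2 * l)) * indicator J' x) * ennreal r"
        using eJ by (simp only: nn_integral_cmult_indicator[OF JM(1)])
      also have "\<dots> = (ennreal (W / (2 * l)) * ennreal r) * indicator J' x" by (simp only: mult_ac)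
      also have "ennreal (W / (2 * l)) * ennreal r = ennreal (W / (2 * l) * r)"
        using l W r by (intro ennreal_mult[symmetric]) auto
      finally show ?thesis .
    qed
    then show "(\<integral>\<^sup>+y. ennreal (l / 2) * ennreal (q x y) + ennreal (W / (2 * l)) * (indicator J' x * indicator J y) \<partial>?M) =
      ennreal (l / 2) * (\<integral>\<^sup>+y. ennreal (q x y) \<partial>?M) + ennreal (W / (2 * l) * r) * indicator J' x"
      by (simp add: nn_integral_add nn_integral_cmult)
  qed
  also have "\<dots> = ennreal (l / 2) * ennreal S + ennreal (W / (2 * l) * r) * ennreal (d - c)"
    using S unfolding q_def[symmetric] by (simp add: nn_integral_add nn_integral_cmult eJ)
  also have "\<dots> = ennreal (l / 2 * S + W / (2 * l) * r * (d - c))"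
  proof -
    have n: "0 \<le> l / 2" "0 \<le> W / (2 * l) * r" "0 \<le> d - c" using l W r uv by auto
    show ?thesis
      using n S0 by (simp only: ennreal_mult ennreal_plus mult_nonneg_nonneg)
  qed
  finally have "\<bar>r * (d - c) * (slope f c d - slope f u v)\<bar> \<le> l / 2 * S + W / (2 * l) * r * (d - c)"
    using l W r S0 uv by (subst (asm) ennreal_le_iff) (auto intro!: add_nonneg_nonneg mult_nonneg_nonneg divide_nonneg_nonneg)
  then have "r * (d - c) * \<bar>slope f c d - slope f u v\<bar> \<le> l / 2 * S + W / (2 * l) * r * (d - c)"
    using r uv by (simp add: abs_mult)
  \<comment> \<open>Here the half-length condition enters: d - c is at least r/2, so the common
    factor r (d - c) can be divided out.\<close>
  also have "l / 2 * S \<le> r * (d - c) * (l / r\<^sup>2 * S)"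
  proof -
    have "r / 2 \<le> d - c" using uv by (simp add: r_def)
    then have "r * (r / 2) * (l / r\<^sup>2 * S) \<le> r * (d - c) * (l / r\<^sup>2 * S)"
      using r l S0 by (intro mult_right_mono mult_left_mono) auto
    then show ?thesis using r by (simp add: power2_eq_square)
  qed
  finally have "r * (d - c) * \<bar>slope f c d - slope f u v\<bar> \<le> r * (d - c) * (l / r\<^sup>2 * S + W / (2 * l))"
    by (simp add: algebra_simps)
  then have "\<bar>slope f c d - slope f u v\<bar> \<le> l / r\<^sup>2 * S + W / (2 * l)" using r uv by simp
  also have "l / r\<^sup>2 = r powr (\<theta> - 1/2)"
  proof -
    have "r\<^sup>2 = r powr 2" using r by (simp add: powr_numeral)
    then show ?thesis by (simp add: l_def powr_diff[symmetric])
  qed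
  also have "W / (2 * l) = r powr (\<theta> - 1/2) / 2"
    by (simp add: W_def l_def powr_diff[symmetric])
  finally show ?thesis by (simp add: r_def algebra_simps)
qed

text \<open>Membership in the Sobolev space concerns classes of functions; continuity of
  \<open>f\<close> selects the representative that is to be differentiated. The slopes satisfy a
  Hoelder estimate with exponent s - 3/2 if s < 2, and 1/2 otherwise.\<close>

theorem sobolev_C1:
  assumes T: "0 < T" and s: "3/2 < s" and H: "f \<in> sobolev_H s {0<..<T}" and f: "continuous_on {0..T} f"
  shows "\<exists>D. continuous_on {0..T} D \<and>
    (\<forall>t\<in>{0..T}. (f has_vector_derivative D t) (at t within {0..T}))"
proof -
  obtain \<rho> R Q where "mollifier \<rho> R Q" using mollifier_exists by blast
  then interpret mollifier \<rho> R Q .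
  show ?thesis
  proof (cases "s < 2")
    case True
    have fl: "\<lfloor>s\<rfloor> = 1" using s True by (simp add: floor_eq_iff)
    have "s \<notin> \<int>"
    proof
      assume "s \<in> \<int>"
      then have "real_of_int \<lfloor>s\<rfloor> = s" by (simp add: of_int_floor)
      then show False using s fl by simp
    qed
    then obtain g where g: "g \<in> L2 (lebesgue_on {0<..<T})" "weak_deriv {0<..<T} 1 f g"
      "slobodeckij_finite {0<..<T} (s - 1) g"
      using H fl by (auto simp: sobolev_H_def)
    define S where "S = enn2real (\<integral>\<^sup>+x. (\<integral>\<^sup>+y. ennreal ((g x - g y)\<^sup>2 / \<bar>x - y\<bar> powr (1 + 2 * (s - 1)))
        \<partial>lebesgue_on {0<..<T}) \<partial>lebesgue_on {0<..<T})"
    have S: "(\<integral>\<^sup>+x. (\<integral>\<^sup>+y. ennreal ((g x - g y)\<^sup>2 / \<bar>x - y\<bar> powr (1 + 2 * (s - 1)))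
        \<partial>lebesgue_on {0<..<T}) \<partial>lebesgue_on {0<..<T}) = ennreal S" "0 \<le> S"
      using g(3) unfolding S_def slobodeckij_finite_def by (auto simp: enn2real_nonneg)
    show ?thesis
    proof (rule C1_of_interior_slopes[OF T _ _ f])
      show "0 < s - 1 - 1/2" using s by simp
      show "0 \<le> S + 1/2" using S by simp
      show "\<bar>slope f c d - slope f u v\<bar> \<le> (S + 1/2) * (v - u) powr (s - 1 - 1/2)"
        if "0 < u" "u \<le> c" "c < d" "d \<le> v" "v < T" "v - u \<le> 2 * (d - c)" for u v c d
        using s by (intro slobodeckij_slopes[OF g(1) weak_deriv_increment[OF f g(1,2)] S _ that]) auto
    qed
  next
    case False
    then have "2 \<le> nat \<lfloor>s\<rfloor>" by (simp add: le_nat_iff le_floor_iff)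
    then obtain g where g: "g \<in> L2 (lebesgue_on {0<..<T})" "weak_deriv {0<..<T} 2 f g"
      using H unfolding sobolev_H_def by blast
    define B where "B = (1 + (LINT x|lebesgue_on {0<..<T}. (g x)\<^sup>2)) / 2"
    have B: "0 \<le> B" unfolding B_def by (intro divide_nonneg_pos add_nonneg_nonneg integral_nonneg_AE) auto
    have adj: "\<bar>slope f m v - slope f u m\<bar> \<le> B * (v - u) powr (1/2)" if "0 < u" "u < m" "m < v" "v < T" for u m v
      unfolding B_def using weak_deriv_2_slopes[OF f g that] .
    \<comment> \<open>The slope over [u,v] is the length-weighted mean of the slopes over its two
      pieces, so it is no farther from either of them than they are from each other.\<close>
    have cut: "\<bar>slope f m v - slope f u v\<bar> \<le> B * (v - u) powr (1/2)"
      "\<bar>slope f u m - slope f u v\<bar> \<le> B * (v - u) powr (1/2)" if "0 < u" "u < m" "m < v" "v < T" for u m v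
    proof -
      have split: "(v - u) * slope f u v = (m - u) * slope f u m + (v - m) * slope f m v"
        using that by (intro slope_split)
      have 1: "(v - u) * (slope f m v - slope f u v) = (m - u) * (slope f m v - slope f u m)"
        using split by (simp add: algebra_simps)
      have 2: "(v - u) * (slope f u m - slope f u v) = (v - m) * (slope f u m - slope f m v)"
        using split by (simp add: algebra_simps)
      have *: "\<bar>x\<bar> \<le> \<bar>y\<bar>" if "(v - u) * x = w * y" "0 \<le> w" "w \<le> v - u" for x y w
      proof -
        have "\<bar>v - u\<bar> * \<bar>x\<bar> = \<bar>w\<bar> * \<bar>y\<bar>" unfolding abs_mult[symmetric] that(1) ..
        then have "(v - u) * \<bar>x\<bar> = w * \<bar>y\<bar>" using that(2,3) by simp
        also have "\<dots> \<le> (v - u) * \<bar>y\<bar>" using that by (intro mult_right_mono) auto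
        finally show ?thesis using \<open>u < m\<close> \<open>m < v\<close> by simp
      qed
      show "\<bar>slope f m v - slope f u v\<bar> \<le> B * (v - u) powr (1/2)"
        using *[OF 1] adj[OF that] that by simp
      show "\<bar>slope f u m - slope f u v\<bar> \<le> B * (v - u) powr (1/2)"
        using *[OF 2] adj[OF that] that by (simp add: abs_minus_commute)
    qed
    show ?thesis
    proof (rule C1_of_interior_slopes[OF T _ _ f])
      show "(0::real) < 1/2" by simp
      \<comment> \<open>The factor 2 counts two cuts: [u,v] is first shortened on the left to [c,v]
        and then on the right to [c,d].\<close>
      show "0 \<le> 2 * B" using B by simp
      fix u v c d assume uv: "0 < u" "u \<le> c" "c < d" "d \<le> v" "v < T" "v - u \<le> 2 * (d - c)"
      have nn: "0 \<le> B * (v - u) powr (1/2)" using B by simp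
      have "\<bar>slope f c v - slope f u v\<bar> \<le> B * (v - u) powr (1/2)"
        using cut(1)[of u c v] uv nn by (cases "u = c") auto
      moreover have "\<bar>slope f c d - slope f c v\<bar> \<le> B * (v - u) powr (1/2)"
      proof (cases "d = v")
        case False
        then have "\<bar>slope f c d - slope f c v\<bar> \<le> B * (v - c) powr (1/2)" using cut(2)[of c d v] uv by auto
        also have "\<dots> \<le> B * (v - u) powr (1/2)" using uv B by (intro mult_left_mono powr_mono2) auto
        finally show ?thesis .
      qed (use nn in simp)
      ultimately show "\<bar>slope f c d - slope f u v\<bar> \<le> 2 * B * (v - u) powr (1/2)" by linarith
    qed
  qed
qed

section \<open>Regular curves\<close>

text \<open>If the derivative is bounded by B, the linearisation error is at most 2B |t - s| and the
  linear part at most B |t - s|, hence the constant 3B.\<close>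

lemma C1_Lipschitz:
  fixes h :: "real \<Rightarrow> 'a::euclidean_space"
  assumes D: "continuous_on {0..T} D"
    and h: "\<And>t. t \<in> {0..T} \<Longrightarrow> (h has_vector_derivative D t) (at t within {0..T})"
  shows "\<exists>L>0. \<forall>t\<in>{0..T}. norm (D t) \<le> L \<and> (\<forall>s\<in>{0..T}. norm (h t - h s) \<le> L * \<bar>t - s\<bar>)"
proof -
  have "bounded (D ` {0..T})" using D by (intro compact_imp_bounded compact_continuous_image) auto
  then obtain B where B: "0 < B" "\<And>t. t \<in> {0..T} \<Longrightarrow> norm (D t) \<le> B"
    unfolding bounded_pos by blast
  have "norm (h t - h s) \<le> 3 * B * \<bar>t - s\<bar>" if ts: "t \<in> {0..T}" "s \<in> {0..T}" for t s
  proof -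
    have "norm (h t - h s - (t - s) *\<^sub>R D s) \<le> norm (t - s) * (2 * B)"
    proof (rule vector_differentiable_bound_linearization)
      show "(h has_vector_derivative D x) (at x within {0..T})" if "x \<in> {0..T}" for x using h[OF that] .
      show "closed_segment s t \<subseteq> {0..T}" using ts by (auto simp: closed_segment_eq_real_ivl)
      show "norm (D x - D s) \<le> 2 * B" if "x \<in> {0..T}" for x
        using norm_triangle_ineq4[of "D x" "D s"] B(2)[OF that] B(2)[OF ts(2)] by linarith
    qed (use ts in auto)
    moreover have "norm ((t - s) *\<^sub>R D s) \<le> \<bar>t - s\<bar> * B" using B(2)[OF ts(2)] by (simp add: mult_left_mono)
    moreover have "norm (h t - h s) \<le> norm (h t - h s - (t - s) *\<^sub>R D s) + norm ((t - s) *\<^sub>R D s)"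
      using norm_triangle_sub[of "h t - h s" "(t - s) *\<^sub>R D s"] by linarith
    ultimately show ?thesis by (simp add: algebra_simps)
  qed
  then show ?thesis using B by (intro exI[of _ "3 * B"]) force
qed

text \<open>On short time intervals the curve moves away from each of its points at least at speed \<open>c/2\<close>.\<close>

lemma regular_curve_measure:
  fixes h :: "real \<Rightarrow> 'a::euclidean_space"
  assumes T: "0 < T" and D: "continuous_on {0..T} D"
    and h: "\<And>t. t \<in> {0..T} \<Longrightarrow> (h has_vector_derivative D t) (at t within {0..T})"
    and nz: "\<And>t. t \<in> {0..T} \<Longrightarrow> D t \<noteq> 0"
  shows "\<exists>C\<ge>0. \<forall>z \<rho>. 0 < \<rho> \<longrightarrow>
    emeasure (lebesgue_on {0<..<T}) {t \<in> {0<..<T}. norm (z - h t) < \<rho>} \<le> ennreal (C * \<rho>)"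
proof -
  have "\<exists>t0\<in>{0..T}. \<forall>t\<in>{0..T}. norm (D t0) \<le> norm (D t)"
    using T D by (intro continuous_attains_inf continuous_intros) auto
  then obtain t0 where t0: "t0 \<in> {0..T}" "\<forall>t\<in>{0..T}. norm (D t0) \<le> norm (D t)" by blast
  define c where "c = norm (D t0)"
  have c: "0 < c" "\<And>t. t \<in> {0..T} \<Longrightarrow> c \<le> norm (D t)" using t0 nz by (auto simp: c_def)
  have "uniformly_continuous_on {0..T} D" using D by (intro compact_uniformly_continuous) auto
  then obtain \<eta> where \<eta>: "0 < \<eta>"
    "\<And>s t. s \<in> {0..T} \<Longrightarrow> t \<in> {0..T} \<Longrightarrow> dist t s < \<eta> \<Longrightarrow> dist (D t) (D s) < c / 2"
    unfolding uniformly_continuous_on_def using half_gt_zero[OF c(1)] by blast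
  have far: "c / 2 * \<bar>t - s\<bar> \<le> norm (h t - h s)"
    if ts: "s \<in> {0..T}" "t \<in> {0..T}" "\<bar>t - s\<bar> < \<eta>" for s t
  proof -
    have "norm (h t - h s - (t - s) *\<^sub>R D s) \<le> norm (t - s) * (c / 2)"
    proof (rule vector_differentiable_bound_linearization)
      have sub: "closed_segment s t \<subseteq> {0..T}" using ts by (auto simp: closed_segment_eq_real_ivl)
      show "(h has_vector_derivative D x) (at x within closed_segment s t)" if "x \<in> closed_segment s t" for x
        using h[of x] that sub by (meson has_vector_derivative_within_subset subsetD)
      show "norm (D x - D s) \<le> c / 2" if x: "x \<in> closed_segment s t" for x
      proof -
        have "dist x s < \<eta>" using x ts(3) by (auto simp: dist_real_def closed_segment_eq_real_ivl split: if_splits)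
        then have "dist (D x) (D s) < c / 2" using x sub ts by (intro \<eta>) auto
        then show ?thesis by (simp add: dist_norm)
      qed
    qed auto
    moreover have "\<bar>t - s\<bar> * c \<le> norm ((t - s) *\<^sub>R D s)" using c(2)[OF ts(1)] by (simp add: mult_left_mono)
    moreover have "norm ((t - s) *\<^sub>R D s) \<le> norm (h t - h s) + norm (h t - h s - (t - s) *\<^sub>R D s)"
      using norm_triangle_sub[of "(t - s) *\<^sub>R D s" "h t - h s"]
      by (simp only: norm_minus_commute[of "h t - h s"])
    ultimately show ?thesis by (simp add: algebra_simps)
  qed
  obtain n where n: "T / \<eta> < real n" using reals_Archimedean2 by blast
  have "0 < T / \<eta>" using T \<eta> by simp
  then have n0: "0 < real n" using n by (rule less_trans)
  have short: "T / real n < \<eta>" using n n0 \<eta> by (simp add: pos_divide_less_eq mult.commute)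
  show ?thesis
  proof (intro exI[of _ "real n * (8 / c)"] conjI allI impI)
    show "0 \<le> real n * (8 / c)" using c by simp
    fix z and \<rho> :: real assume \<rho>: "0 < \<rho>"
    \<comment> \<open>The curve may come close to \<open>z\<close> several times, but on each of the
      \<open>n\<close> pieces of length T/n < \<eta> the lower speed bound confines such times to a
      neighbourhood of one of them, \<open>x k\<close>. If \<open>A k\<close> is empty, its
      inclusion is vacuous.\<close>
    define A where "A k = {t \<in> {0<..<T}. norm (z - h t) < \<rho> \<and> real k * (T / real n) \<le> t \<and> t < real (Suc k) * (T / real n)}" for k
    define x where "x k = (SOME t. t \<in> A k)" for k
    \<comment> \<open>Two times in \<open>A k\<close> have images less than 2\<rho> apart, so c/2
      times their distance is below 2\<rho>. The \<open>n\<close> intervals of length 2w add up to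
      the constant 8n/c.\<close>
    define w where "w = 4 * \<rho> / c"
    have Ax: "A k \<subseteq> {x k - w..x k + w}" for k
    proof
      fix t assume t: "t \<in> A k"
      then have xk: "x k \<in> A k" unfolding x_def by (rule someI)
      have "real (Suc k) * (T / real n) = real k * (T / real n) + T / real n"
        by (simp only: of_nat_Suc distrib_right mult_1_left add.commute)
      then have "\<bar>t - x k\<bar> < \<eta>" using t xk short unfolding A_def mem_Collect_eq by linarith
      then have "c / 2 * \<bar>t - x k\<bar> \<le> norm (h t - h (x k))" using t xk by (intro far) (auto simp: A_def)
      also have "\<dots> \<le> norm (z - h (x k)) + norm (z - h t)"
        using norm_triangle_ineq4[of "z - h (x k)" "z - h t"] by simp
      also have "\<dots> < 2 * \<rho>" using t xk by (simp add: A_def)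
      finally have "\<bar>t - x k\<bar> < w" using c by (simp add: w_def field_simps)
      then show "t \<in> {x k - w..x k + w}" by auto
    qed
    have cover: "{t \<in> {0<..<T}. norm (z - h t) < \<rho>} \<subseteq> (\<Union>k<n. {x k - w..x k + w} \<inter> {0<..<T})"
    proof
      fix t assume t: "t \<in> {t \<in> {0<..<T}. norm (z - h t) < \<rho>}"
      define k where "k = nat \<lfloor>t / (T / real n)\<rfloor>"
      have pos: "0 < T / real n" using T n0 by simp
      have q: "0 \<le> t / (T / real n)" using t pos by simp
      have k: "real k \<le> t / (T / real n)" "t / (T / real n) < real k + 1"
        using q by (simp_all add: k_def)
      then have k': "real k * (T / real n) \<le> t" "t < real (Suc k) * (T / real n)"
        using pos_le_divide_eq[OF pos, THEN iffD1, OF k(1)] pos_divide_less_eq[OF pos, THEN iffD1, OF k(2)]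
        by (simp_all only: of_nat_Suc add.commute[of 1])
      have "real k * (T / real n) < real n * (T / real n)" using k'(1) t n0 by auto
      then have "k < n" using pos by (simp only: mult_less_cancel_right_pos of_nat_less_iff)
      have "t \<in> A k" using t k' by (simp only: A_def mem_Collect_eq)
      then have "t \<in> {x k - w..x k + w} \<inter> {0<..<T}" using Ax[of k] t by blast
      with \<open>k < n\<close> show "t \<in> (\<Union>k<n. {x k - w..x k + w} \<inter> {0<..<T})" by blast
    qed
    have meas: "{x k - w..x k + w} \<inter> {0<..<T} \<in> sets (lebesgue_on {0<..<T})" for k
      by (auto simp: sets_restrict_space_iff)
    have "emeasure (lebesgue_on {0<..<T}) {t \<in> {0<..<T}. norm (z - h t) < \<rho>} \<le>
        emeasure (lebesgue_on {0<..<T}) (\<Union>k<n. {x k - w..x k + w} \<inter> {0<..<T})"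
      using meas by (intro emeasure_mono cover sets.finite_UN) auto
    also have "\<dots> \<le> (\<Sum>k<n. emeasure (lebesgue_on {0<..<T}) ({x k - w..x k + w} \<inter> {0<..<T}))"
      using meas by (intro emeasure_subadditive_finite) auto
    also have "\<dots> \<le> (\<Sum>k<n. ennreal (2 * w))"
    proof (intro sum_mono)
      fix k
      have "emeasure (lebesgue_on {0<..<T}) ({x k - w..x k + w} \<inter> {0<..<T}) = emeasure lebesgue ({x k - w..x k + w} \<inter> {0<..<T})"
        by (intro emeasure_restrict_space) auto
      also have "\<dots> \<le> emeasure lebesgue {x k - w..x k + w}" by (intro emeasure_mono) auto
      also have "\<dots> = ennreal (2 * w)" using \<rho> c by (simp add: w_def)
      finally show "emeasure (lebesgue_on {0<..<T}) ({x k - w..x k + w} \<inter> {0<..<T}) \<le> ennreal (2 * w)" .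
    qed
    also have "\<dots> = ennreal (real n * (8 / c) * \<rho>)"
      using \<rho> c by (simp add: ennreal_of_nat_eq_real_of_nat ennreal_mult[symmetric] w_def field_simps)
    finally show "emeasure (lebesgue_on {0<..<T}) {t \<in> {0<..<T}. norm (z - h t) < \<rho>} \<le> ennreal (real n * (8 / c) * \<rho>)" .
  qed
qed

section \<open>The singular kernel\<close>

text \<open>The component of \<open>v\<close> orthogonal to \<open>H\<close>, divided by the norm of
  \<open>H\<close>: the symmetric matrix of the kernel applied to \<open>v\<close>. Division by zero
  makes it 0 at \<open>H = 0\<close>.\<close>

definition perp :: "'a::real_inner \<Rightarrow> 'a \<Rightarrow> 'a" where
  "perp H v = (1 / norm H) *\<^sub>R v - ((H \<bullet> v) / norm H ^ 3) *\<^sub>R H"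

lemma perp_zero [simp]: "perp 0 v = 0"
  by (simp add: perp_def)

lemma perp_sgn: "perp H v = (1 / norm H) *\<^sub>R (v - (sgn H \<bullet> v) *\<^sub>R sgn H)"
  by (cases "H = 0") (simp_all add: perp_def sgn_div_norm scaleR_diff_right power3_eq_cube field_simps)

lemma norm_proj_diff_le:
  fixes e v :: "'a::real_inner"
  assumes "norm e \<le> 1"
  shows "norm ((e \<bullet> v) *\<^sub>R e) \<le> norm v"
proof -
  have "\<bar>e \<bullet> v\<bar> \<le> norm e * norm v" by (rule Cauchy_Schwarz_ineq2)
  also have "\<dots> \<le> 1 * norm v" using assms by (intro mult_right_mono) auto
  finally have "\<bar>e \<bullet> v\<bar> * norm e \<le> norm v * 1" using assms by (intro mult_mono) auto
  then show ?thesis by simp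
qed

lemma norm_perp_le: "norm (perp H v) \<le> 2 * norm v / norm H"
proof -
  have "norm (v - (sgn H \<bullet> v) *\<^sub>R sgn H) \<le> norm v + norm ((sgn H \<bullet> v) *\<^sub>R sgn H)" by (rule norm_triangle_ineq4)
  also have "\<dots> \<le> 2 * norm v" using norm_proj_diff_le[of "sgn H" v] by (simp add: norm_sgn)
  finally show ?thesis unfolding perp_sgn by (simp add: divide_right_mono)
qed

lemma norm_inverse_norm_diff:
  fixes H H' :: "'a::real_inner"
  assumes "H \<noteq> 0" "H' \<noteq> 0"
  shows "\<bar>1 / norm H - 1 / norm H'\<bar> \<le> norm (H - H') / (norm H * norm H')"
proof -
  have "1 / norm H - 1 / norm H' = (norm H' - norm H) / (norm H * norm H')" using assms by (simp add: field_simps)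
  then have "\<bar>1 / norm H - 1 / norm H'\<bar> = \<bar>norm H' - norm H\<bar> / (norm H * norm H')" by (simp add: abs_mult)
  also have "\<dots> \<le> norm (H - H') / (norm H * norm H')"
    using norm_triangle_ineq3[of H' H] by (intro divide_right_mono) (auto simp: norm_minus_commute)
  finally show ?thesis .
qed

text \<open>The difference splits into a change of the factor 1/|H| and a change of the projection.
  Unit vectors differ by at most 2 |H - H'| / |H|, and the projection is quadratic in the unit
  vector; the two parts contribute 2 and 4 to the constant 6.\<close>

lemma norm_perp_diff:
  fixes H H' v :: "'a::real_inner"
  assumes nz: "H \<noteq> 0" "H' \<noteq> 0"
  shows "norm (perp H v - perp H' v) \<le> 6 * norm v * norm (H - H') / (norm H * norm H')"
proof -
  define e where "e = sgn H"
  define e' where "e' = sgn H'"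
  define d where "d = norm (H - H')"
  have e1: "norm e = 1" "norm e' = 1" using nz by (auto simp: e_def e'_def norm_sgn)
  have ee: "norm (e - e') \<le> 2 * d / norm H"
  proof -
    have "e - e' = (1 / norm H) *\<^sub>R (H - H') + (1 / norm H - 1 / norm H') *\<^sub>R H'"
      by (simp add: e_def e'_def sgn_div_norm algebra_simps inverse_eq_divide)
    then have "norm (e - e') \<le> d / norm H + \<bar>1 / norm H - 1 / norm H'\<bar> * norm H'"
      using norm_triangle_ineq[of "(1 / norm H) *\<^sub>R (H - H')" "(1 / norm H - 1 / norm H') *\<^sub>R H'"]
      by (simp add: d_def)
    also have "\<bar>1 / norm H - 1 / norm H'\<bar> * norm H' \<le> d / (norm H * norm H') * norm H'"
      unfolding d_def by (intro mult_right_mono norm_inverse_norm_diff nz) auto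
    finally show ?thesis using nz by simp
  qed
  have proj: "norm ((e \<bullet> v) *\<^sub>R e - (e' \<bullet> v) *\<^sub>R e') \<le> 2 * norm v * norm (e - e')"
  proof -
    have "(e \<bullet> v) *\<^sub>R e - (e' \<bullet> v) *\<^sub>R e' = ((e - e') \<bullet> v) *\<^sub>R e + (e' \<bullet> v) *\<^sub>R (e - e')"
      by (simp add: algebra_simps)
    then have "norm ((e \<bullet> v) *\<^sub>R e - (e' \<bullet> v) *\<^sub>R e') \<le> \<bar>(e - e') \<bullet> v\<bar> + \<bar>e' \<bullet> v\<bar> * norm (e - e')"
      using norm_triangle_ineq[of "((e - e') \<bullet> v) *\<^sub>R e" "(e' \<bullet> v) *\<^sub>R (e - e')"] e1 by simp
    also have "\<dots> \<le> norm (e - e') * norm v + norm v * norm (e - e')"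
      using Cauchy_Schwarz_ineq2[of "e - e'" v] Cauchy_Schwarz_ineq2[of e' v] e1
      by (intro add_mono mult_right_mono) auto
    finally show ?thesis by simp
  qed
  have "perp H v - perp H' v = (1 / norm H - 1 / norm H') *\<^sub>R (v - (e \<bullet> v) *\<^sub>R e)
      - (1 / norm H') *\<^sub>R ((e \<bullet> v) *\<^sub>R e - (e' \<bullet> v) *\<^sub>R e')"
    unfolding perp_sgn e_def[symmetric] e'_def[symmetric] by (simp add: algebra_simps)
  then have "norm (perp H v - perp H' v) \<le> \<bar>1 / norm H - 1 / norm H'\<bar> * norm (v - (e \<bullet> v) *\<^sub>R e)
      + (1 / norm H') * norm ((e \<bullet> v) *\<^sub>R e - (e' \<bullet> v) *\<^sub>R e')"
    using norm_triangle_ineq4[of "(1 / norm H - 1 / norm H') *\<^sub>R (v - (e \<bullet> v) *\<^sub>R e)"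
        "(1 / norm H') *\<^sub>R ((e \<bullet> v) *\<^sub>R e - (e' \<bullet> v) *\<^sub>R e')"] by simp
  also have "\<dots> \<le> d / (norm H * norm H') * (2 * norm v) + (1 / norm H') * (2 * norm v * (2 * d / norm H))"
  proof (intro add_mono mult_mono)
    show "norm (v - (e \<bullet> v) *\<^sub>R e) \<le> 2 * norm v"
      using norm_triangle_ineq4[of v "(e \<bullet> v) *\<^sub>R e"] norm_proj_diff_le[of e v] e1 by simp
    show "norm ((e \<bullet> v) *\<^sub>R e - (e' \<bullet> v) *\<^sub>R e') \<le> 2 * norm v * (2 * d / norm H)"
      by (rule order_trans[OF proj mult_left_mono[OF ee]]) simp
    show "\<bar>1 / norm H - 1 / norm H'\<bar> \<le> d / (norm H * norm H')"
      unfolding d_def by (rule norm_inverse_norm_diff[OF nz])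
  qed (auto simp: d_def)
  also have "\<dots> = 6 * norm v * d / (norm H * norm H')" by (simp add: field_simps)
  finally show ?thesis by (simp add: d_def)
qed

text \<open>The kernel frozen at a nearby time, cut off where it is close to its singularity.\<close>

lemma norm_perp_cutoff:
  fixes H H' v :: "'a::real_inner"
  assumes \<delta>: "0 < \<delta>" and close: "norm (H - H') \<le> \<delta> / 2"
  shows "norm (perp H v - (if \<delta> \<le> norm H' then perp H' v else 0)) \<le> 9 * norm v * \<delta> powr (1/4) * norm H powr (- (5/4))"
proof (cases "H = 0")
  case True
  then have "\<not> \<delta> \<le> norm H'" using \<delta> close by simp
  then show ?thesis using True by simp
next
  case False
  define r where "r = norm H"
  define r' where "r' = norm H'"
  have r: "0 < r" using False by (simp add: r_def)
  have rr: "\<bar>r - r'\<bar> \<le> \<delta> / 2" unfolding r_def r'_def using norm_triangle_ineq3[of H H'] close by linarith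
  show ?thesis
  proof (cases "\<delta> \<le> r'")
    case True
    have r'0: "0 < r'" using True \<delta> by linarith
    \<comment> \<open>Away from the cut-off the norms of \<open>H\<close> and \<open>H'\<close> are
      comparable, so the difference is of order \<delta> / r^2. Of the factor r^(-2), the part
      r^(-3/4) is traded for \<delta>^(-3/4) since r \<ge> \<delta>/2, leaving \<delta>^(1/4)
      r^(-5/4).\<close>
    have rd: "\<delta> / 2 \<le> r" "2 / 3 * r \<le> r'" using rr True by argo+
    have "norm (perp H v - perp H' v) \<le> 6 * norm v * norm (H - H') / (r * r')"
      unfolding r_def r'_def using False r'0 by (intro norm_perp_diff) (auto simp: r'_def)
    also have "\<dots> \<le> 6 * norm v * (\<delta> / 2) / (r * (2 / 3 * r))"
      using r rd r'0 close \<delta> by (intro frac_le mult_left_mono) (auto intro!: mult_nonneg_nonneg)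
    also have "\<dots> = 9 / 2 * norm v * (\<delta> * (r powr (- (3/4)) * r powr (- (5/4))))"
    proof -
      have "r powr (- (3/4)) * r powr (- (5/4)) = r powr (- (3/4) + - (5/4))" by (rule powr_add[symmetric])
      also have "- (3/4) + - (5/4) = - (2::real)" by simp
      also have "r powr (- 2) = 1 / (r * r)" using r by (simp add: powr_minus_divide powr_numeral power2_eq_square)
      finally have *: "r powr (- (3/4)) * r powr (- (5/4)) = 1 / (r * r)" .
      show ?thesis unfolding * using r by (simp add: field_simps)
    qed
    also have "\<dots> \<le> 9 / 2 * norm v * (\<delta> * ((2 * \<delta> powr (- (3/4))) * r powr (- (5/4))))"
    proof (intro mult_left_mono mult_right_mono)
      have "r powr (- (3/4)) \<le> (\<delta> / 2) powr (- (3/4))" using \<delta> rd by (intro powr_mono2') auto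
      also have "\<dots> = \<delta> powr (- (3/4)) / 2 powr (- (3/4))" by (rule powr_divide)
      also have "\<dots> = 2 powr (3/4) * \<delta> powr (- (3/4))"
        by (simp only: powr_minus[of 2] divide_inverse inverse_inverse_eq mult.commute)
      also have "\<dots> \<le> 2 * \<delta> powr (- (3/4))"
      proof (rule mult_right_mono)
        have "(2::real) powr (3/4) \<le> 2 powr 1" by (intro powr_mono) auto
        then show "(2::real) powr (3/4) \<le> 2" by simp
      qed simp
      finally show "r powr (- (3/4)) \<le> 2 * \<delta> powr (- (3/4))" .
    qed (use \<delta> in auto)
    also have "\<dots> = 9 * norm v * (\<delta> powr 1 * \<delta> powr (- (3/4))) * r powr (- (5/4))" using \<delta> by simp
    also have "\<delta> powr 1 * \<delta> powr (- (3/4)) = \<delta> powr (1/4)" by (simp only: powr_add[symmetric]) simp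
    finally show ?thesis using True by (simp add: r_def r'_def)
  next
    case F: False
    \<comment> \<open>Inside the cut-off the full kernel, of order 1/r, remains. As \<open>r\<close>
      is at most a multiple of \<delta>, the factor r^(1/4) split off from it is paid for by
      \<delta>^(1/4).\<close>
    have r2: "r \<le> 2 * \<delta>" using rr F by argo
    have "norm (perp H v) \<le> 2 * norm v / r" unfolding r_def by (rule norm_perp_le)
    also have "\<dots> = 2 * norm v * (r powr (1/4) * r powr (- (5/4)))"
    proof -
      have "r powr (1/4) * r powr (- (5/4)) = r powr (1/4 + - (5/4))" by (rule powr_add[symmetric])
      also have "1/4 + - (5/4) = - (1::real)" by simp
      also have "r powr (- 1) = 1 / r" using r by (simp add: powr_minus_divide)
      finally have *: "r powr (1/4) * r powr (- (5/4)) = 1 / r" .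
      show ?thesis unfolding * by simp
    qed
    also have "\<dots> \<le> 2 * norm v * ((2 * \<delta> powr (1/4)) * r powr (- (5/4)))"
    proof (intro mult_left_mono mult_right_mono)
      have "r powr (1/4) \<le> (2 * \<delta>) powr (1/4)" using r r2 by (intro powr_mono2) auto
      also have "\<dots> = 2 powr (1/4) * \<delta> powr (1/4)" by (rule powr_mult)
      also have "\<dots> \<le> 2 * \<delta> powr (1/4)"
      proof (rule mult_right_mono)
        have "(2::real) powr (1/4) \<le> 2 powr 1" by (intro powr_mono) auto
        then show "(2::real) powr (1/4) \<le> 2" by simp
      qed simp
      finally show "r powr (1/4) \<le> 2 * \<delta> powr (1/4)" .
    qed auto
    also have "\<dots> \<le> 9 * norm v * \<delta> powr (1/4) * r powr (- (5/4))"
    proof -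
      have "0 \<le> norm v * \<delta> powr (1/4) * r powr (- (5/4))" by simp
      then show ?thesis by simp
    qed
    finally show ?thesis using F by (simp add: r_def r'_def)
  qed
qed

text \<open>The kernel matrix is symmetric, so it may act on \<open>p\<close> in place of the time
  derivative; the sign is that of the time derivative of H.\<close>

lemma kappa_limit_perp:
  "kappa_limit T \<mu>0 m0 G p h x t =
    - (\<mu>0 * m0) * (perp (field_H G h x t) (p x) \<bullet> time_deriv T h t)"
proof -
  define H where "H = field_H G h x t"
  define d where "d = time_deriv T h t"
  have outer: "outer H H *v w = (H \<bullet> w) *\<^sub>R H" for w :: "real^3"
    by (simp add: vec_eq_iff outer_def matrix_vector_mult_def inner_vec_def sum_distrib_left mult_ac)
  have mv: "(- ((1 / norm H ^ 3) *\<^sub>R outer H H) + (1 / norm H) *\<^sub>R mat 1) *v w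
      = (1 / norm H) *\<^sub>R w - (1 / norm H ^ 3) *\<^sub>R ((H \<bullet> w) *\<^sub>R H)" for w :: "real^3"
  proof -
    have "(- ((1 / norm H ^ 3) *\<^sub>R outer H H) + (1 / norm H) *\<^sub>R mat 1) *v w
      = (- (1 / norm H ^ 3)) *\<^sub>R (outer H H *v w) + (1 / norm H) *\<^sub>R (mat 1 *v w)"
      by (simp only: scaleR_minus_left[symmetric] matrix_vector_mult_add_rdistrib scaleR_matrix_vector_assoc)
    then show ?thesis by (simp add: outer)
  qed
  show ?thesis
    unfolding kappa_limit_def Let_def H_def[symmetric] d_def[symmetric] mv
    by (simp add: perp_def inner_diff_left inner_diff_right inner_commute algebra_simps)
qed

section \<open>From finite rank approximation to decay and compactness\<close>

lemma singular_value_decay: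
  assumes T: "L2_operator M N T" and d: "0 < d" and E: "0 \<le> E0" "0 \<le> E"
    and E0: "finite_rank_approx M N T 0 E0"
    and approx: "\<And>k. 1 \<le> k \<Longrightarrow> finite_rank_approx M N T (k * d) (E * real k powr (- (1/4)))"
    and n: "1 \<le> n"
  shows "singular_value M N T n \<le> (E0 + 2 * E) * real d * real n powr (- (1/4))"
proof -
  \<comment> \<open>The largest multiple of \<open>d\<close> that stays strictly below
    \<open>n\<close>, as the comparison with finite rank operators requires. If k = 0, then n \<le>
    d and the rank 0 bound suffices; otherwise n \<le> 2dk transfers the decay from \<open>k\<close>
    to \<open>n\<close>.\<close>
  define k where "k = (n - 1) div d"
  have neg: "y powr (- (1/4)) \<le> c * x powr (- (1/4))" if "0 < x" "1 \<le> c" "x \<le> c * y" for x y c :: real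
  proof -
    have y: "x / c \<le> y" using that by (simp add: pos_divide_le_eq mult.commute)
    have "y powr (- (1/4)) \<le> (x / c) powr (- (1/4))" using that y by (intro powr_mono2') auto
    also have "\<dots> = x powr (- (1/4)) / c powr (- (1/4))" by (rule powr_divide)
    also have "\<dots> = c powr (1/4) * x powr (- (1/4))"
      by (simp only: powr_minus[of c] divide_inverse inverse_inverse_eq mult.commute)
    also have "\<dots> \<le> c * x powr (- (1/4))"
    proof (rule mult_right_mono)
      have "c powr (1/4) \<le> c powr 1" using that by (intro powr_mono) auto
      then show "c powr (1/4) \<le> c" using that by simp
    qed simp
    finally show ?thesis .
  qed
  show ?thesis
  proof (cases "k = 0")
    case True
    then have nd: "n \<le> d" using n d by (auto simp: k_def div_eq_0_iff)
    have "singular_value M N T n \<le> E0"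
      using n E by (intro singular_value_le_finite_rank[OF T E0]) auto
    also have "E0 * 1 \<le> E0 * (real d * real n powr (- (1/4)))"
      using neg[of "real n" "real d" 1] n d nd E by (intro mult_left_mono) auto
    also have "\<dots> \<le> (E0 + 2 * E) * (real d * real n powr (- (1/4)))"
      using E by (intro mult_right_mono) auto
    finally show ?thesis by (simp only: mult_1_right mult.assoc)
  next
    case False
    then have k: "1 \<le> k" by simp
    have kd: "k * d \<le> n - 1" unfolding k_def by (rule div_times_less_eq_dividend)
    have "n - 1 < (k + 1) * d" unfolding k_def using d by (simp add: dividend_less_div_times)
    moreover have "(k + 1) * d \<le> 2 * d * k" using k by (simp add: algebra_simps)
    ultimately have "n \<le> 2 * d * k" by linarith
    then have nk: "real n \<le> 2 * real d * real k" unfolding of_nat_mult[symmetric] of_nat_numeral[symmetric, where 'a=real] of_nat_le_iff .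
    have "singular_value M N T n \<le> E * real k powr (- (1/4))"
      using n kd E by (intro singular_value_le_finite_rank[OF T approx[OF k]]) auto
    also have "\<dots> \<le> E * (2 * real d * real n powr (- (1/4)))"
      using neg[of "real n" "2 * real d" "real k"] n d nk E by (intro mult_left_mono) auto
    also have "\<dots> = (2 * E) * (real d * real n powr (- (1/4)))" by simp
    also have "\<dots> \<le> (E0 + 2 * E) * (real d * real n powr (- (1/4)))"
      using E by (intro mult_right_mono) auto
    finally show ?thesis by (simp only: mult.assoc)
  qed
qed

lemma finite_rank_approx_mono:
  assumes "finite_rank_approx M N T m e" "e \<le> e'"
  shows "finite_rank_approx M N T m e'"
proof -
  have "e * L2_norm M c \<le> e' * L2_norm M c" for c
    using assms(2) L2_norm_nonneg by (rule mult_right_mono)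
  then show ?thesis using assms(1) unfolding finite_rank_approx_def by (blast intro: order_trans)
qed

lemma compact_of_decay:
  assumes T: "L2_operator M N T"
    and approx: "\<And>k. 1 \<le> k \<Longrightarrow> finite_rank_approx M N T (k * d) (E * real k powr (- (1/4)))"
  shows "compact_L2_operator M N T"
proof (rule compact_of_finite_rank_approx[OF T])
  fix e :: real assume e: "0 < e"
  have "(\<lambda>k. E * real k powr (- (1/4))) \<longlonglongrightarrow> E * 0"
    by (intro tendsto_mult tendsto_const tendsto_neg_powr filterlim_real_sequentially) simp
  then have "eventually (\<lambda>k. E * real k powr (- (1/4)) < e) sequentially"
    using e by (intro order_tendstoD) auto
  then have "eventually (\<lambda>k. E * real k powr (- (1/4)) < e \<and> 1 \<le> k) sequentially"
    using eventually_ge_at_top[of 1] by eventually_elim simp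
  then obtain k where "E * real k powr (- (1/4)) < e" "1 \<le> k"
    by (auto simp: eventually_sequentially)
  then show "\<exists>m. finite_rank_approx M N T m e"
    using finite_rank_approx_mono[OF approx, of k e] by auto
qed

lemma bounded_measurable_L2:
  assumes "finite_measure M" "f \<in> borel_measurable M" "AE x in M. \<bar>f x\<bar> \<le> B"
  shows "f \<in> L2 M"
proof -
  interpret finite_measure M by fact
  have "integrable M (\<lambda>x. (f x)\<^sup>2)"
  proof (rule integrable_const_bound[of _ "B\<^sup>2"])
    show "AE x in M. norm ((f x)\<^sup>2) \<le> B\<^sup>2"
      using assms(3)
    proof eventually_elim
      fix x assume "\<bar>f x\<bar> \<le> B"
      then have "\<bar>f x\<bar>\<^sup>2 \<le> B\<^sup>2" by (intro power_mono) auto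
      then show "norm ((f x)\<^sup>2) \<le> B\<^sup>2" by simp
    qed
  qed (use assms in measurable)
  then show ?thesis using assms by (simp add: L2_def)
qed

lemma perp_measurable [measurable]:
  fixes H v :: "'a \<Rightarrow> 'b::{real_inner, second_countable_topology}"
  assumes [measurable]: "H \<in> borel_measurable M" "v \<in> borel_measurable M"
  shows "(\<lambda>x. perp (H x) (v x)) \<in> borel_measurable M"
  unfolding perp_def by measurable

lemma vec_nth_measurable:
  fixes f :: "'a \<Rightarrow> real^'n"
  assumes [measurable]: "f \<in> borel_measurable M"
  shows "(\<lambda>x. f x $ i) \<in> borel_measurable M"
proof -
  have "(\<lambda>x. f x \<bullet> axis i 1) \<in> borel_measurable M" by measurable
  then show ?thesis by (simp add: inner_axis)
qed

theorem perp_kernel_singular_values: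
  fixes M :: "'a measure" and g p :: "'a \<Rightarrow> real^'n" and h D :: "real \<Rightarrow> real^'n" and \<mu> :: real
  defines "N T \<equiv> lebesgue_on {0<..<T}"
  assumes ws: "weakly_singular M (N T) (\<lambda>x t. norm (g x - h t)) KM KN"
    and T: "0 < T"
    and g[measurable]: "g \<in> borel_measurable M" and p[measurable]: "p \<in> borel_measurable M"
    and h[measurable]: "h \<in> borel_measurable (N T)" and D[measurable]: "D \<in> borel_measurable (N T)"
    and P: "AE x in M. norm (p x) \<le> P" "0 \<le> P"
    and L: "0 < L" "\<And>t. t \<in> {0<..<T} \<Longrightarrow> norm (D t) \<le> L"
      "\<And>s t. s \<in> {0..T} \<Longrightarrow> t \<in> {0..T} \<Longrightarrow> norm (h t - h s) \<le> L * \<bar>t - s\<bar>"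
    and R: "0 < R" "\<And>x t. x \<in> space M \<Longrightarrow> t \<in> {0<..<T} \<Longrightarrow> norm (g x - h t) \<le> R"
  defines "F \<equiv> \<lambda>c t. LINT x|M. c x * (\<mu> * (perp (g x - h t) (p x) \<bullet> D t))"
  shows "compact_L2_operator M (N T) F"
    and "\<exists>C\<ge>0. \<forall>n\<ge>1. singular_value M (N T) F n \<le> C * real n powr (- (1/4))"
proof -
  interpret weakly_singular M "N T" "\<lambda>x t. norm (g x - h t)" KM KN by (rule ws)
  have spN: "space (N T) = {0<..<T}" by (simp add: N_def)
  have idN[measurable]: "(\<lambda>t. t) \<in> borel_measurable (N T)"
    using id_borel_measurable_lebesgue_on by (simp add: N_def id_def)
  define k where "k x t = \<mu> * (perp (g x - h t) (p x) \<bullet> D t)" for x t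
  have k_meas[measurable]: "(\<lambda>(x, t). k x t) \<in> borel_measurable (M \<Otimes>\<^sub>M N T)"
    unfolding k_def by measurable
  define r where "r x t = norm (g x - h t)" for x t
  \<comment> \<open>The kernel is of order 1/r, a weaker singularity than the power -5/4;
    boundedness of \<open>r\<close> by \<open>R\<close> supplies the missing factor r^(1/4).\<close>
  define K0 where "K0 = \<bar>\<mu>\<bar> * (2 * P * L) * R powr (1/4)"
  have K0: "0 \<le> K0" using P L by (simp add: K0_def)
  have dom0: "dominated K0 k"
    unfolding dominated_def spN
  proof (intro conjI k_meas)
    show "AE x in M. \<forall>t\<in>{0<..<T}. \<bar>k x t\<bar> \<le> K0 * norm (g x - h t) powr (- (5/4))"
      using P(1) AE_space
    proof eventually_elim
      fix x assume px: "norm (p x) \<le> P" and x: "x \<in> space M"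
      show "\<forall>t\<in>{0<..<T}. \<bar>k x t\<bar> \<le> K0 * norm (g x - h t) powr (- (5/4))"
      proof
        fix t assume t: "t \<in> {0<..<T}"
        show "\<bar>k x t\<bar> \<le> K0 * norm (g x - h t) powr (- (5/4))"
        proof (cases "r x t = 0")
          case True then show ?thesis by (simp add: k_def r_def)
        next
          case False
          then have r0: "0 < r x t" by (simp add: r_def)
          have "\<bar>perp (g x - h t) (p x) \<bullet> D t\<bar> \<le> norm (perp (g x - h t) (p x)) * norm (D t)"
            by (rule Cauchy_Schwarz_ineq2)
          also have "\<dots> \<le> (2 * norm (p x) / r x t) * L"
            unfolding r_def using L(1) L(2)[OF t] by (intro mult_mono norm_perp_le) auto
          also have "\<dots> \<le> (2 * P / r x t) * L"
            using px r0 L(1) by (intro mult_right_mono divide_right_mono) auto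
          also have "\<dots> = 2 * P * L * (r x t powr (1/4) * r x t powr (- (5/4)))"
          proof -
            have "r x t powr (1/4) * r x t powr (- (5/4)) = r x t powr (1/4 + - (5/4))" by (rule powr_add[symmetric])
            also have "1/4 + - (5/4) = - (1::real)" by simp
            also have "r x t powr (- 1) = 1 / r x t" using r0 by (simp add: powr_minus_divide)
            finally have *: "r x t powr (1/4) * r x t powr (- (5/4)) = 1 / r x t" .
            show ?thesis unfolding * by simp
          qed
          also have "\<dots> \<le> 2 * P * L * (R powr (1/4) * r x t powr (- (5/4)))"
            using R(2)[OF x t] r0 P L by (intro mult_left_mono mult_right_mono powr_mono2) (auto simp: r_def)
          finally have "\<bar>\<mu>\<bar> * \<bar>perp (g x - h t) (p x) \<bullet> D t\<bar> \<le> \<bar>\<mu>\<bar> * (2 * P * L * (R powr (1/4) * r x t powr (- (5/4))))"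
            by (rule mult_left_mono) simp
          then show ?thesis by (simp add: k_def K0_def abs_mult r_def mult_ac)
        qed
      qed
    qed
  qed
  have F: "F = (\<lambda>c t. LINT x|M. c x * k x t)" by (simp add: F_def k_def)
  have op: "L2_operator M (N T) F" unfolding F by (rule dominated_L2_operator[OF dom0 K0])
  define E0 where "E0 = K0 * sqrt (KM * KN)"
  have E0: "0 \<le> E0" using K0 KM_nonneg KN_nonneg by (simp add: E0_def)
  have fr0: "finite_rank_approx M (N T) F 0 E0"
    using dominated_finite_rank_approx[OF dom0 K0, of "{}" "\<lambda>_ _. 0" "\<lambda>_ _. 0" K0] dom0 K0
    unfolding F E0_def by simp
  define E where "E = \<bar>\<mu>\<bar> * (9 * P * L * (2 * L * T) powr (1/4)) * sqrt (KM * KN)"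
  have E: "0 \<le> E" using P L KM_nonneg KN_nonneg by (simp add: E_def)
  have fr: "finite_rank_approx M (N T) F (n * CARD('n)) (E * real n powr (- (1/4)))" if n: "1 \<le> n" for n
  proof -
    have n0: "0 < real n" using n by simp
    define q where "q = T / real n"
    have q: "0 < q" using T n0 by (simp add: q_def)
    \<comment> \<open>Within one time step \<open>h\<close> moves by at most L q = \<delta>/2, which
      is the closeness that \<open>norm_perp_cutoff\<close> asks for.\<close>
    define \<delta> where "\<delta> = 2 * L * q"
    have \<delta>: "0 < \<delta>" using L q by (simp add: \<delta>_def)
    define A where "A j x = (if \<delta> \<le> norm (g x - h (real j * q)) then perp (g x - h (real j * q)) (p x) else 0)" for j :: nat and x
    define j where "j t = nat \<lfloor>t / q\<rfloor>" for t
    have j: "real (j t) * q \<le> t" "t < (real (j t) + 1) * q" "j t < n" if t: "t \<in> {0<..<T}" for t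
    proof -
      have "0 \<le> t / q" using t q by simp
      then have *: "real (j t) \<le> t / q" "t / q < real (j t) + 1" by (simp_all add: j_def)
      show 1: "real (j t) * q \<le> t" by (rule pos_le_divide_eq[OF q, THEN iffD1, OF *(1)])
      show "t < (real (j t) + 1) * q" by (rule pos_divide_less_eq[OF q, THEN iffD1, OF *(2)])
      have "real n * q = T" using n0 by (simp add: q_def)
      then have "real (j t) * q < real n * q" using 1 t by auto
      then show "j t < n" using q by (simp only: mult_less_cancel_right_pos of_nat_less_iff)
    qed
    have node: "norm (g x - h t - (g x - h (real (j t) * q))) \<le> \<delta> / 2" if t: "t \<in> {0<..<T}" for x t
    proof -
      have jq: "0 \<le> real (j t) * q" using q by simp
      have "norm (h (real (j t) * q) - h t) \<le> L * \<bar>real (j t) * q - t\<bar>"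
        using t j[OF t] jq by (intro L(3)) auto
      also have "\<dots> \<le> L * q" using j[OF t] L(1) by (intro mult_left_mono) (auto simp: distrib_right)
      finally show ?thesis by (simp add: \<delta>_def)
    qed
    \<comment> \<open>Spatial factors, one for each node and coordinate; the matching time factor
      \<open>b\<close> is a coordinate of \<open>D\<close> restricted to the time slot of the
      node.\<close>
    define a where "a = (\<lambda>(jj, i::'n) x. \<mu> * A jj x $ i)"
    define b where "b = (\<lambda>(jj, i::'n) t. if j t = jj then D t $ i else 0)"
    have A_meas[measurable]: "A jj \<in> borel_measurable M" for jj unfolding A_def by measurable
    have A_bound: "AE x in M. norm (A jj x) \<le> 2 * P / \<delta>" for jj
      using P(1)
    proof eventually_elim
      fix x assume px: "norm (p x) \<le> P"
      show "norm (A jj x) \<le> 2 * P / \<delta>"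
      proof (cases "\<delta> \<le> norm (g x - h (real jj * q))")
        case True
        have "norm (A jj x) \<le> 2 * norm (p x) / norm (g x - h (real jj * q))"
          using True norm_perp_le by (simp add: A_def)
        also have "\<dots> \<le> 2 * P / \<delta>" using True \<delta> px P by (intro frac_le) auto
        finally show ?thesis .
      qed (use P \<delta> in \<open>simp add: A_def\<close>)
    qed
    have aL: "a q \<in> L2 M" for q
    proof -
      obtain jj i where qq: "q = (jj, i)" by fastforce
      show ?thesis
      proof (rule bounded_measurable_L2[where B = "\<bar>\<mu>\<bar> * (2 * P / \<delta>)"])
        show "a q \<in> borel_measurable M" unfolding a_def qq prod.case
          by (rule borel_measurable_times[OF borel_measurable_const vec_nth_measurable[OF A_meas]])
        show "AE x in M. \<bar>a q x\<bar> \<le> \<bar>\<mu>\<bar> * (2 * P / \<delta>)"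
          using A_bound[of jj]
        proof eventually_elim
          fix x assume "norm (A jj x) \<le> 2 * P / \<delta>"
          then have "\<bar>A jj x $ i\<bar> \<le> 2 * P / \<delta>" using component_le_norm_cart order_trans by blast
          then show "\<bar>a q x\<bar> \<le> \<bar>\<mu>\<bar> * (2 * P / \<delta>)" unfolding a_def qq prod.case abs_mult by (rule mult_left_mono) simp
        qed
      qed unfold_locales
    qed
    have bM[measurable]: "b q \<in> borel_measurable (N T)" for q
    proof -
      obtain jj i where qq: "q = (jj, i)" by fastforce
      have [measurable]: "(\<lambda>t. D t $ i) \<in> borel_measurable (N T)" by (rule vec_nth_measurable[OF D])
      have "(\<lambda>t. if j t = jj then D t $ i else 0) \<in> borel_measurable (N T)"
        unfolding j_def by measurable
      then show ?thesis unfolding b_def qq by simp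
    qed
    have bL: "b q \<in> L2 (N T)" for q
    proof -
      obtain jj i where qq: "q = (jj, i)" by fastforce
      show ?thesis
      proof (rule bounded_measurable_L2[where B = L])
        show "AE t in N T. \<bar>b q t\<bar> \<le> L"
        proof (intro AE_I2)
          fix t assume "t \<in> space (N T)"
          then have "norm (D t) \<le> L" using L(2) spN by simp
          then have "\<bar>D t $ i\<bar> \<le> L" using component_le_norm_cart order_trans by blast
          then show "\<bar>b q t\<bar> \<le> L" using L(1) unfolding b_def qq by simp
        qed
      qed (unfold_locales, rule bM)
    qed
    define J where "J = {..<n} \<times> (UNIV :: 'n set)"
    have finJ: "finite J" and cardJ: "card J = n * CARD('n)" by (simp_all add: J_def card_cartesian_product)
    have sumJ: "(\<Sum>i\<in>J. a i x * b i t) = \<mu> * (A (j t) x \<bullet> D t)" if t: "t \<in> {0<..<T}" for x t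
    proof -
      have "(\<Sum>i\<in>J. a i x * b i t) = (\<Sum>jj<n. \<Sum>i\<in>UNIV. a (jj, i) x * b (jj, i) t)"
        unfolding J_def by (simp add: sum.cartesian_product)
      also have "\<dots> = (\<Sum>jj<n. if jj = j t then \<mu> * (A jj x \<bullet> D t) else 0)"
        by (intro sum.cong) (auto simp: a_def b_def inner_vec_def sum_distrib_left mult.assoc)
      also have "\<dots> = \<mu> * (A (j t) x \<bullet> D t)" using j(3)[OF t] by (simp add: sum.delta)
      finally show ?thesis .
    qed
    define K' where "K' = \<bar>\<mu>\<bar> * (9 * P * L * \<delta> powr (1/4))"
    have K': "0 \<le> K'" using P L by (simp add: K'_def)
    have dom': "dominated K' (\<lambda>x t. k x t - (\<Sum>i\<in>J. a i x * b i t))"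
      unfolding dominated_def spN
    proof (intro conjI)
      have [measurable]: "a q \<in> borel_measurable M" for q using aL by (rule L2_measurable)
      show "(\<lambda>(x, t). k x t - (\<Sum>i\<in>J. a i x * b i t)) \<in> borel_measurable (M \<Otimes>\<^sub>M N T)" by measurable
      show "AE x in M. \<forall>t\<in>{0<..<T}. \<bar>k x t - (\<Sum>i\<in>J. a i x * b i t)\<bar> \<le> K' * norm (g x - h t) powr (- (5/4))"
        using P(1)
      proof eventually_elim
        fix x assume px: "norm (p x) \<le> P"
        show "\<forall>t\<in>{0<..<T}. \<bar>k x t - (\<Sum>i\<in>J. a i x * b i t)\<bar> \<le> K' * norm (g x - h t) powr (- (5/4))"
        proof
          fix t assume t: "t \<in> {0<..<T}"
          have "\<bar>k x t - (\<Sum>i\<in>J. a i x * b i t)\<bar> = \<bar>\<mu>\<bar> * \<bar>(perp (g x - h t) (p x) - A (j t) x) \<bullet> D t\<bar>"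
            unfolding sumJ[OF t] k_def by (simp add: abs_mult[symmetric] inner_diff_left right_diff_distrib)
          also have "\<dots> \<le> \<bar>\<mu>\<bar> * (norm (perp (g x - h t) (p x) - A (j t) x) * norm (D t))"
            by (intro mult_left_mono Cauchy_Schwarz_ineq2) simp
          also have "\<dots> \<le> \<bar>\<mu>\<bar> * ((9 * norm (p x) * \<delta> powr (1/4) * norm (g x - h t) powr (- (5/4))) * L)"
            unfolding A_def using L(1) L(2)[OF t] by (intro mult_left_mono mult_mono norm_perp_cutoff \<delta> node[OF t]) auto
          also have "\<dots> \<le> \<bar>\<mu>\<bar> * ((9 * P * \<delta> powr (1/4) * norm (g x - h t) powr (- (5/4))) * L)"
            using px L(1) by (intro mult_left_mono mult_right_mono) auto
          also have "\<dots> = K' * norm (g x - h t) powr (- (5/4))" by (simp add: K'_def mult_ac)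
          finally show "\<bar>k x t - (\<Sum>i\<in>J. a i x * b i t)\<bar> \<le> K' * norm (g x - h t) powr (- (5/4))" .
        qed
      qed
    qed
    have "finite_rank_approx M (N T) F (card J) (K' * sqrt (KM * KN))"
      unfolding F by (rule dominated_finite_rank_approx[OF dom0 K0 finJ aL bL dom' K'])
    moreover have "K' * sqrt (KM * KN) = E * real n powr (- (1/4))"
    proof -
      have "\<delta> = (2 * L * T) / real n" by (simp add: \<delta>_def q_def)
      then have "\<delta> powr (1/4) = (2 * L * T) powr (1/4) / real n powr (1/4)" by (simp only: powr_divide)
      then have "\<delta> powr (1/4) = (2 * L * T) powr (1/4) * real n powr (- (1/4))"
        by (simp only: powr_minus_divide) simp
      then show ?thesis by (simp add: K'_def E_def mult_ac)
    qed
    ultimately show ?thesis by (simp only: cardJ)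
  qed
  show "compact_L2_operator M (N T) F" by (rule compact_of_decay[OF op fr])
  show "\<exists>C\<ge>0. \<forall>n\<ge>1. singular_value M (N T) F n \<le> C * real n powr (- (1/4))"
    using singular_value_decay[OF op _ E0 E fr0 fr] E0 E
    by (intro exI[of _ "(E0 + 2 * E) * real CARD('n)"]) auto
qed

section \<open>The field free line setting\<close>

lemma diag_matrix_3_mult:
  "(diag_matrix (vector [a, b, 0]) *v x) $ 1 = a * x $ 1"
  "(diag_matrix (vector [a, b, 0]) *v x) $ 2 = b * x $ 2"
  for x :: "real^3"
  by (simp_all add: matrix_vector_mult_def diag_matrix_def sum_3 vector_3)

lemma bounded_linear_proj12: "bounded_linear proj12"
proof -
  have "linear proj12"
    by (rule linearI) (simp_all add: proj12_def vec_eq_iff forall_2)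
  then show ?thesis by (rule linear_conv_bounded_linear[THEN iffD1])
qed

lemma open_cylinder:
  assumes "open A" "open B"
  shows "open (cylinder A B)"
proof -
  have "cylinder A B = (proj12 -` A) \<inter> ((\<lambda>x. x $ 3) -` B)" by (auto simp: cylinder_def)
  moreover have "open (proj12 -` A)"
    using assms(1) linear_continuous_on[OF bounded_linear_proj12] by (intro open_vimage) auto
  moreover have "open ((\<lambda>x::real^3. x $ 3) -` B)"
    using assms(2) by (intro open_vimage) (auto intro!: continuous_intros)
  ultimately show ?thesis by (simp add: open_Int)
qed

lemma bounded_cylinder:
  assumes "bounded A" "bounded B"
  shows "bounded (cylinder A B)"
proof -
  obtain a where a: "\<And>x. x \<in> A \<Longrightarrow> norm x \<le> a" using assms(1) by (auto simp: bounded_iff)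
  obtain b where b: "\<And>x. x \<in> B \<Longrightarrow> norm x \<le> b" using assms(2) by (auto simp: bounded_iff)
  have "norm x \<le> a + a + b" if "x \<in> cylinder A B" for x
  proof -
    have x: "proj12 x \<in> A" "x $ 3 \<in> B" using that by (auto simp: cylinder_def)
    have "\<bar>x $ 1\<bar> \<le> norm (proj12 x)" "\<bar>x $ 2\<bar> \<le> norm (proj12 x)"
      using component_le_norm_cart[of "proj12 x" 1] component_le_norm_cart[of "proj12 x" 2]
      by (simp_all add: proj12_def)
    moreover have "norm x \<le> (\<Sum>i\<in>UNIV. \<bar>x $ i\<bar>)" by (rule norm_le_l1_cart)
    ultimately show ?thesis using a[OF x(1)] b[OF x(2)] by (simp add: sum_3)
  qed
  then show ?thesis by (auto simp: bounded_iff)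
qed

text \<open>The third row of the matrix is zero, so the condition confines only the first two
  coordinates, to intervals of length 2\<rho>/|c1| and 2\<rho>/|c2|, while the third ranges over
  [a,b]. The power 2 is the codimension of the line on which the field vanishes.\<close>

lemma emeasure_tube:
  fixes \<Omega> :: "(real^3) set"
  assumes nz: "c1 \<noteq> 0" "c2 \<noteq> 0" and \<Omega>: "\<Omega> \<in> sets lebesgue" "\<And>x. x \<in> \<Omega> \<Longrightarrow> x $ 3 \<in> {a..b}"
    and ab: "a \<le> b" and \<rho>: "0 < \<rho>"
  shows "emeasure (lebesgue_on \<Omega>) {x \<in> space (lebesgue_on \<Omega>). norm (diag_matrix (vector [c1, c2, 0]) *v x - z) < \<rho>}
    \<le> ennreal (4 * (b - a) / (\<bar>c1\<bar> * \<bar>c2\<bar>) * \<rho> powr 2)"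
proof -
  let ?S = "{x \<in> space (lebesgue_on \<Omega>). norm (diag_matrix (vector [c1, c2, 0]) *v x - z) < \<rho>}"
  define l :: "real^3" where "l = vector [z $ 1 / c1 - \<rho> / \<bar>c1\<bar>, z $ 2 / c2 - \<rho> / \<bar>c2\<bar>, a]"
  define u :: "real^3" where "u = vector [z $ 1 / c1 + \<rho> / \<bar>c1\<bar>, z $ 2 / c2 + \<rho> / \<bar>c2\<bar>, b]"
  have coord: "y / c - \<rho> / \<bar>c\<bar> \<le> x \<and> x \<le> y / c + \<rho> / \<bar>c\<bar>" if "c \<noteq> 0" "\<bar>c * x - y\<bar> < \<rho>" for c x y :: real
  proof -
    have "c * (x - y / c) = c * x - y" using that(1) by (simp add: right_diff_distrib)
    then have "\<bar>c\<bar> * \<bar>x - y / c\<bar> = \<bar>c * x - y\<bar>" by (simp only: abs_mult[symmetric])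
    then have "\<bar>x - y / c\<bar> \<le> \<rho> / \<bar>c\<bar>" using that by (simp add: pos_le_divide_eq mult.commute)
    then show ?thesis by linarith
  qed
  have sub: "?S \<subseteq> cbox l u \<inter> \<Omega>"
  proof
    fix x assume "x \<in> ?S"
    then have x: "x \<in> \<Omega>" "norm (diag_matrix (vector [c1, c2, 0]) *v x - z) < \<rho>" by auto
    have "\<bar>c1 * x $ 1 - z $ 1\<bar> < \<rho>"
      using component_le_norm_cart[of "diag_matrix (vector [c1, c2, 0]) *v x - z" 1] x(2)
      by (simp add: diag_matrix_3_mult)
    moreover have "\<bar>c2 * x $ 2 - z $ 2\<bar> < \<rho>"
      using component_le_norm_cart[of "diag_matrix (vector [c1, c2, 0]) *v x - z" 2] x(2)
      by (simp add: diag_matrix_3_mult)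
    ultimately show "x \<in> cbox l u \<inter> \<Omega>"
      using coord[of c1 "x $ 1" "z $ 1"] coord[of c2 "x $ 2" "z $ 2"] nz \<Omega>(2)[OF x(1)] x(1)
      by (simp add: mem_box_cart forall_3 l_def u_def vector_3)
  qed
  have "emeasure (lebesgue_on \<Omega>) ?S
      \<le> emeasure (lebesgue_on \<Omega>) (cbox l u \<inter> \<Omega>)"
    using \<Omega>(1) by (intro emeasure_mono[OF sub]) (auto simp: sets_restrict_space_iff)
  also have "\<dots> = emeasure lebesgue (cbox l u \<inter> \<Omega>)" using \<Omega>(1) by (intro emeasure_restrict_space) auto
  also have "\<dots> \<le> emeasure lebesgue (cbox l u)" by (intro emeasure_mono) auto
  also have "\<dots> = ennreal (measure lebesgue (cbox l u))"
    by (rule emeasure_eq_measure2[OF lmeasurable_cbox])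
  also have "measure lebesgue (cbox l u) = (2 * \<rho> / \<bar>c1\<bar>) * (2 * \<rho> / \<bar>c2\<bar>) * (b - a)"
  proof -
    have "cbox l u \<noteq> {}"
      using ab \<rho> nz by (simp add: interval_ne_empty_cart forall_3 l_def u_def vector_3)
    then have "measure lebesgue (cbox l u) = (\<Prod>i\<in>UNIV. u $ i - l $ i)"
      by (simp add: content_cbox_cart)
    also have "\<dots> = (u $ 1 - l $ 1) * (u $ 2 - l $ 2) * (u $ 3 - l $ 3)"
      unfolding UNIV_3 by (simp add: mult.assoc)
    also have "u $ 1 - l $ 1 = 2 * \<rho> / \<bar>c1\<bar>" by (simp add: l_def u_def vector_3)
    also have "u $ 2 - l $ 2 = 2 * \<rho> / \<bar>c2\<bar>" by (simp add: l_def u_def vector_3)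
    also have "u $ 3 - l $ 3 = b - a" by (simp add: l_def u_def vector_3)
    finally show ?thesis .
  qed
  also have "\<dots> = 4 * (b - a) / (\<bar>c1\<bar> * \<bar>c2\<bar>) * \<rho> powr 2"
    using \<rho> by (simp add: powr_numeral power2_eq_square)
  finally show ?thesis .
qed

text \<open>Compactness is part of the conclusion because the ordered list of singular values is
  meaningful for compact operators. The function \<open>h\<close> is given by its continuous
  representative, so that values and one-sided derivatives at single times make sense.\<close>

theorem theorem4p4:
  fixes \<Omega>12 :: "(real^2) set" and \<Omega>3 :: "real set" and \<Omega> :: "(real^3) set"
    and a b T \<mu>0 m0 s G11 G22 :: real and I :: "real set"
    and G :: "real^3^3" and G' :: "real^2^2"
    and p :: "real^3 \<Rightarrow> real^3" and h :: "real \<Rightarrow> real^3" and h' :: "real \<Rightarrow> real^2"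
    and F :: "(real^3 \<Rightarrow> real) \<Rightarrow> real \<Rightarrow> real"
  assumes dom12: "bounded_lipschitz_domain \<Omega>12"
    and dom3: "a < b" "\<Omega>3 = {a<..<b}"
    and Omega: "\<Omega> = cylinder \<Omega>12 \<Omega>3"
    and T: "T > 0" and I: "I = {0<..<T}"
    and params: "\<mu>0 > 0" "m0 > 0"
    and G_def: "G = diag_matrix (vector [G11, G22, 0])" and G_nz: "G11 \<noteq> 0" "G22 \<noteq> 0"
    and p: "p \<in> Linfty (lebesgue_on \<Omega>)"
    and s: "s > 3/2"
    and h: "\<And>i. (\<lambda>t. h t $ i) \<in> sobolev_H s I"
    and h_rep: "continuous_on {0..T} h"
    and h3: "\<And>t. t \<in> I \<Longrightarrow> h t $ 3 = 0"
    and G'_def: "G' = diag_matrix (vector [G11, G22])"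
    and h'_def: "h' = (\<lambda>t. proj12 (h t))"
    and hyp_i: "(SUP t\<in>{0..T}. inverse (ennreal (norm (time_deriv T h' t)))) < \<infinity>"
    and hyp_ii_range: "\<And>t. t \<in> I \<Longrightarrow> matrix_inv G' *v h' t \<in> \<Omega>12"
    and hyp_ii_card: "\<exists>N_h::nat. \<forall>y\<in>\<Omega>12.
          finite {t \<in> I. h' t = G' *v y} \<and> card {t \<in> I. h' t = G' *v y} \<le> N_h"
    and F_def: "F = F_limit \<Omega> T \<mu>0 m0 G p h"
  shows "compact_L2_operator (lebesgue_on \<Omega>) (lebesgue_on I) F \<and>
         (\<forall>\<epsilon>. 0 < \<epsilon> \<and> \<epsilon> < 1/4 \<longrightarrow>
            (\<exists>C. \<forall>n\<ge>1. singular_value (lebesgue_on \<Omega>) (lebesgue_on I) F n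
                          \<le> C * real n powr (- 1/4 + \<epsilon>)))"
proof -
  define D where "D = time_deriv T h"
  have "\<exists>Di. continuous_on {0..T} Di \<and>
      (\<forall>t\<in>{0..T}. ((\<lambda>t. h t $ i) has_vector_derivative Di t) (at t within {0..T}))" for i
    using h[of i] h_rep T s unfolding I by (intro sobolev_C1[of T s]) (auto intro!: continuous_intros)
  then obtain Di where Di: "\<And>i. continuous_on {0..T} (Di i)"
    "\<And>i t. t \<in> {0..T} \<Longrightarrow> ((\<lambda>t. h t $ i) has_vector_derivative Di i t) (at t within {0..T})" by metis
  have h_sum: "h = (\<lambda>t. \<Sum>i\<in>UNIV. (h t $ i) *\<^sub>R axis i 1)"
    using basis_expansion[of "h _"] by (simp add: scalar_mult_eq_scaleR)
  have hv: "(h has_vector_derivative (\<Sum>i\<in>UNIV. Di i t *\<^sub>R axis i 1)) (at t within {0..T})" if "t \<in> {0..T}" for t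
    by (subst h_sum) (intro has_vector_derivative_sum
      bounded_linear.has_vector_derivative[OF bounded_linear_scaleR_left] Di(2) that)
  have D_eq: "D t = (\<Sum>i\<in>UNIV. Di i t *\<^sub>R axis i 1)" if "t \<in> {0..T}" for t
    unfolding D_def time_deriv_def using hv[OF that] that T
    by (intro vector_derivative_within_cbox[of 0 T, unfolded cbox_interval]) auto
  have hD: "(h has_vector_derivative D t) (at t within {0..T})" if "t \<in> {0..T}" for t
    using hv[OF that] by (simp only: D_eq[OF that])
  have D_cont: "continuous_on {0..T} D"
  proof (rule continuous_on_cong[OF refl D_eq, THEN iffD2])
    show "continuous_on {0..T} (\<lambda>t. \<Sum>i\<in>UNIV. Di i t *\<^sub>R axis i (1::real))"
      by (intro continuous_on_sum continuous_on_scaleR continuous_on_const Di(1))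
  qed
  have D_nz: "D t \<noteq> 0" if t: "t \<in> {0..T}" for t
  proof
    assume "D t = 0"
    have "(h' has_vector_derivative proj12 (D t)) (at t within {0..T})"
      unfolding h'_def by (rule bounded_linear.has_vector_derivative[OF bounded_linear_proj12 hD[OF t]])
    then have "time_deriv T h' t = proj12 (D t)"
      unfolding time_deriv_def using t T
      by (intro vector_derivative_within_cbox[of 0 T, unfolded cbox_interval]) auto
    then have "time_deriv T h' t = 0"
      using \<open>D t = 0\<close> linear_0[OF bounded_linear.linear[OF bounded_linear_proj12]] by simp
    \<comment> \<open>In \<open>ennreal\<close> the inverse of 0 is \<infinity>, so the finite
      supremum excludes a vanishing derivative at every time, end points included.\<close>
    then have "inverse (ennreal (norm (time_deriv T h' t))) = \<infinity>" by simp
    moreover have "inverse (ennreal (norm (time_deriv T h' t))) < \<infinity>"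
      by (rule le_less_trans[OF SUP_upper[OF t] hyp_i])
    ultimately show False by simp
  qed
  obtain L where L: "0 < L" "\<And>t. t \<in> {0..T} \<Longrightarrow> norm (D t) \<le> L"
    "\<And>s t. s \<in> {0..T} \<Longrightarrow> t \<in> {0..T} \<Longrightarrow> norm (h t - h s) \<le> L * \<bar>t - s\<bar>"
    using C1_Lipschitz[OF D_cont hD] by blast
  obtain C1 where C1: "0 \<le> C1" "\<And>z \<rho>. 0 < \<rho> \<Longrightarrow>
    emeasure (lebesgue_on {0<..<T}) {t \<in> {0<..<T}. norm (z - h t) < \<rho>} \<le> ennreal (C1 * \<rho>)"
    using regular_curve_measure[OF T D_cont hD D_nz] by blast
  have \<Omega>12: "open \<Omega>12" "bounded \<Omega>12" using dom12 by (auto simp: bounded_lipschitz_domain_def)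
  have \<Omega>_open: "open \<Omega>" unfolding Omega dom3(2) using \<Omega>12 by (intro open_cylinder) auto
  have \<Omega>_bdd: "bounded \<Omega>" unfolding Omega dom3(2) using \<Omega>12 by (intro bounded_cylinder) auto
  have \<Omega>_lm: "\<Omega> \<in> lmeasurable" using \<Omega>_bdd \<Omega>_open by (rule lmeasurable_open)
  then have \<Omega>_sets: "\<Omega> \<in> sets lebesgue" by (rule fmeasurableD)
  interpret M: finite_measure "lebesgue_on \<Omega>" by (rule finite_measure_lebesgue_on[OF \<Omega>_lm])
  interpret N: finite_measure "lebesgue_on {0<..<T}" by (rule finite_measure_Ioo)
  have G_meas[measurable]: "(\<lambda>x. G *v x) \<in> borel_measurable (lebesgue_on \<Omega>)"
    using \<Omega>_sets by (intro continuous_imp_measurable_on_sets_lebesgue)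
      (auto intro: linear_continuous_on simp: linear_conv_bounded_linear[symmetric] matrix_vector_mul_linear)
  have h_meas[measurable]: "h \<in> borel_measurable (lebesgue_on {0<..<T})"
    by (rule continuous_imp_measurable_on_sets_lebesgue) (auto intro: continuous_on_subset[OF h_rep])
  have D_meas[measurable]: "D \<in> borel_measurable (lebesgue_on {0<..<T})"
    by (rule continuous_imp_measurable_on_sets_lebesgue) (auto intro: continuous_on_subset[OF D_cont])
  obtain P' where p_meas: "p \<in> borel_measurable (lebesgue_on \<Omega>)" and P': "AE x in lebesgue_on \<Omega>. norm (p x) \<le> P'"
    using p by (auto simp: Linfty_def)
  define P where "P = max P' 0"
  have P: "AE x in lebesgue_on \<Omega>. norm (p x) \<le> P" "0 \<le> P"
    using P' by (auto simp: P_def elim: eventually_mono)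
  obtain B where B: "\<And>x. x \<in> \<Omega> \<Longrightarrow> norm (G *v x) \<le> B"
    using bounded_linear_image[OF \<Omega>_bdd, of "\<lambda>x. G *v x"] unfolding bounded_iff
    by (auto simp: matrix_vector_mul_linear linear_conv_bounded_linear[symmetric])
  have "bounded (h ` {0..T})" using h_rep by (intro compact_imp_bounded compact_continuous_image) auto
  then obtain B' where B': "\<forall>y\<in>h ` {0..T}. norm y \<le> B'" unfolding bounded_iff by blast
  define R where "R = max 1 (B + B')"
  have R: "norm (G *v x - h t) \<le> R" if "x \<in> \<Omega>" "t \<in> {0<..<T}" for x t
  proof -
    have "norm (h t) \<le> B'" using B' that by auto
    then show ?thesis using norm_triangle_ineq4[of "G *v x" "h t"] B[OF that(1)] unfolding R_def by linarith
  qed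
  define V where "V = measure (lebesgue_on \<Omega>) \<Omega>"
  \<comment> \<open>The bounds of \<open>nn_integral_powr_neg_bound\<close> for q = 7/4, d = 2 in
    space and q = 3/4, d = 1 in time. Both geometric series have ratio 2^(-1/4).\<close>
  define KM where "KM = V + 4 * (b - a) / (\<bar>G11\<bar> * \<bar>G22\<bar>) * 2 powr (7/4 + 2) / (1 - 2 powr (7/4 - 2))"
  define KN where "KN = T + C1 * 2 powr (3/4 + 1) / (1 - 2 powr (3/4 - 1))"
  have quarter: "(2::real) powr (- (1/4)) < 1" by (intro powr_less_one) auto
  have ws: "weakly_singular (lebesgue_on \<Omega>) (lebesgue_on {0<..<T}) (\<lambda>x t. norm (G *v x - h t)) KM KN"
  proof
    show "(\<lambda>(x, t). norm (G *v x - h t)) \<in> borel_measurable (lebesgue_on \<Omega> \<Otimes>\<^sub>M lebesgue_on {0<..<T})"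
      by measurable
    show "0 \<le> KM" unfolding KM_def V_def using dom3(1) quarter
      by (intro add_nonneg_nonneg divide_nonneg_nonneg mult_nonneg_nonneg) auto
    show "0 \<le> KN" unfolding KN_def using T C1(1) quarter
      by (intro add_nonneg_nonneg divide_nonneg_nonneg mult_nonneg_nonneg) auto
    fix t assume t: "t \<in> space (lebesgue_on {0<..<T})"
    show "(\<integral>\<^sup>+x. ennreal (norm (G *v x - h t) powr (- (7/4))) \<partial>lebesgue_on \<Omega>) \<le> ennreal KM"
      unfolding KM_def
    proof (rule nn_integral_powr_neg_bound)
      show "emeasure (lebesgue_on \<Omega>) {x \<in> space (lebesgue_on \<Omega>). norm (G *v x - h t) < \<rho>}
          \<le> ennreal (4 * (b - a) / (\<bar>G11\<bar> * \<bar>G22\<bar>) * \<rho> powr 2)" if "0 < \<rho>" for \<rho>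
        unfolding G_def using G_nz \<Omega>_sets dom3 that
        by (intro emeasure_tube) (auto simp: Omega cylinder_def)
      show "emeasure (lebesgue_on \<Omega>) (space (lebesgue_on \<Omega>)) \<le> ennreal V"
        by (simp add: V_def M.emeasure_eq_measure)
    qed (use dom3(1) in \<open>auto simp: V_def\<close>)
  next
    fix x assume x: "x \<in> space (lebesgue_on \<Omega>)"
    show "(\<integral>\<^sup>+t. ennreal (norm (G *v x - h t) powr (- (3/4))) \<partial>lebesgue_on {0<..<T}) \<le> ennreal KN"
      unfolding KN_def
    proof (rule nn_integral_powr_neg_bound)
      show "emeasure (lebesgue_on {0<..<T}) {t \<in> space (lebesgue_on {0<..<T}). norm (G *v x - h t) < \<rho>}
          \<le> ennreal (C1 * \<rho> powr 1)" if "0 < \<rho>" for \<rho>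
        using C1(2)[OF that, of "G *v x"] that by simp
      show "emeasure (lebesgue_on {0<..<T}) (space (lebesgue_on {0<..<T})) \<le> ennreal T"
        using T by (simp add: emeasure_restrict_space)
    qed (use T C1(1) in auto)
  qed
  have F_eq: "F = (\<lambda>c t. LINT x|lebesgue_on \<Omega>. c x * (- (\<mu>0 * m0) * (perp (G *v x - h t) (p x) \<bullet> D t)))"
    unfolding F_def F_limit_def D_def kappa_limit_perp field_H_def by (rule refl)
  have Rpos: "0 < R" by (simp add: R_def)
  have main: "compact_L2_operator (lebesgue_on \<Omega>) (lebesgue_on I) F"
    "\<exists>C\<ge>0. \<forall>n\<ge>1. singular_value (lebesgue_on \<Omega>) (lebesgue_on I) F n \<le> C * real n powr (- (1/4))"
    unfolding F_eq I
    by (rule perp_kernel_singular_values[OF ws T G_meas p_meas h_meas D_meas P L(1) _ L(3) Rpos R]; simp add: L(2))+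
  then obtain C where C: "0 \<le> C"
    "\<And>n. 1 \<le> n \<Longrightarrow> singular_value (lebesgue_on \<Omega>) (lebesgue_on I) F n \<le> C * real n powr (- (1/4))"
    by blast
  have "singular_value (lebesgue_on \<Omega>) (lebesgue_on I) F n \<le> C * real n powr (- 1/4 + \<epsilon>)"
    if "0 < \<epsilon>" "1 \<le> n" for \<epsilon> n
  proof -
    \<comment> \<open>Since n \<ge> 1, raising the exponent by \<epsilon> only enlarges the bound,
      so one constant serves every \<epsilon>.\<close>
    have "C * real n powr (- (1/4)) \<le> C * real n powr (- 1/4 + \<epsilon>)"
      using that C(1) by (intro mult_left_mono powr_mono) auto
    with C(2)[OF that(2)] show ?thesis by linarith
  qed
  with main(1) show ?thesis by blast
qed

end
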